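(* Assume the Riemann hypothesis. There exist absolute constants $C>0$ and $c_0>0$ such that for all $0<\varepsilon,\delta<c_0$ there is $X_0=X_0(\varepsilon,\delta)$ such that the following holds for all $X\ge X_0$. Let $\mathcal{X}\subseteq [X,2X]$ be a set such that $$|x-x'|\ge X^{1-(1-2\delta)(2\pi\varepsilon)^{1/2}}\quad\text{for all distinct } x,x'\in\mathcal{X},$$ and $$|\psi(x)-x|\ge \varepsilon(\log x)^2x^{1/2}\quad\text{for all } x\in\mathcal{X}.$$ Then $$|\mathcal{X}|\le \exp\left(\frac{C}{(\varepsilon\delta)^2}\right).$$
   Context: $\psi(x)=\sum_{n\le x}\Lambda(n)$ is the Chebyshev function, where $\Lambda$ is the von Mangoldt function. The Riemann hypothesis (every non-trivial zero of the Riemann zeta function has real part $1/2$) is a standing assumption. *)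

theory Defs
  imports "HOL-Complex_Analysis.Complex_Analysis" "HOL-Number_Theory.Prime_Powers"
begin

text \<open>
  The Riemann zeta function is the analytic continuation of the Dirichlet series
  \<open>\<Sum>n\<ge>1. n powr (-s)\<close> from \<open>Re s > 1\<close> to the complex plane without the point \<open>1\<close>.
  By the identity theorem the choice operator fixes its value everywhere except at the
  pole \<open>1\<close>, where the value is arbitrary and is never used.
\<close>

definition riemann_zeta :: "complex \<Rightarrow> complex" where
  "riemann_zeta = (SOME f. f holomorphic_on (- {1}) \<and>
     (\<forall>s. Re s > 1 \<longrightarrow> (\<lambda>n::nat. of_nat (Suc n) powr (- s)) sums f s))"

text \<open>The trivial zeros are the negative even integers.\<close>

definition nontrivial_zeta_zero :: "complex \<Rightarrow> bool" where
  "nontrivial_zeta_zero s \<longleftrightarrow>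
     s \<noteq> 1 \<and> riemann_zeta s = 0 \<and> (\<forall>n::nat. n \<ge> 1 \<longrightarrow> s \<noteq> - of_nat (2 * n))"

definition riemann_hypothesis :: bool where
  "riemann_hypothesis \<longleftrightarrow> (\<forall>s. nontrivial_zeta_zero s \<longrightarrow> Re s = 1 / 2)"

definition chebyshev_psi :: "real \<Rightarrow> real" where
  "chebyshev_psi x = (\<Sum>n | n \<ge> 1 \<and> real n \<le> x. mangoldt n)"

end

theory Submission
  imports Defs "HOL-Probability.Probability" "HOL-Real_Asymp.Real_Asymp"
begin

text \<open>No zeros of the zeta function are summed. Under the Riemann hypothesis the Phragmen-Lindelof principle gives
  \<open>|\<xi>(s - h)| \<le> |\<xi>(s + h)|\<close> for \<open>Re s \<ge> 1/2\<close>, so \<open>Re (\<xi>'/\<xi>) \<ge> 0\<close> to the right of the critical line.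
  Perron's formula then expresses \<open>\<psi>(x) - x\<close>, up to a small error, through the integral of \<open>x\<^sup>s / s\<close> over
  \<open>Re s = 1/2 + b\<close> against this positive density, where \<open>b\<close> has order \<open>1 / log x\<close>. The frequencies below
  \<open>T0 = X powr ((1 - \<delta>) * sqrt (2 * pi * \<epsilon>))\<close> contribute at most about
  \<open>(log T0)\<^sup>2 * sqrt x / (2 * pi)\<close>, which is \<open>(1 - \<delta>)\<^sup>2 * \<epsilon> * (log x)\<^sup>2 * sqrt x\<close>, so a deviation of size
  \<open>\<epsilon> * (log x)\<^sup>2 * sqrt x\<close> forces the frequencies above \<open>T0\<close> to contribute a proportion \<open>\<delta>\<close> of it. For
  points separated by much more than \<open>X / T0\<close> these high-frequency parts are almost orthogonal with respect to the
  density, and a large-values (duality) argument bounds the number of points, even by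
  \<open>O((\<epsilon> * \<delta>) powr (-2))\<close>.\<close>

section \<open>The functional equation of the theta function\<close>

text \<open>Positivity stands in for information on the vertical distribution of the zeros. The
  means of \<open>ReG\<close> against \<open>1 / t\<close> and \<open>cos (t * y) / t\<close> are
  those of the archimedean term \<open>Aco\<close>, because \<open>Aco - Glog\<close> is analytic
  right of the critical line and can be moved to \<open>Re s = 2\<close>, where it is bounded; the
  cost is \<open>1 / b + ln T\<close>. For \<open>b\<close> of order \<open>1 / ln X\<close> this is
  a single logarithm, while the diagonal carries the square of \<open>ln T\<close>. Off the diagonal
  \<open>Aco\<close> oscillates and also leaves one logarithm. This gap of one logarithm makes the
  count independent of \<open>X\<close>. The width \<open>b\<close> is squeezed from two sides: a
  smaller order of magnitude would spoil this error, a larger one would make \<open>u powr b\<close>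
  grow with \<open>X\<close>. With \<open>b = \<delta> / (2 * ln X)\<close> the loss is at most
  \<open>exp \<delta>\<close>. This is why \<open>T0\<close> carries \<open>1 - \<delta>\<close>,
  which enters squared: one factor pays for \<open>exp \<delta>\<close>, the other leaves the
  surplus. What is needed about zeta is the functional equation, polynomial growth and the Dirichlet
  series; all of it is derived from the theta function.\<close>

lemma tendsto_integral_uniform_limit:
  fixes f :: "'a \<Rightarrow> real \<Rightarrow> 'c::banach"
  assumes u: "uniform_limit {a..b} f g F"
  assumes c: "\<And>n. continuous_on {a..b} (f n)"
  assumes "F \<noteq> bot"
  shows "((\<lambda>n. integral {a..b} (f n)) \<longlongrightarrow> integral {a..b} g) F"
proof -
  obtain I J where IJ: "\<And>n. (f n has_integral I n) {a..b}" "(g has_integral J) {a..b}" "(I \<longlongrightarrow> J) F"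
    using uniform_limit_integral[OF assms] by blast
  have "I = (\<lambda>n. integral {a..b} (f n))" by (rule ext, rule integral_unique[OF IJ(1), symmetric])
  moreover have "J = integral {a..b} g" using IJ(2) by (rule integral_unique[symmetric])
  ultimately show ?thesis using IJ(3) by simp
qed

text \<open>These sines are orthogonal on the interval, so Bessel's inequality makes the squares of
  the coefficients summable and the coefficients tend to 0. Later \<open>R\<close> is a Fourier
  remainder divided by \<open>sin (pi * x)\<close>.\<close>

lemma Riemann_Lebesgue_odd_sines:
  fixes R :: "real \<Rightarrow> real"
  assumes cont: "continuous_on {-(1/2)..1/2} R"
  shows "(\<lambda>M. integral {-(1/2)..1/2} (\<lambda>x. R x * sin ((2 * real M + 1) * pi * x))) \<longlonglongrightarrow> 0"
proof -
  let ?I = "{-(1/2)..1/2::real}"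
  define \<phi> where "\<phi> M x = sin ((2 * real M + 1) * pi * x)" for M :: nat and x :: real
  define c where "c M = integral ?I (\<lambda>x. R x * \<phi> M x)" for M
  have contphi: "continuous_on ?I (\<phi> M)" for M unfolding \<phi>_def by (intro continuous_intros)
  have cosint: "integral ?I (\<lambda>x. cos (2 * real_of_int k * pi * x)) = (if k = 0 then 1 else 0)" for k :: int
  proof (cases "k = 0")
    case False
    define a where "a = 2 * real_of_int k * pi"
    have a: "a \<noteq> 0" using False by (simp add: a_def)
    have d: "((\<lambda>x. sin (a * x) / a) has_real_derivative cos (a * x)) (at x within ?I)" for x
      using a by (auto intro!: derivative_eq_intros)
    have "((\<lambda>x. cos (a * x)) has_integral (sin (a * (1/2)) / a - sin (a * (-(1/2))) / a)) ?I"
      by (rule fundamental_theorem_of_calculus)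
         (use d in \<open>auto simp flip: has_real_derivative_iff_has_vector_derivative\<close>)
    then have "((\<lambda>x. cos (2 * real_of_int k * pi * x)) has_integral (2 * sin (real_of_int k * pi) / a)) ?I"
      by (simp add: a_def mult_ac)
    moreover have "sin (real_of_int k * pi) = 0" by (auto simp: sin_zero_iff_int2)
    ultimately show ?thesis using False by (simp add: integral_unique)
  qed (simp)
  have orth: "integral ?I (\<lambda>x. \<phi> M x * \<phi> K x) = (if M = K then 1/2 else 0)" for M K
  proof -
    have eq: "\<phi> M x * \<phi> K x = (1/2) * cos (2 * real_of_int (int M - int K) * pi * x)
            - (1/2) * cos (2 * real_of_int (int M + int K + 1) * pi * x)" for x
      unfolding \<phi>_def sin_times_sin by (simp add: algebra_simps diff_divide_distrib add_divide_distrib)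
    have int: "(\<lambda>x. cos (2 * real_of_int k * pi * x)) integrable_on ?I" for k
      by (intro integrable_continuous_real continuous_intros)
    have ne: "int M + int K + 1 \<noteq> 0" by linarith
    have "integral ?I (\<lambda>x. \<phi> M x * \<phi> K x) = (1/2) * integral ?I (\<lambda>x. cos (2 * real_of_int (int M - int K) * pi * x))
            - (1/2) * integral ?I (\<lambda>x. cos (2 * real_of_int (int M + int K + 1) * pi * x))"
      unfolding eq using int[of "int M - int K"] int[of "int M + int K + 1"]
      by (subst integral_diff) (auto intro!: integrable_on_cmult_left simp del: of_int_add of_int_diff of_int_of_nat_eq)
    also have "\<dots> = (if M = K then 1/2 else 0)"
      unfolding cosint using ne by simp
    finally show ?thesis .
  qed
  have bessel: "(\<Sum>M<n. 2 * (c M)\<^sup>2) \<le> integral ?I (\<lambda>x. (R x)\<^sup>2)" for n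
  proof -
    \<comment> \<open>The factor 2 is the reciprocal of the squared norm 1/2 of each sine, so
      \<open>S\<close> is the orthogonal projection of \<open>R\<close> onto the first
      \<open>n\<close> of them.\<close>
    define S where "S x = (\<Sum>M<n. 2 * c M * \<phi> M x)" for x
    have contS: "continuous_on ?I S" unfolding S_def by (intro continuous_intros contphi)
    have i1: "integral ?I (\<lambda>x. R x * S x) = (\<Sum>M<n. 2 * (c M)\<^sup>2)"
    proof -
      have "integral ?I (\<lambda>x. R x * S x) = integral ?I (\<lambda>x. \<Sum>M<n. 2 * c M * (R x * \<phi> M x))"
        unfolding S_def by (simp add: sum_distrib_left mult_ac)
      also have "\<dots> = (\<Sum>M<n. integral ?I (\<lambda>x. 2 * c M * (R x * \<phi> M x)))"
        by (rule integral_sum) (auto intro!: integrable_continuous_real continuous_intros cont contphi)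
      also have "\<dots> = (\<Sum>M<n. 2 * (c M)\<^sup>2)"
        by (intro sum.cong refl) (simp add: c_def power2_eq_square)
      finally show ?thesis .
    qed
    have i2: "integral ?I (\<lambda>x. S x * S x) = (\<Sum>M<n. 2 * (c M)\<^sup>2)"
    proof -
      have "integral ?I (\<lambda>x. S x * S x) = integral ?I (\<lambda>x. \<Sum>M<n. \<Sum>K<n. 4 * c M * c K * (\<phi> M x * \<phi> K x))"
        unfolding S_def sum_product by (simp add: mult_ac)
      also have "\<dots> = (\<Sum>M<n. integral ?I (\<lambda>x. \<Sum>K<n. 4 * c M * c K * (\<phi> M x * \<phi> K x)))"
        by (rule integral_sum) (auto intro!: integrable_continuous_real continuous_intros contphi)
      also have "\<dots> = (\<Sum>M<n. \<Sum>K<n. integral ?I (\<lambda>x. 4 * c M * c K * (\<phi> M x * \<phi> K x)))"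
        by (intro sum.cong refl integral_sum) (auto intro!: integrable_continuous_real continuous_intros contphi)
      also have "\<dots> = (\<Sum>M<n. \<Sum>K<n. 4 * c M * c K * (if M = K then 1/2 else 0))"
        using orth by simp
      also have "\<dots> = (\<Sum>M<n. \<Sum>K<n. if K = M then 2 * c M * c M else 0)"
        by (intro sum.cong refl) auto
      also have "\<dots> = (\<Sum>M<n. 2 * (c M)\<^sup>2)"
        by (simp add: power2_eq_square mult.assoc)
      finally show ?thesis .
    qed
    have "0 \<le> integral ?I (\<lambda>x. (R x - S x)\<^sup>2)"
      by (rule integral_nonneg) (auto intro!: integrable_continuous_real continuous_intros cont contS)
    also have "\<dots> = integral ?I (\<lambda>x. (R x)\<^sup>2 - 2 * (R x * S x) + S x * S x)"
      by (simp add: power2_eq_square algebra_simps)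
    also have "\<dots> = integral ?I (\<lambda>x. (R x)\<^sup>2) - 2 * integral ?I (\<lambda>x. R x * S x) + integral ?I (\<lambda>x. S x * S x)"
    proof -
      have i: "(\<lambda>x. (R x)\<^sup>2) integrable_on ?I" "(\<lambda>x. 2 * (R x * S x)) integrable_on ?I" "(\<lambda>x. S x * S x) integrable_on ?I"
        by (intro integrable_continuous_real continuous_intros cont contS)+
      have "integral ?I (\<lambda>x. (R x)\<^sup>2 - 2 * (R x * S x) + S x * S x) =
        integral ?I (\<lambda>x. (R x)\<^sup>2 - 2 * (R x * S x)) + integral ?I (\<lambda>x. S x * S x)"
        by (rule integral_add) (use i in \<open>auto intro: integrable_diff\<close>)
      also have "integral ?I (\<lambda>x. (R x)\<^sup>2 - 2 * (R x * S x)) =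
        integral ?I (\<lambda>x. (R x)\<^sup>2) - integral ?I (\<lambda>x. 2 * (R x * S x))"
        by (rule integral_diff) (use i in auto)
      finally show ?thesis by simp
    qed
    finally show ?thesis unfolding i1 i2 by simp
  qed
  have "summable (\<lambda>M. 2 * (c M)\<^sup>2)"
    by (rule summableI_nonneg_bounded[where x = "integral ?I (\<lambda>x. (R x)\<^sup>2)"]) (use bessel in auto)
  then have "(\<lambda>M. 2 * (c M)\<^sup>2) \<longlonglongrightarrow> 0" by (rule summable_LIMSEQ_zero)
  then have "(\<lambda>M. (c M)\<^sup>2) \<longlonglongrightarrow> 0"
    by (subst (asm) tendsto_mult_left_iff[where c=2 and l=0, simplified]) auto
  then have "(\<lambda>M. sqrt ((c M)\<^sup>2)) \<longlonglongrightarrow> sqrt 0" by (rule tendsto_real_sqrt)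
  then have "c \<longlonglongrightarrow> 0" by (simp add: tendsto_rabs_zero_iff)
  then show ?thesis unfolding c_def \<phi>_def .
qed

section \<open>The Gaussian and its Fourier transform\<close>

definition gau :: "real \<Rightarrow> real \<Rightarrow> real" where
  "gau t x = exp (- (pi * t * x\<^sup>2))"

text \<open>The characteristic function of the standard normal distribution is this integral up to
  rescaling the variable by \<open>sqrt (2 * pi * t)\<close>.\<close>

lemma gau_cos_integral:
  assumes t: "t > 0"
  shows "((\<lambda>x. gau t x * cos (2 * pi * m * x)) has_integral exp (- (pi * m\<^sup>2 / t)) / sqrt t) UNIV"
proof -
  define a where "a = sqrt (2 * pi * t)"
  have a: "a > 0" using t by (simp add: a_def)
  define u where "u = 2 * pi * m / a"
  have "char std_normal_distribution u = exp (- (u\<^sup>2) / 2)"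
    using char_std_normal_distribution by (metis of_real_exp)
  then have "(CLINT x|std_normal_distribution. iexp (u * x)) = exp (- (u\<^sup>2) / 2)"
    by (simp add: char_def)
  moreover have "(CLINT x|std_normal_distribution. iexp (u * x)) = (CLINT x|lborel. std_normal_density x *\<^sub>R iexp (u * x))"
    by (subst integral_density) (auto simp: )
  ultimately have e1: "(CLINT x|lborel. std_normal_density x *\<^sub>R iexp (u * x)) = complex_of_real (exp (- (u\<^sup>2) / 2))" by simp
  have int: "integrable lborel (\<lambda>x. std_normal_density x *\<^sub>R iexp (u * x))"
    by (rule Bochner_Integration.integrable_bound[of lborel "\<lambda>x. std_normal_density x"])
       (auto)
  have "(LBINT x. Re (std_normal_density x *\<^sub>R iexp (u * x))) = exp (- (u\<^sup>2) / 2)"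
    using integral_Re[OF int] e1 by (simp only: Re_complex_of_real)
  then have e2: "(LBINT x. std_normal_density x * cos (u * x)) = exp (- (u\<^sup>2) / 2)"
    by (simp add: Re_exp)
  have int2: "integrable lborel (\<lambda>x. std_normal_density x * cos (u * x))"
    using integrable_Re[OF int] by (simp add: Re_exp)
  have "has_bochner_integral lborel (\<lambda>x. std_normal_density x * cos (u * x)) (exp (- (u\<^sup>2) / 2))"
    using e2 int2 has_bochner_integral_iff by blast
  then have "has_bochner_integral lborel (\<lambda>x. std_normal_density (0 + a * x) * cos (u * (0 + a * x))) (exp (- (u\<^sup>2) / 2) /\<^sub>R \<bar>a\<bar>)"
    using lborel_has_bochner_integral_real_affine_iff[of a "\<lambda>x. std_normal_density x * cos (u * x)" "exp (- (u\<^sup>2) / 2)" 0] a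
    by blast
  then have "has_bochner_integral lborel (\<lambda>x. std_normal_density (a * x) * cos (u * (a * x))) (exp (- (u\<^sup>2) / 2) / a)"
    using a by (simp only: add_0_left abs_of_pos real_scaleR_def divide_inverse mult.commute)
  then have "has_bochner_integral lborel (\<lambda>x. sqrt (2*pi) * (std_normal_density (a * x) * cos (u * (a * x)))) (sqrt (2*pi) * (exp (- (u\<^sup>2) / 2) / a))"
    by (rule has_bochner_integral_mult_right)
  moreover have "sqrt (2*pi) * (std_normal_density (a * x) * cos (u * (a * x))) = gau t x * cos (2 * pi * m * x)" for x
  proof -
    have "a\<^sup>2 = 2*pi*t" using t by (simp add: a_def)
    then have "- (a*x)\<^sup>2/2 = - (pi*t*x\<^sup>2)" by (simp add: power_mult_distrib)
    moreover have "u * (a * x) = 2 * pi * m * x" using a by (simp add: u_def field_simps)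
    ultimately have 1: "std_normal_density (a * x) = exp (- (pi * t * x\<^sup>2)) / sqrt (2*pi)" "u * (a * x) = 2 * pi * m * x"
      unfolding std_normal_density_def by simp_all
    have "sqrt (2*pi) * (e / sqrt (2*pi) * c) = e * c" for e c :: real by simp
    then show ?thesis unfolding 1 gau_def .
  qed
  moreover have "sqrt (2*pi) * (exp (- (u\<^sup>2) / 2) / a) = exp (- (pi * m\<^sup>2 / t)) / sqrt t"
  proof -
    have "u\<^sup>2 / 2 = pi * m\<^sup>2 / t" using t unfolding u_def a_def
      by (simp add: power_divide power_mult_distrib) (simp add: field_simps power2_eq_square)
    then show ?thesis by (simp add: a_def real_sqrt_mult)
  qed
  ultimately have "has_bochner_integral lborel (\<lambda>x. gau t x * cos (2 * pi * m * x)) (exp (- (pi * m\<^sup>2 / t)) / sqrt t)"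
    by simp
  then have "integrable lborel (\<lambda>x. gau t x * cos (2 * pi * m * x))"
    and "integral\<^sup>L lborel (\<lambda>x. gau t x * cos (2 * pi * m * x)) = exp (- (pi * m\<^sup>2 / t)) / sqrt t"
    by (simp_all only: has_bochner_integral_iff)
  then show ?thesis using has_integral_integral_lborel[of "\<lambda>x. gau t x * cos (2 * pi * m * x)"] by simp
qed

lemma gau_minus [simp]: "gau t (-x) = gau t x" by (simp add: gau_def)
lemma gau_nonneg [simp]: "gau t x \<ge> 0" by (simp add: gau_def)
lemma gau_cont [continuous_intros]: "continuous_on S (gau t)" unfolding gau_def by (intro continuous_intros)

text \<open>The offset 1/4 fits \<open>\<bar>x\<bar> \<le> 3/4\<close>: there
  \<open>x + (n + 1)\<close> and \<open>x - (n + 1)\<close> both have modulus at least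
  \<open>n + 1/4\<close>. A geometric majorant is enough for the M-test.\<close>

lemma gau_le_geom:
  assumes "t > 0" "\<bar>x\<bar> \<ge> real n + 1/4"
  shows "gau t x \<le> exp (- (pi * t / 4)) ^ n"
proof -
  have "(real n + 1/4)\<^sup>2 = (real n)\<^sup>2 + real n / 2 + 1/16"
    by (simp add: power2_eq_square algebra_simps)
  then have "real n / 4 \<le> (real n + 1/4)\<^sup>2"
    using zero_le_power2[of "real n"] by simp
  also have "\<dots> \<le> \<bar>x\<bar>\<^sup>2" using assms by (intro power_mono) auto
  finally have "real n / 4 \<le> x\<^sup>2" by simp
  then have "pi * t * (real n / 4) \<le> pi * t * x\<^sup>2" using assms by (intro mult_left_mono) auto
  then have "- (pi * t * x\<^sup>2) \<le> real n * - (pi * t / 4)" by (simp only: mult_ac times_divide_eq_right times_divide_eq_left mult_minus_right)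
  then have "gau t x \<le> exp (real n * - (pi * t / 4))" unfolding gau_def by (simp only: exp_le_cancel_iff)
  then show ?thesis by (simp only: exp_of_nat_mult)
qed

lemma gau_deriv: "(gau t has_real_derivative (- (2 * pi * t * x) * gau t x)) (at x within S)"
  unfolding gau_def by (auto intro!: derivative_eq_intros)

section \<open>Periodisation of the Gaussian and Poisson summation at the origin\<close>

definition wrap :: "real \<Rightarrow> nat \<Rightarrow> real \<Rightarrow> real" where
  "wrap t n x = gau t (x + (real n + 1)) + gau t (x - (real n + 1))"

text \<open>The sum of all integer translates. The translates by \<open>n + 1\<close> and
  \<open>- (n + 1)\<close> are paired, so that the sum runs over the naturals and each summand is
  even.\<close>

definition wrapped :: "real \<Rightarrow> real \<Rightarrow> real" where
  "wrapped t x = gau t x + (\<Sum>n. wrap t n x)"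

lemma wrap_cont [continuous_intros]: "continuous_on S (wrap t n)"
  unfolding wrap_def gau_def by (intro continuous_intros)

context
  fixes t :: real and q :: real
  assumes t: "t > 0"
  defines "q \<equiv> exp (- (pi * t / 4))"
begin

lemma q_bounds: "0 < q" "q < 1" using t by (auto simp: q_def)

lemma wrap_bound: "\<bar>x\<bar> \<le> 3/4 \<Longrightarrow> norm (wrap t n x) \<le> 2 * q ^ n"
proof -
  assume x: "\<bar>x\<bar> \<le> 3/4"
  have "gau t (x + (real n + 1)) \<le> q ^ n" "gau t (x - (real n + 1)) \<le> q ^ n"
    unfolding q_def by (rule gau_le_geom[OF t]; use x in linarith)+
  then show ?thesis by (simp add: wrap_def)
qed

lemma summable_q: "summable (\<lambda>n. 2 * q ^ n)" using q_bounds by (auto intro!: summable_mult summable_geometric)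

lemma wrap_uniform: "uniform_limit {-(3/4)..3/4} (\<lambda>n x. \<Sum>i<n. wrap t i x) (\<lambda>x. \<Sum>i. wrap t i x) sequentially"
  by (rule Weierstrass_m_test[OF wrap_bound summable_q]) auto

lemma wrapped_cont: "continuous_on {-(1/2)..1/2} (wrapped t)"
proof -
  have "continuous_on {-(3/4)..3/4} (\<lambda>x. \<Sum>i. wrap t i x)"
    by (rule uniform_limit_theorem[OF _ wrap_uniform]) (auto intro!: always_eventually continuous_intros)
  then have "continuous_on {-(3/4)..3/4} (wrapped t)"
    unfolding wrapped_def by (intro continuous_intros)
  then show ?thesis by (rule continuous_on_subset) auto
qed

text \<open>Each pair of translates is even and has derivative 0 at 0. This is what makes the
  quotient by \<open>sin (pi * x)\<close> in the Poisson formula continuous at 0.\<close>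

lemma wrapped_deriv_0: "(wrapped t has_real_derivative 0) (at 0)"
proof -
  define w' where "w' n x = - (2 * pi * t * (x + (real n + 1))) * gau t (x + (real n + 1))
         - (2 * pi * t * (x - (real n + 1))) * gau t (x - (real n + 1))" for n x
  let ?S = "{-(3/4)..3/4::real}"
  have d: "(wrap t n has_field_derivative w' n x) (at x within ?S)" for n x
    unfolding wrap_def w'_def
    by (rule derivative_eq_intros DERIV_chain2[OF gau_deriv] refl)+ simp
  have b: "norm (w' n x) \<le> 2 * (2 * pi * t * (real n + 2)) * q ^ n" if "x \<in> ?S" for n x
  proof -
    have 1: "gau t (x + (real n + 1)) \<le> q ^ n" "gau t (x - (real n + 1)) \<le> q ^ n"
      unfolding q_def by (rule gau_le_geom[OF t]; use that in auto)+
    have 2: "\<bar>2 * pi * t * (x + (real n + 1))\<bar> \<le> 2 * pi * t * (real n + 2)"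
            "\<bar>2 * pi * t * (x - (real n + 1))\<bar> \<le> 2 * pi * t * (real n + 2)"
      using t that by (auto simp: abs_mult)
    have "norm (w' n x) \<le> \<bar>2 * pi * t * (x + (real n + 1))\<bar> * gau t (x + (real n + 1))
       + \<bar>2 * pi * t * (x - (real n + 1))\<bar> * gau t (x - (real n + 1))"
      unfolding w'_def by (rule order.trans[OF norm_triangle_ineq4]) (simp add: abs_mult)
    also have "\<dots> \<le> 2 * pi * t * (real n + 2) * q ^ n + 2 * pi * t * (real n + 2) * q ^ n"
      using 1 2 t by (intro add_mono mult_mono) auto
    finally show ?thesis by (simp add: algebra_simps)
  qed
  have s: "summable (\<lambda>n. 2 * (2 * pi * t * (real n + 2)) * q ^ n)"
  proof -
    have "summable (\<lambda>n. real (Suc n) * q ^ n)"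
      using geometric_deriv_sums[of q] q_bounds by (auto simp: sums_iff)
    then have "summable (\<lambda>n. 4 * pi * t * (real (Suc n) * q ^ n) + 4 * pi * t * q ^ n)"
      using q_bounds by (intro summable_add summable_mult summable_geometric) auto
    then show ?thesis by (simp add: algebra_simps)
  qed
  have "((\<lambda>x. \<Sum>n. wrap t n x) has_field_derivative (\<Sum>n. w' n 0)) (at 0)"
  proof (rule has_field_derivative_series'(2)[where S = ?S and f' = w' and ?x0.0 = 0])
    show "uniformly_convergent_on ?S (\<lambda>n x. \<Sum>i<n. w' i x)"
      by (rule Weierstrass_m_test'[OF b s])
    show "summable (\<lambda>n. wrap t n 0)"
      by (rule summable_comparison_test'[OF summable_q, of 0]) (use wrap_bound[of 0] in auto)
  qed (use d in auto)
  moreover have "w' n 0 = 0" for n unfolding w'_def using gau_minus[of t "real n + 1"] by (simp add: algebra_simps)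
  ultimately have "((\<lambda>x. \<Sum>n. wrap t n x) has_field_derivative 0) (at 0)" by simp
  moreover have "(gau t has_field_derivative 0) (at 0)" using gau_deriv[of t 0 UNIV] by simp
  ultimately show ?thesis unfolding wrapped_def using DERIV_add by fastforce
qed

lemma wrapped_0: "wrapped t 0 = 1 + 2 * (\<Sum>n. gau t (real n + 1))"
proof -
  have "summable (\<lambda>n. gau t (real n + 1))"
    by (rule summable_comparison_test'[of "\<lambda>n. q ^ n" 0]) (use q_bounds gau_le_geom[OF t] in \<open>auto simp: q_def\<close>)
  moreover have "wrap t n 0 = 2 * gau t (real n + 1)" for n
    unfolding wrap_def using gau_minus[of t "real n + 1"] by simp
  ultimately show ?thesis by (simp add: wrapped_def suminf_mult gau_def)
qed

text \<open>Unfolding: the cosine has period 1, so the translates over one period contribute the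
  integrals over consecutive unit intervals, which add up to the Fourier transform on the
  line.\<close>

lemma wrapped_coeff:
  fixes m :: nat
  shows "integral {-(1/2)..1/2} (\<lambda>x. wrapped t x * cos (2 * pi * real m * x)) = exp (- (pi * (real m)\<^sup>2 / t)) / sqrt t"
proof -
  let ?I = "{-(1/2)..1/2::real}"
  let ?c = "\<lambda>x. cos (2 * pi * real m * x)"
  let ?f = "\<lambda>x. gau t x * ?c x"
  have int: "?f integrable_on S" if "S = {a..b}" for S a b
    unfolding that by (intro integrable_continuous_real continuous_intros)
  have shift: "integral ?I (\<lambda>x. gau t (x + c) * ?c x) = integral {c - 1/2..c + 1/2} ?f" if "c \<in> \<int>" for c
  proof -
    have "?c (x + c) = ?c x" for x
    proof -
      from that obtain k where k: "c = of_int k" by (auto elim: Ints_cases)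
      have "2 * pi * real m * (x + c) = 2 * pi * real m * x + of_int (2 * int m * k) * pi"
        by (simp add: k algebra_simps)
      moreover have "sin (of_int (2 * int m * k) * pi) = 0" by (auto simp: sin_zero_iff_int2 simp del: of_int_mult)
      moreover have "cos (of_int (2 * int m * k) * pi) = 1"
        using cos_int_2pin[of "int m * k"] by (simp add: mult_ac)
      ultimately show ?thesis by (simp add: cos_add del: of_int_mult)
    qed
    then have "integral ?I (\<lambda>x. gau t (x + c) * ?c x) = integral ?I (?f \<circ> (\<lambda>x. x + c))" by (simp add: o_def)
    also have "\<dots> = integral {-(1/2) + c..1/2 + c} ?f"
      using integral_shift_Icc_real[of "-(1/2)" "1/2" ?f c] by (simp add: o_def add.commute)
    finally show ?thesis by (simp add: algebra_simps)
  qed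
  have part: "integral {-(real N + 1/2)..real N + 1/2} ?f = integral ?I ?f + (\<Sum>i<N. integral ?I (\<lambda>x. wrap t i x * ?c x))" for N
  proof (induction N)
    case (Suc N)
    have "integral {-(real (Suc N) + 1/2)..real (Suc N) + 1/2} ?f =
       integral {-(real (Suc N) + 1/2)..-(real N+1/2)} ?f + integral {-(real N+1/2)..real (Suc N) + 1/2} ?f"
      by (rule Henstock_Kurzweil_Integration.integral_combine[symmetric]) (auto intro!: int)
    also have "integral {-(real N+1/2)..real (Suc N) + 1/2} ?f = integral {-(real N+1/2)..real N + 1/2} ?f + integral {real N+1/2..real (Suc N) + 1/2} ?f"
      by (rule Henstock_Kurzweil_Integration.integral_combine[symmetric]) (auto intro!: int)
    also have "integral {real N+1/2..real (Suc N) + 1/2} ?f = integral ?I (\<lambda>x. gau t (x + (real N + 1)) * ?c x)"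
      by (subst shift) (auto intro!: arg_cong2[where f = integral])
    also have "integral {-(real (Suc N) + 1/2)..-(real N+1/2)} ?f = integral ?I (\<lambda>x. gau t (x + (- (real N + 1))) * ?c x)"
      by (subst shift) (auto intro!: arg_cong2[where f = integral])
    finally have *: "integral {-(real (Suc N) + 1/2)..real (Suc N) + 1/2} ?f =
       integral ?I ?f + (\<Sum>i<N. integral ?I (\<lambda>x. wrap t i x * ?c x)) +
       (integral ?I (\<lambda>x. gau t (x + (real N + 1)) * ?c x) + integral ?I (\<lambda>x. gau t (x + (- (real N + 1))) * ?c x))"
      unfolding Suc.IH by simp
    have "integral ?I (\<lambda>x. wrap t N x * ?c x) =
      integral ?I (\<lambda>x. gau t (x + (real N + 1)) * ?c x + gau t (x + (- (real N + 1))) * ?c x)"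
      by (simp add: wrap_def algebra_simps)
    also have "\<dots> = integral ?I (\<lambda>x. gau t (x + (real N + 1)) * ?c x) + integral ?I (\<lambda>x. gau t (x + (- (real N + 1))) * ?c x)"
      by (rule integral_add) (auto intro!: integrable_continuous_real continuous_intros simp: gau_def)
    finally show ?case unfolding * by simp
  qed simp
  have lim1: "(\<lambda>N. integral {-(real N + 1/2)..real N + 1/2} ?f) \<longlonglongrightarrow> exp (- (pi * (real m)\<^sup>2 / t)) / sqrt t"
  proof -
    define g where "g N x = (if x \<in> {-(real N + 1/2)..real N + 1/2} then ?f x else 0)" for N x
    have "(\<lambda>N. integral UNIV (g N)) \<longlonglongrightarrow> integral UNIV ?f"
    proof (rule dominated_convergence(2)[where h = "gau t"])
      show "g N integrable_on UNIV" for N unfolding g_def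
        by (subst integrable_restrict_UNIV) (rule int, rule refl)
      show "gau t integrable_on UNIV" using gau_cos_integral[OF t, of 0] by auto
      show "norm (g N x) \<le> gau t x" for N x
        by (auto simp: g_def abs_mult intro!: mult_left_le)
      show "(\<lambda>N. g N x) \<longlonglongrightarrow> ?f x" for x
      proof (rule tendsto_eventually)
        obtain n0 :: nat where "\<bar>x\<bar> \<le> real n0" using real_arch_simple by blast
        then have "g N x = ?f x" if "N \<ge> n0" for N using that by (auto simp: g_def)
        then show "\<forall>\<^sub>F N in sequentially. g N x = ?f x" by (auto simp: eventually_sequentially)
      qed
    qed
    then show ?thesis using gau_cos_integral[OF t, of m]
      unfolding g_def integral_restrict_UNIV by (simp add: integral_unique)
  qed
  have lim2: "(\<lambda>N. integral ?I (\<lambda>x. (\<Sum>i<N. wrap t i x * ?c x))) \<longlonglongrightarrow> integral ?I (\<lambda>x. (\<Sum>i. wrap t i x * ?c x))"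
  proof (rule tendsto_integral_uniform_limit)
    show "uniform_limit ?I (\<lambda>N x. (\<Sum>i<N. wrap t i x * ?c x)) (\<lambda>x. (\<Sum>i. wrap t i x * ?c x)) sequentially"
    proof (rule Weierstrass_m_test[OF _ summable_q])
      show "norm (wrap t n x * ?c x) \<le> 2 * q ^ n" if "x \<in> ?I" for n x
      proof -
        have "norm (wrap t n x * ?c x) \<le> norm (wrap t n x)" by (auto simp: abs_mult intro!: mult_left_le)
        also have "\<dots> \<le> 2 * q ^ n" by (rule wrap_bound) (use that in auto)
        finally show ?thesis .
      qed
    qed
  qed (auto intro!: integrable_continuous_real continuous_intros)
  have "integral ?I (\<lambda>x. (\<Sum>i<N. wrap t i x * ?c x)) = (\<Sum>i<N. integral ?I (\<lambda>x. wrap t i x * ?c x))" for N :: nat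
    by (rule integral_sum) (simp, intro integrable_continuous_real continuous_intros)
  then have "(\<lambda>N. integral {-(real N + 1/2)..real N + 1/2} ?f) = (\<lambda>N. integral ?I ?f + integral ?I (\<lambda>x. (\<Sum>i<N. wrap t i x * ?c x)))"
    by (simp only: part)
  then have lim3: "(\<lambda>N. integral ?I ?f + integral ?I (\<lambda>x. (\<Sum>i<N. wrap t i x * ?c x))) \<longlonglongrightarrow> exp (- (pi * (real m)\<^sup>2 / t)) / sqrt t"
    using lim1 by (simp only:)
  have eq: "exp (- (pi * (real m)\<^sup>2 / t)) / sqrt t = integral ?I ?f + integral ?I (\<lambda>x. (\<Sum>i. wrap t i x * ?c x))"
    by (rule LIMSEQ_unique[OF lim3]) (intro tendsto_add tendsto_const lim2)
  have sm: "(\<Sum>i. wrap t i x * ?c x) = (\<Sum>i. wrap t i x) * ?c x" if "x \<in> ?I" for x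
    by (rule suminf_mult2[symmetric], rule summable_comparison_test'[OF summable_q, of 0]) (use wrap_bound[of x] that in auto)
  have "integral ?I (\<lambda>x. wrapped t x * ?c x) = integral ?I (\<lambda>x. ?f x + (wrapped t x - gau t x) * ?c x)"
    by (simp add: algebra_simps)
  also have "\<dots> = integral ?I ?f + integral ?I (\<lambda>x. (wrapped t x - gau t x) * ?c x)"
    by (rule integral_add) (intro integrable_continuous_real continuous_intros wrapped_cont)+
  also have "integral ?I (\<lambda>x. (wrapped t x - gau t x) * ?c x) = integral ?I (\<lambda>x. (\<Sum>i. wrap t i x * ?c x))"
    by (rule integral_cong) (simp add: sm wrapped_def)
  finally show ?thesis using eq by simp
qed

text \<open>The closed form of the Dirichlet kernel, multiplied by its denominator so that it also
  holds where \<open>sin (pi * x) = 0\<close>.\<close>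

lemma odd_sine_sum:
  fixes M :: nat
  shows "(1 + 2 * (\<Sum>m=1..M. cos (2 * pi * real m * x))) * sin (pi * x) = sin ((2 * real M + 1) * pi * x)"
proof (induction M)
  case (Suc M)
  have "2 * cos (2 * pi * real (Suc M) * x) * sin (pi * x) = sin ((2 * real (Suc M) + 1) * pi * x) - sin ((2 * real M + 1) * pi * x)"
  proof -
    have "(2 * real (Suc M) + 1) * pi * x = 2 * pi * real (Suc M) * x + pi * x"
         "(2 * real M + 1) * pi * x = 2 * pi * real (Suc M) * x - pi * x" by (simp_all add: algebra_simps)
    then show ?thesis by (simp only: sin_add sin_diff)
  qed
  moreover have "(1 + 2 * (\<Sum>m=1..Suc M. cos (2 * pi * real m * x))) * sin (pi * x) =
    (1 + 2 * (\<Sum>m=1..M. cos (2 * pi * real m * x))) * sin (pi * x) + 2 * cos (2 * pi * real (Suc M) * x) * sin (pi * x)"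
    by (simp add: distrib_left distrib_right del: of_nat_Suc)
  ultimately show ?case using Suc.IH by linarith
qed simp

text \<open>This is convergence of the Fourier series at 0. The partial sum minus
  \<open>wrapped t 0\<close> is the integral of \<open>wrapped t x - wrapped t 0\<close> against the
  Dirichlet kernel; division by \<open>sin (pi * x)\<close> turns it into an odd sine coefficient of
  a continuous function, which tends to 0.\<close>

lemma wrapped_Poisson: "wrapped t 0 = (1 + 2 * (\<Sum>n. gau (1/t) (real n + 1))) / sqrt t"
proof -
  let ?I = "{-(1/2)..1/2::real}"
  let ?F = "wrapped t"
  define R where "R x = (?F x - ?F 0) / sin (pi * x)" for x
  define D where "D M x = 1 + 2 * (\<Sum>m=1..M. cos (2 * pi * real m * x))" for M x
  have sin0: "sin (pi * x) \<noteq> 0" if "x \<in> ?I" "x \<noteq> 0" for x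
  proof
    assume "sin (pi * x) = 0"
    then obtain k where "pi * x = of_int k * pi" by (auto simp: sin_zero_iff_int2)
    then have "x = of_int k" by simp
    with that show False by (auto simp: abs_le_iff)
  qed
  \<comment> \<open>Division by zero gives \<open>R 0 = 0\<close>. This is also the limit at 0,
    where the numerator has derivative 0 and the denominator has derivative
    \<open>pi\<close>.\<close>
  have contR: "continuous_on ?I R"
  proof (subst continuous_on_eq_continuous_within, intro ballI)
    fix x assume x: "x \<in> ?I"
    show "continuous (at x within ?I) R"
    proof (cases "x = 0")
      case False
      have "continuous_on (?I - {0}) R" unfolding R_def
        by (intro continuous_intros continuous_on_subset[OF wrapped_cont]) (use sin0 in auto)
      then have "continuous (at x within ?I - {0}) R" using x False by (simp add: continuous_on_eq_continuous_within)
      moreover have "at x within ?I - {0} = at x within ?I"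
        by (rule at_within_nhd[of _ "- {0}"]) (use False in auto)
      ultimately show ?thesis by simp
    next
      case True
      have "((\<lambda>x. (?F x - ?F 0) / (x - 0)) \<longlongrightarrow> 0) (at 0)"
        using wrapped_deriv_0 by (simp only: has_field_derivative_iff)
      moreover have "((\<lambda>x. (sin (pi * x) - sin (pi * 0)) / (x - 0)) \<longlongrightarrow> pi) (at 0)"
      proof -
        have "((\<lambda>x. sin (pi * x)) has_field_derivative pi) (at 0)" by (auto intro!: derivative_eq_intros)
        then show ?thesis by (simp only: has_field_derivative_iff)
      qed
      ultimately have "((\<lambda>x. ((?F x - ?F 0) / (x - 0)) / ((sin (pi * x) - sin (pi * 0)) / (x - 0))) \<longlongrightarrow> 0 / pi) (at 0)"
        by (rule tendsto_divide) simp
      then have "((\<lambda>x. ((?F x - ?F 0) / (x - 0)) / ((sin (pi * x) - sin (pi * 0)) / (x - 0))) \<longlongrightarrow> 0) (at 0)"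
        by (simp only: div_0)
      then have "(R \<longlongrightarrow> 0) (at 0)"
        by (rule Lim_transform_eventually) (auto simp: R_def eventually_at intro!: exI[of _ 1])
      then have "continuous (at 0) R" unfolding continuous_at by (simp add: R_def)
      then show ?thesis using True continuous_at_imp_continuous_within by blast
    qed
  qed
  \<comment> \<open>These Fourier coefficients are the values of \<open>gau (1/t)\<close> at the
    integers, divided by \<open>sqrt t\<close>: the other side of the theta equation.\<close>
  define A where "A m = exp (- (pi * (real m)\<^sup>2 / t)) / sqrt t" for m :: nat
  have contD: "continuous_on ?I (D M)" for M unfolding D_def by (intro continuous_intros)
  have D: "integral ?I (\<lambda>x. f x * D M x) = integral ?I f + 2 * (\<Sum>m=1..M. integral ?I (\<lambda>x. f x * cos (2 * pi * real m * x)))"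
    if f: "continuous_on ?I f" for f M
  proof -
    have "integral ?I (\<lambda>x. f x * D M x) = integral ?I (\<lambda>x. f x + (\<Sum>m=1..M. 2 * (f x * cos (2 * pi * real m * x))))"
      by (simp add: D_def algebra_simps sum_distrib_left)
    also have "\<dots> = integral ?I f + integral ?I (\<lambda>x. (\<Sum>m=1..M. 2 * (f x * cos (2 * pi * real m * x))))"
      by (rule integral_add) (intro integrable_continuous_real continuous_intros f)+
    also have "integral ?I (\<lambda>x. (\<Sum>m=1..M. 2 * (f x * cos (2 * pi * real m * x)))) =
       (\<Sum>m=1..M. integral ?I (\<lambda>x. 2 * (f x * cos (2 * pi * real m * x))))"
      by (rule integral_sum) (auto intro!: integrable_continuous_real continuous_intros f)
    finally show ?thesis by (simp add: sum_distrib_left)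
  qed
  have FD: "integral ?I (\<lambda>x. ?F x * D M x) = A 0 + 2 * (\<Sum>m=1..M. A m)" for M
    using wrapped_coeff[of 0] by (simp add: D[OF wrapped_cont] wrapped_coeff A_def)
  have D1: "integral ?I (D M) = 1" for M
  proof -
    have "integral ?I (\<lambda>x. cos (2 * pi * real m * x)) = 0" if "m \<in> {1..M}" for m
    proof -
      define a where "a = 2 * pi * real m"
      have a: "a \<noteq> 0" using that by (simp add: a_def)
      have d: "((\<lambda>x. sin (a * x) / a) has_real_derivative cos (a * x)) (at x within ?I)" for x
        using a by (auto intro!: derivative_eq_intros)
      have "((\<lambda>x. cos (a * x)) has_integral (sin (a * (1/2)) / a - sin (a * (-(1/2))) / a)) ?I"
        by (rule fundamental_theorem_of_calculus)
           (use d in \<open>auto simp flip: has_real_derivative_iff_has_vector_derivative\<close>)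
      then have "((\<lambda>x. cos (2 * pi * real m * x)) has_integral (2 * sin (real_of_int (int m) * pi) / a)) ?I"
        by (simp add: a_def mult_ac)
      moreover have "sin (real_of_int (int m) * pi) = 0" using sin_zero_iff_int2 by blast
      ultimately show ?thesis by (simp add: integral_unique)
    qed
    then show ?thesis using D[of "\<lambda>_. 1" M] by simp
  qed
  have key: "A 0 + 2 * (\<Sum>m=1..M. A m) - ?F 0 = integral ?I (\<lambda>x. R x * sin ((2 * real M + 1) * pi * x))" for M
  proof -
    have "A 0 + 2 * (\<Sum>m=1..M. A m) - ?F 0 = integral ?I (\<lambda>x. ?F x * D M x) - integral ?I (\<lambda>x. ?F 0 * D M x)"
      unfolding FD by (simp add: D1)
    also have "\<dots> = integral ?I (\<lambda>x. ?F x * D M x - ?F 0 * D M x)"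
      by (rule integral_diff[symmetric]) (intro integrable_continuous_real continuous_intros wrapped_cont contD)+
    also have "\<dots> = integral ?I (\<lambda>x. R x * sin ((2 * real M + 1) * pi * x))"
    proof (rule integral_cong)
      fix x assume x: "x \<in> ?I"
      show "?F x * D M x - ?F 0 * D M x = R x * sin ((2 * real M + 1) * pi * x)"
        unfolding odd_sine_sum[symmetric] R_def D_def[symmetric] using sin0[OF x] by (cases "x = 0") (auto simp: field_simps)
    qed
    finally show ?thesis .
  qed
  have "(\<lambda>M. A 0 + 2 * (\<Sum>m=1..M. A m) - ?F 0) \<longlonglongrightarrow> 0"
    unfolding key by (rule Riemann_Lebesgue_odd_sines[OF contR])
  then have L1: "(\<lambda>M. A 0 + 2 * (\<Sum>m=1..M. A m)) \<longlonglongrightarrow> ?F 0" by (simp add: LIM_zero_iff)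
  have Ag: "A (Suc n) = gau (1/t) (real n + 1) / sqrt t" for n by (simp add: A_def gau_def add.commute)
  have t': "1 / t > 0" using t by simp
  have "summable (\<lambda>n. gau (1/t) (real n + 1))"
    by (rule summable_comparison_test'[of "\<lambda>n. exp (- (pi * (1/t) / 4)) ^ n" 0]) (use gau_le_geom[OF t'] t in auto)
  then have "(\<lambda>M. \<Sum>n<M. gau (1/t) (real n + 1)) \<longlonglongrightarrow> (\<Sum>n. gau (1/t) (real n + 1))"
    by (rule summable_LIMSEQ)
  then have "(\<lambda>M. A 0 + 2 * ((\<Sum>n<M. gau (1/t) (real n + 1)) / sqrt t)) \<longlonglongrightarrow> A 0 + 2 * ((\<Sum>n. gau (1/t) (real n + 1)) / sqrt t)"
    using t by (intro tendsto_intros) auto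
  moreover have "(\<Sum>m=1..M. A m) = (\<Sum>n<M. gau (1/t) (real n + 1)) / sqrt t" for M
    by (simp add: sum.atLeast1_atMost_eq Ag sum_divide_distrib del: sum_divide_distrib[symmetric])
  ultimately have "(\<lambda>M. A 0 + 2 * (\<Sum>m=1..M. A m)) \<longlonglongrightarrow> A 0 + 2 * ((\<Sum>n. gau (1/t) (real n + 1)) / sqrt t)"
    by (simp only:)
  then have "?F 0 = A 0 + 2 * ((\<Sum>n. gau (1/t) (real n + 1)) / sqrt t)"
    by (rule LIMSEQ_unique[OF L1])
  then show ?thesis by (simp add: A_def add_divide_distrib)
qed

end

theorem theta_functional_equation:
  assumes "t > 0"
  shows "1 + 2 * (\<Sum>n. gau t (real n + 1)) = (1 + 2 * (\<Sum>n. gau (1/t) (real n + 1))) / sqrt t"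
  using wrapped_Poisson[OF assms] wrapped_0[OF assms] by simp

section \<open>The completed zeta function\<close>

text \<open>This is \<open>(\<theta>(t) - 1) / 2\<close> at \<open>t = exp v\<close>: the Mellin transform becomes a Laplace transform.\<close>

definition wt :: "real \<Rightarrow> real" where
  "wt v = (\<Sum>n. gau (exp v) (real n + 1))"

lemma gau_exp_le:
  assumes "t \<ge> 1"
  shows "gau t (real n + 1) \<le> exp (- (pi * t)) * (1/2) ^ n"
proof -
  have "pi * t * (real n + 1) \<le> pi * t * (real n + 1)\<^sup>2"
    using assms by (intro mult_left_mono) (auto simp: power2_eq_square)
  then have "gau t (real n + 1) \<le> exp (- (pi * t) + real n * (- (pi * t)))"
    unfolding gau_def by (simp add: algebra_simps)
  also have "\<dots> = exp (- (pi * t)) * exp (- (pi * t)) ^ n"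
    by (simp only: exp_add exp_of_nat_mult)
  also have "\<dots> \<le> exp (- (pi * t)) * (1/2) ^ n"
  proof (intro mult_left_mono power_mono)
    have "1 * 1 \<le> pi * t" using assms pi_gt3 by (intro mult_mono) auto
    then have "exp 1 \<le> exp (pi * t)" by simp
    moreover have "2 \<le> exp (1::real)" using exp_ge_add_one_self[of 1] by simp
    ultimately have "2 \<le> exp (pi * t)" by linarith
    then show "exp (- (pi * t)) \<le> 1/2" by (simp add: exp_minus field_simps)
  qed auto
  finally show ?thesis .
qed

lemma summable_gau: "t > 0 \<Longrightarrow> summable (\<lambda>n. gau t (real n + 1))"
  by (rule summable_comparison_test'[of "\<lambda>n. exp (- (pi * t / 4)) ^ n" 0]) (use gau_le_geom[of t] in auto)

lemma wt_nonneg: "wt v \<ge> 0"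
  unfolding wt_def by (rule suminf_nonneg) (auto intro: summable_gau)

text \<open>A single term of the exponential series gives
  \<open>exp (- exp v) \<le> fact k * exp (- (k * v))\<close>. Since \<open>k\<close> is free, this
  beats the exponentials in \<open>phi_integrand\<close> for every \<open>s\<close>.\<close>

lemma wt_le:
  assumes "v \<ge> 0"
  shows "wt v \<le> 2 * fact k * exp (- (real k * v))"
proof -
  have e: "exp v \<ge> 1" using assms by simp
  have s: "summable (\<lambda>n. exp (- (pi * exp v)) * (1/2) ^ n)" by (intro summable_mult summable_geometric) auto
  have "wt v \<le> (\<Sum>n. exp (- (pi * exp v)) * (1/2) ^ n)"
    unfolding wt_def by (intro suminf_le gau_exp_le e summable_gau s) auto
  also have "\<dots> = 2 * exp (- (pi * exp v))"
    by (subst suminf_mult) (auto simp: suminf_geometric)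
  also have "\<dots> \<le> 2 * (fact k * exp (- (real k * v)))"
  proof (intro mult_left_mono)
    have "exp v ^ k / fact k \<le> exp (exp v)"
    proof -
      have "(\<Sum>n\<in>{k}. exp v ^ n /\<^sub>R fact n) \<le> (\<Sum>n. exp v ^ n /\<^sub>R fact n)"
        by (intro sum_le_suminf summable_exp_generic) auto
      then show ?thesis by (simp add: exp_def divide_inverse mult.commute)
    qed
    also have "\<dots> \<le> exp (pi * exp v)" using pi_gt3 by simp
    finally have "exp (real k * v) \<le> fact k * exp (pi * exp v)"
      unfolding exp_of_nat_mult by (simp add: field_simps)
    then show "exp (- (pi * exp v)) \<le> fact k * exp (- (real k * v))"
      by (simp add: exp_minus field_simps)
  qed auto
  finally show ?thesis by simp
qed

lemma wt_cont [continuous_intros]: "continuous_on {0..} wt"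
proof -
  have "uniform_limit {0..} (\<lambda>N v. \<Sum>n<N. gau (exp v) (real n + 1)) wt sequentially"
    unfolding wt_def
  proof (rule Weierstrass_m_test)
    show "norm (gau (exp v) (real n + 1)) \<le> (1/2) ^ n" if "v \<in> {0..}" for n v
    proof -
      have "gau (exp v) (real n + 1) \<le> exp (- (pi * exp v)) * (1/2) ^ n"
        by (rule gau_exp_le) (use that in auto)
      also have "\<dots> \<le> 1 * (1/2) ^ n" by (intro mult_right_mono) auto
      finally show ?thesis by simp
    qed
  qed (auto intro!: summable_geometric)
  then show ?thesis
    by (rule uniform_limit_theorem[rotated]) (auto intro!: always_eventually continuous_intros simp: gau_def)
qed

text \<open>The theta equation in the logarithmic variable. Its term
  \<open>(exp (v/2) - 1) / 2\<close> is the source of the poles of the completed zeta function at 0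
  and 1.\<close>

lemma wt_minus: "wt (- v) = exp (v/2) * wt v + (exp (v/2) - 1) / 2"
proof -
  have "1 + 2 * wt (-v) = (1 + 2 * wt v) / sqrt (exp (-v))"
  proof -
    have "1 / exp (-v) = exp v" by (simp add: exp_minus inverse_eq_divide)
    then show ?thesis using theta_functional_equation[of "exp (-v)"] unfolding wt_def by simp
  qed
  moreover have "sqrt (exp (-v)) = exp (- (v/2))"
    by (rule real_sqrt_unique) (simp_all flip: exp_double)
  ultimately have "1 + 2 * wt (-v) = (1 + 2 * wt v) * exp (v/2)"
    by (simp only:) (simp add: exp_minus field_simps)
  moreover have "(1 + 2 * wt v) * exp (v/2) = exp (v/2) + 2 * (exp (v/2) * wt v)" by (simp add: algebra_simps)
  ultimately have "2 * wt (-v) = 2 * (exp (v/2) * wt v) + exp (v/2) - 1" by simp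
  then show ?thesis by (simp add: field_simps)
qed

section \<open>Riemann's entire integral\<close>

definition phi_integrand :: "complex \<Rightarrow> real \<Rightarrow> complex" where
  "phi_integrand s v = of_real (wt v) * (exp (of_real v * s / 2) + exp (of_real v * (1 - s) / 2))"

text \<open>The integral of \<open>phi_integrand s\<close> over the half-line, cut into unit
  intervals: each piece is entire by differentiation under the integral sign, and the M-test passes
  this on to the sum.\<close>

definition Phi :: "complex \<Rightarrow> complex" where
  "Phi s = (\<Sum>j. integral {real j..real j + 1} (phi_integrand s))"

lemma phi_integrand_cont:
  assumes "A \<subseteq> {0..}"
  shows "continuous_on A (phi_integrand s)"
  unfolding phi_integrand_def
  by (intro continuous_intros continuous_on_subset[OF wt_cont assms]) auto

text \<open>For \<open>k \<ge> norm s + 1\<close> both exponents stay below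
  \<open>(k - 1/2) * v\<close>, while \<open>wt\<close> supplies \<open>exp (- (k * v))\<close>;
  what is left is \<open>exp (- v / 2)\<close>. The bound depends on \<open>s\<close> only through
  its modulus, hence it is locally uniform.\<close>

lemma phi_integrand_bound:
  assumes "v \<ge> 0" "norm s + 1 \<le> R" "real k \<ge> R"
  shows "norm (phi_integrand s v) \<le> 4 * fact k * exp (- v / 2)"
proof -
  have a: "Re (of_real v * s / 2) \<le> (real k - 1/2) * v" "Re (of_real v * (1 - s) / 2) \<le> (real k - 1/2) * v"
  proof -
    have n: "norm s + 1 \<le> real k" using assms by linarith
    have "Re s / 2 \<le> real k - 1/2" "(1 - Re s) / 2 \<le> real k - 1/2"
      using n complex_Re_le_cmod[of s] complex_Re_le_cmod[of "-s"] norm_ge_zero[of s] by auto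
    note this[THEN mult_left_mono, OF assms(1)]
    moreover have ab: "Re (of_real v * s / 2) = v * (Re s / 2)" "Re (of_real v * (1 - s) / 2) = v * ((1 - Re s) / 2)" by simp_all
    ultimately show "Re (of_real v * s / 2) \<le> (real k - 1/2) * v" "Re (of_real v * (1 - s) / 2) \<le> (real k - 1/2) * v"
      using ab by (simp_all only: mult.commute)
  qed
  have "norm (phi_integrand s v) \<le> wt v * (norm (exp (of_real v * s / 2)) + norm (exp (of_real v * (1 - s) / 2)))"
    unfolding phi_integrand_def norm_mult norm_of_real abs_of_nonneg[OF wt_nonneg]
    by (intro mult_left_mono norm_triangle_ineq wt_nonneg)
  also have "\<dots> \<le> (2 * fact k * exp (- (real k * v))) * (exp ((real k - 1/2) * v) + exp ((real k - 1/2) * v))"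
    using a by (intro mult_mono add_mono wt_le assms)
      (simp_all only: norm_exp_eq_Re exp_le_cancel_iff, simp_all add: add_nonneg_nonneg)
  also have "\<dots> = 4 * fact k * (exp (- (real k * v)) * exp ((real k - 1/2) * v))" by simp
  also have "\<dots> = 4 * fact k * exp (- v / 2)" by (simp flip: exp_add add: algebra_simps)
  finally show ?thesis .
qed

lemma Phi_term_bound:
  assumes "norm s + 1 \<le> R" "real k \<ge> R"
  shows "norm (integral {real j..real j + 1} (phi_integrand s)) \<le> 4 * fact k * exp (- 1 / 2) ^ j"
proof -
  have "norm (integral {real j..real j + 1} (phi_integrand s)) \<le> (4 * fact k * exp (- 1 / 2) ^ j) * ((real j + 1) - real j)"
  proof (rule integral_bound)
    show "continuous_on {real j..real j + 1} (phi_integrand s)" by (rule phi_integrand_cont) auto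
    fix v assume v: "v \<in> {real j..real j + 1}"
    have "norm (phi_integrand s v) \<le> 4 * fact k * exp (- v / 2)"
      by (rule phi_integrand_bound[OF _ assms]) (use v in auto)
    also have "\<dots> \<le> 4 * fact k * exp (real j * (- 1 / 2))" using v by auto
    finally show "norm (phi_integrand s v) \<le> 4 * fact k * exp (- 1 / 2) ^ j"
      by (simp only: exp_of_nat_mult)
  qed auto
  then show ?thesis by simp
qed

lemma Phi_summable: "summable (\<lambda>j. integral {real j..real j + 1} (phi_integrand s))"
proof -
  obtain k where k: "norm s + 1 \<le> real k" using real_arch_simple by blast
  show ?thesis
    by (rule summable_comparison_test'[of "\<lambda>j. 4 * fact k * exp (- 1 / 2) ^ j" 0])
       (use Phi_term_bound[OF order.refl k] in \<open>auto intro!: summable_mult summable_geometric\<close>)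
qed

lemma Phi_partial: "(\<Sum>j<N. integral {real j..real j + 1} (phi_integrand s)) = integral {0..real N} (phi_integrand s)"
proof (induction N)
  case (Suc N)
  have "integral {0..real N} (phi_integrand s) + integral {real N..real N + 1} (phi_integrand s) = integral {0..real N + 1} (phi_integrand s)"
    by (rule Henstock_Kurzweil_Integration.integral_combine)
       (auto intro!: integrable_continuous_real phi_integrand_cont)
  with Suc show ?case by (simp add: add.commute)
qed simp

lemma Phi_LIMSEQ: "(\<lambda>N. integral {0..real N} (phi_integrand s)) \<longlonglongrightarrow> Phi s"
  using summable_LIMSEQ[OF Phi_summable[of s]] unfolding Phi_partial Phi_def .

lemma Phi_holomorphic [holomorphic_intros]: "Phi holomorphic_on A"
proof -
  have hol: "(\<lambda>s. integral (cbox (real j) (real j + 1)) (phi_integrand s)) holomorphic_on UNIV" for j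
  proof (rule leibniz_rule_holomorphic)
    define fx where "fx s v = of_real (wt v) * (of_real v / 2 * exp (of_real v * s / 2) - of_real v / 2 * exp (of_real v * (1 - s) / 2))" for s :: complex and v :: real
    show "((\<lambda>x. phi_integrand x t) has_field_derivative fx x t) (at x within UNIV)" for x t
      unfolding phi_integrand_def fx_def by (auto intro!: derivative_eq_intros simp: algebra_simps)
    show "phi_integrand x integrable_on cbox (real j) (real j + 1)" for x
      by (rule integrable_continuous) (auto intro!: phi_integrand_cont)
    have "continuous_on (UNIV \<times> cbox (real j) (real j + 1)) (\<lambda>p. wt (snd p))"
      by (rule continuous_on_compose2[OF wt_cont]) (auto intro!: continuous_intros)
    then show "continuous_on (UNIV \<times> cbox (real j) (real j + 1)) (\<lambda>(x, t). fx x t)"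
      unfolding fx_def case_prod_unfold by (intro continuous_intros) auto
  qed auto
  have "Phi holomorphic_on UNIV"
  proof (rule holomorphic_uniform_sequence)
    show "(\<lambda>s. \<Sum>j<N. integral {real j..real j + 1} (phi_integrand s)) holomorphic_on UNIV" for N
      using hol by (intro holomorphic_intros) auto
    show "\<exists>d>0. cball x d \<subseteq> UNIV \<and> uniform_limit (cball x d) (\<lambda>N s. \<Sum>j<N. integral {real j..real j + 1} (phi_integrand s)) Phi sequentially" for x
    proof (intro exI[of _ 1] conjI)
      obtain k where k: "norm x + 1 + 1 \<le> real k" using real_arch_simple by blast
      show "uniform_limit (cball x 1) (\<lambda>N s. \<Sum>j<N. integral {real j..real j + 1} (phi_integrand s)) Phi sequentially"
        unfolding Phi_def
      proof (rule Weierstrass_m_test)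
        show "norm (integral {real j..real j + 1} (phi_integrand s)) \<le> 4 * fact k * exp (- 1 / 2) ^ j" if "s \<in> cball x 1" for j s
        proof (rule Phi_term_bound[OF _ k])
          show "norm s + 1 \<le> norm x + 1 + 1" using that norm_triangle_sub[of s x] by (auto simp: dist_norm norm_minus_commute)
        qed
      qed (auto intro!: summable_mult summable_geometric)
    qed auto
  qed auto
  then show ?thesis by (rule holomorphic_on_subset) auto
qed

lemma Phi_reflect: "Phi (1 - s) = Phi s"
  unfolding Phi_def phi_integrand_def by (simp add: add.commute)

lemma Phi_cnj: "Phi (cnj s) = cnj (Phi s)"
proof -
  have "integral {real j..real j + 1} (phi_integrand (cnj s)) = cnj (integral {real j..real j + 1} (phi_integrand s))" for j
    by (simp add: integral_cnj phi_integrand_def[abs_def] exp_cnj)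
  then show ?thesis unfolding Phi_def
    using sums_unique[OF sums_cnj[THEN iffD2, OF summable_sums[OF Phi_summable[of s]]]] by simp
qed

text \<open>Normalised as \<open>s (s - 1) / 2 * \<pi> powr (-s/2) * \<Gamma>(s/2) * \<zeta>(s)\<close>.\<close>

definition xi :: "complex \<Rightarrow> complex" where
  "xi s = (1 + s * (s - 1) * Phi s) / 2"

lemma xi_holomorphic [holomorphic_intros]: "xi holomorphic_on A"
  unfolding xi_def by (intro holomorphic_intros) auto

lemma xi_reflect: "xi (1 - s) = xi s"
  unfolding xi_def Phi_reflect by (simp add: algebra_simps)

lemma xi_cnj: "xi (cnj s) = cnj (xi s)"
  unfolding xi_def Phi_cnj by simp

text \<open>This is \<open>(s - 1) \<zeta>(s)\<close>; the reciprocal Gamma function makes it visibly entire.\<close>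

definition zg :: "complex \<Rightarrow> complex" where
  "zg s = of_real pi powr (s / 2) * rGamma (s / 2 + 1) * xi s"

lemma zg_holomorphic [holomorphic_intros]: "zg holomorphic_on A"
  unfolding zg_def by (intro holomorphic_intros) auto

section \<open>The Mellin transform of the theta function\<close>

lemma tendsto_integral_exhaust:
  fixes f :: "real \<Rightarrow> real"
  assumes f: "f integrable_on S" "\<And>x. x \<in> S \<Longrightarrow> f x \<ge> 0"
    and sub: "\<And>N. {a N..b N} \<subseteq> S" and ev: "\<And>x. x \<in> S \<Longrightarrow> \<forall>\<^sub>F N in sequentially. x \<in> {a N..b N}"
  shows "(\<lambda>N. integral {a N..b N} f) \<longlonglongrightarrow> integral S f"
proof -
  define g where "g N x = (if x \<in> {a N..b N} then f x else 0)" for N x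
  have int: "f integrable_on {a N..b N}" for N
    using integrable_on_subinterval[OF f(1) sub] .
  have eq: "integral S (g N) = integral {a N..b N} f" for N
    unfolding g_def using sub[of N] integral_restrict_Int[of S "{a N..b N}" f] by (simp add: Int_absorb1 Int_absorb2)
  have "(\<lambda>N. integral S (g N)) \<longlonglongrightarrow> integral S f"
  proof (rule dominated_convergence(2)[where h = f])
    show "g N integrable_on S" for N
      unfolding g_def using sub[of N] integrable_restrict_Int[of "{a N..b N}" f S] int[of N] by (simp add: Int_absorb1 Int_absorb2)
    show "(\<lambda>N. g N x) \<longlonglongrightarrow> f x" if "x \<in> S" for x
      by (rule tendsto_eventually, rule eventually_mono[OF ev[OF that]]) (auto simp: g_def)
  qed (use f in \<open>auto simp: g_def\<close>)
  then show ?thesis unfolding eq .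
qed

text \<open>Euler's integral after the substitution of \<open>c * exp v\<close> for the
  variable.\<close>

lemma Gamma_integral_exp:
  fixes x c :: real
  assumes x: "x > 0" and c: "c > 0"
  shows "((\<lambda>v. exp (x * v) * exp (- (c * exp v))) has_integral (Gamma x * c powr (- x))) UNIV"
proof -
  define f where "f t = t powr (x - 1) / exp t" for t :: real
  have f0: "(f has_integral Gamma x) {0..}" unfolding f_def by (rule Gamma_integral_real[OF x])
  have neg: "negligible {0::real}" by simp
  have f1: "(f has_integral Gamma x) {0<..}"
  proof -
    have "(f has_integral Gamma x) {0..} \<longleftrightarrow> (f has_integral Gamma x) {0<..}"
      by (rule has_integral_spike_set_eq; rule negligible_subset[OF neg]) (auto simp: less_eq_real_def)
    with f0 show ?thesis by simp
  qed
  have f2: "f absolutely_integrable_on {0<..}"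
    by (rule nonnegative_absolutely_integrable_1) (use f1 in \<open>auto simp: f_def\<close>)
  have im: "range (\<lambda>v. c * exp v) = {0<..}"
  proof (intro set_eqI iffI)
    fix y :: real assume "y \<in> {0<..}"
    then have "y = c * exp (ln (y / c))" using c by simp
    then show "y \<in> range (\<lambda>v. c * exp v)" by blast
  qed (use c in auto)
  have "(\<lambda>v. \<bar>c * exp v\<bar> * f (c * exp v)) absolutely_integrable_on UNIV \<and>
     integral UNIV (\<lambda>v. \<bar>c * exp v\<bar> * f (c * exp v)) = Gamma x"
  proof (rule has_absolute_integral_change_of_variables_1'[where S = UNIV and g = "\<lambda>v. c * exp v" and g' = "\<lambda>v. c * exp v" and f = f, THEN iffD2])
    show "((\<lambda>v. c * exp v) has_real_derivative c * exp v) (at v within UNIV)" for v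
      by (auto intro!: derivative_eq_intros)
    show "inj (\<lambda>v. c * exp v)" using c by (auto intro!: injI)
    show "f absolutely_integrable_on range (\<lambda>v. c * exp v) \<and> integral (range (\<lambda>v. c * exp v)) f = Gamma x"
      unfolding im using f2 f1 by (auto simp: integral_unique)
  qed auto
  then have "((\<lambda>v. \<bar>c * exp v\<bar> * f (c * exp v)) has_integral Gamma x) UNIV"
    by (metis set_lebesgue_integral_eq_integral(1) integrable_integral)
  then have "((\<lambda>v. (\<bar>c * exp v\<bar> * f (c * exp v)) * c powr (-x)) has_integral (Gamma x * c powr (-x))) UNIV"
    by (rule has_integral_mult_left)
  moreover have "(\<bar>c * exp v\<bar> * f (c * exp v)) * c powr (-x) = exp (x * v) * exp (- (c * exp v))" for v
  proof -
    have "(c * exp v) powr (x - 1) = c powr (x - 1) * exp v powr (x - 1)" using c by (simp add: powr_mult)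
    also have "c powr (x - 1) = c powr x / c" using c by (simp add: powr_diff)
    also have "exp v powr (x - 1) = exp (x * v) / exp v" by (simp add: powr_def exp_diff[symmetric] algebra_simps)
    finally have "(c * exp v) powr (x - 1) = (c powr x / c) * (exp (x * v) / exp v)" .
    moreover have "c powr x * c powr (-x) = 1" using c by (simp flip: powr_add)
    ultimately show ?thesis using c unfolding f_def by (simp add: exp_minus field_simps)
  qed
  ultimately show ?thesis by simp
qed

text \<open>Riemann's computation: monotone convergence evaluates the transform term by term, and
  the theta equation folds its part over negative \<open>v\<close> onto positive \<open>v\<close>.
  For real \<open>s\<close> all terms are nonnegative; complex \<open>s\<close> is left to analytic
  continuation.\<close>

lemma zeta_Mellin:
  fixes s :: real
  assumes s: "s > 1"
  shows "of_real (Gamma (s/2) * pi powr (-(s/2)) * (\<Sum>n. (real n + 1) powr (-s))) =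
           Phi (of_real s) + of_real (1 / (s - 1) - 1 / s)"
proof -
  define f where "f v = wt v * exp (s/2 * v)" for v
  define F where "F N v = (\<Sum>n<N. gau (exp v) (real n + 1)) * exp (s/2 * v)" for N :: nat and v
  define K where "K = Gamma (s/2) * pi powr (-(s/2))"
  have K0: "K \<ge> 0" using s by (auto simp: K_def intro!: mult_nonneg_nonneg Gamma_real_nonneg)
  have sumz: "summable (\<lambda>n. (real n + 1) powr (-s))"
    using summable_real_powr_iff[of "-s"] s by (subst (asm) summable_Suc_iff[symmetric]) (simp add: add.commute)
  have tm: "((\<lambda>v. gau (exp v) (real n + 1) * exp (s/2 * v)) has_integral (K * (real n + 1) powr (-s))) UNIV" for n
  proof -
    have "((\<lambda>v. exp (s/2 * v) * exp (- ((pi * (real n + 1)^2) * exp v))) has_integral (Gamma (s/2) * (pi * (real n + 1)^2) powr (- (s/2)))) UNIV"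
      by (rule Gamma_integral_exp) (use s in auto)
    moreover have "((real n + 1)^2) powr (- (s/2)) = (real n + 1) powr (-s)"
      by (simp add: powr_powr flip: powr_numeral)
    ultimately show ?thesis by (simp add: gau_def K_def powr_mult mult_ac)
  qed
  have FI: "(F N has_integral (\<Sum>n<N. K * (real n + 1) powr (-s))) UNIV" for N
    unfolding F_def sum_distrib_right by (rule has_integral_sum) (use tm in auto)
  have "f integrable_on UNIV \<and> (\<lambda>N. integral UNIV (F N)) \<longlonglongrightarrow> integral UNIV f"
  proof (rule monotone_convergence_increasing)
    show "F N integrable_on UNIV" for N using FI by blast
    show "F N v \<le> F (Suc N) v" for N v by (simp add: F_def mult_right_mono)
    show "(\<lambda>N. F N v) \<longlonglongrightarrow> f v" for v
      unfolding F_def f_def wt_def by (intro tendsto_intros summable_LIMSEQ summable_gau) auto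
    have "norm (integral UNIV (F N)) \<le> K * (\<Sum>n. (real n + 1) powr (-s))" for N
    proof -
      have "(\<Sum>n<N. (real n + 1) powr (-s)) \<le> (\<Sum>n. (real n + 1) powr (-s))"
        by (rule sum_le_suminf) (use sumz in auto)
      then have "K * (\<Sum>n<N. (real n + 1) powr (-s)) \<le> K * (\<Sum>n. (real n + 1) powr (-s))"
        using K0 by (rule mult_left_mono)
      moreover have "0 \<le> K * (\<Sum>n<N. (real n + 1) powr (-s))" using K0 by (intro mult_nonneg_nonneg sum_nonneg) auto
      ultimately show ?thesis using integral_unique[OF FI[of N]] by (simp add: sum_distrib_left)
    qed
    then show "bounded (range (\<lambda>N. integral UNIV (F N)))" by (auto simp: bounded_iff)
  qed
  then have fint: "f integrable_on UNIV" and "(\<lambda>N. integral UNIV (F N)) \<longlonglongrightarrow> integral UNIV f" by auto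
  then have "(\<lambda>N. K * (\<Sum>n<N. (real n + 1) powr (-s))) \<longlonglongrightarrow> integral UNIV f"
    using integral_unique[OF FI] by (simp add: sum_distrib_left)
  moreover have "(\<lambda>N. K * (\<Sum>n<N. (real n + 1) powr (-s))) \<longlonglongrightarrow> K * (\<Sum>n. (real n + 1) powr (-s))"
    by (intro tendsto_intros summable_LIMSEQ sumz)
  ultimately have I1: "integral UNIV f = K * (\<Sum>n. (real n + 1) powr (-s))" by (rule LIMSEQ_unique)
  have L1: "(\<lambda>N. integral {- real N..real N} f) \<longlonglongrightarrow> K * (\<Sum>n. (real n + 1) powr (-s))"
    unfolding I1[symmetric]
  proof (rule tendsto_integral_exhaust[OF fint])
    show "\<forall>\<^sub>F N in sequentially. x \<in> {- real N..real N}" for x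
    proof -
      obtain n0 :: nat where "\<bar>x\<bar> \<le> real n0" using real_arch_simple by blast
      then have "x \<in> {- real N..real N}" if "N \<ge> n0" for N using that by auto
      then show ?thesis by (auto simp: eventually_sequentially)
    qed
  qed (auto simp: f_def wt_nonneg)
  define p where "p v = wt v * (exp (v * s / 2) + exp (v * (1 - s) / 2))" for v
  define e1 where "e1 v = exp (- ((s-1)/2) * v)" for v
  define e2 where "e2 v = exp (- (s/2) * v)" for v
  have cp: "continuous_on {0..real N} p" for N
    unfolding p_def by (intro continuous_intros continuous_on_subset[OF wt_cont]) auto
  \<comment> \<open>The folding leaves the integrand of \<open>Phi\<close> and two elementary
    exponentials, whose integrals tend to \<open>2 / (s - 1)\<close> and
    \<open>2 / s\<close>.\<close>
  have split: "integral {- real N..real N} f = integral {0..real N} p + (1/2) * integral {0..real N} e1 - (1/2) * integral {0..real N} e2" for N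
  proof -
    have fi: "f integrable_on {a..b}" for a b by (rule integrable_on_subinterval[OF fint]) auto
    have "integral {- real N..real N} f = integral {- real N..0} f + integral {0..real N} f"
      by (rule Henstock_Kurzweil_Integration.integral_combine[symmetric]) (auto intro: fi)
    also have "integral {- real N..0} f = integral {0..real N} (\<lambda>v. f (- v))"
      using Henstock_Kurzweil_Integration.integral_reflect_real[of "real N" "0" "\<lambda>v. f (- v)"] by simp
    also have "integral {0..real N} (\<lambda>v. f (- v)) + integral {0..real N} f = integral {0..real N} (\<lambda>v. f (- v) + f v)"
    proof (rule integral_add[symmetric])
      show "(\<lambda>v. f (- v)) integrable_on {0..real N}" using fi[of "- real N" 0] Henstock_Kurzweil_Integration.integrable_reflect_real[where f = f and a = "- real N" and b = 0] by simp
    qed (rule fi)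
    also have "\<dots> = integral {0..real N} (\<lambda>v. p v + ((1/2) * e1 v - (1/2) * e2 v))"
    proof (rule integral_cong)
      fix v
      have a: "exp (v/2) * exp (- (s/2 * v)) = exp (v * (1 - s)/2)" by (simp flip: exp_add add: algebra_simps add_divide_distrib diff_divide_distrib)
      have b: "e1 v = exp (v/2) * exp (- (s/2 * v))" unfolding e1_def by (simp flip: exp_add add: algebra_simps add_divide_distrib diff_divide_distrib)
      have b': "e1 v = exp (v * (1 - s)/2)" using a b by simp
      have "f (-v) = (exp (v/2) * wt v + (exp (v/2) - 1)/2) * exp (- (s/2 * v))"
        unfolding f_def wt_minus by simp
      also have "\<dots> = wt v * (exp (v/2) * exp (- (s/2 * v))) + (1/2) * (exp (v/2) * exp (- (s/2 * v))) - (1/2) * exp (- (s/2 * v))"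
        by (simp add: algebra_simps diff_divide_distrib)
      also have "\<dots> = wt v * exp (v * (1 - s)/2) + (1/2) * e1 v - (1/2) * e2 v"
        by (simp only: a b' e2_def mult_minus_left)
      finally show "f (- v) + f v = p v + ((1/2) * e1 v - (1/2) * e2 v)"
        by (simp add: f_def p_def algebra_simps)
    qed
    also have "\<dots> = integral {0..real N} p + integral {0..real N} (\<lambda>v. (1/2) * e1 v - (1/2) * e2 v)"
      by (rule integral_add; rule integrable_continuous_real) (auto intro!: cp continuous_intros simp: e1_def e2_def)
    also have "integral {0..real N} (\<lambda>v. (1/2) * e1 v - (1/2) * e2 v) = (1/2) * integral {0..real N} e1 - (1/2) * integral {0..real N} e2"
    proof -
      have "e1 integrable_on {0..real N}" "e2 integrable_on {0..real N}"
        unfolding e1_def e2_def by (intro integrable_continuous_real continuous_intros)+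
      then show ?thesis by (subst integral_diff) (auto intro: integrable_on_cmult_left)
    qed
    finally show ?thesis by simp
  qed
  have exhaust: "\<forall>\<^sub>F N in sequentially. x \<in> {0..real N}" if "x \<in> {0..}" for x
  proof -
    obtain n0 :: nat where "\<bar>x\<bar> \<le> real n0" using real_arch_simple by blast
    then have "x \<in> {0..real N}" if "N \<ge> n0" for N using that \<open>x \<in> {0..}\<close> by auto
    then show ?thesis by (auto simp: eventually_sequentially)
  qed
  have Le: "(\<lambda>N. integral {0..real N} (\<lambda>v. exp (- a * v))) \<longlonglongrightarrow> 1 / a" if "a > 0" for a
  proof -
    have h: "((\<lambda>v. exp (- a * v)) has_integral 1 / a) {0..}" using has_integral_exp_minus_to_infinity[OF that, of 0] by simp
    show ?thesis
      unfolding integral_unique[OF h, symmetric]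
      by (rule tendsto_integral_exhaust) (use h exhaust in auto)
  qed
  have L2: "(\<lambda>N. integral {0..real N} e1) \<longlonglongrightarrow> 2 / (s - 1)" "(\<lambda>N. integral {0..real N} e2) \<longlonglongrightarrow> 2 / s"
    using Le[of "(s-1)/2"] Le[of "s/2"] s by (simp_all add: e1_def[abs_def] e2_def[abs_def])
  have pc: "integral {0..real N} (phi_integrand (of_real s)) = of_real (integral {0..real N} p)" for N
  proof -
    have "phi_integrand (of_real s) = (\<lambda>v. of_real (p v))"
      unfolding phi_integrand_def p_def by (auto simp flip: exp_of_real)
    moreover have "p integrable_on {0..real N}" by (rule integrable_continuous_real) (rule cp)
    ultimately show ?thesis using integral_linear[of p "{0..real N}" complex_of_real] bounded_linear_of_real by (simp add: o_def)
  qed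
  have "(\<lambda>N. complex_of_real (integral {- real N..real N} f - (1/2) * integral {0..real N} e1 + (1/2) * integral {0..real N} e2)) \<longlonglongrightarrow> of_real (K * (\<Sum>n. (real n + 1) powr (-s)) - (1/2) * (2/(s-1)) + (1/2) * (2 / s))"
    by (intro tendsto_intros L1 L2)
  moreover have "integral {- real N..real N} f - (1/2) * integral {0..real N} e1 + (1/2) * integral {0..real N} e2 = integral {0..real N} p" for N
    unfolding split by simp
  ultimately have "(\<lambda>N. integral {0..real N} (phi_integrand (of_real s))) \<longlonglongrightarrow> of_real (K * (\<Sum>n. (real n + 1) powr (-s)) - (1/2) * (2/(s-1)) + (1/2) * (2 / s))"
    unfolding pc by (simp only:)
  from LIMSEQ_unique[OF this Phi_LIMSEQ] have "of_real (K * (\<Sum>n. (real n + 1) powr (-s)) - (1/2) * (2/(s-1)) + (1/2) * (2 / s)) = Phi (of_real s)" .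
  then show ?thesis unfolding K_def[symmetric] by (simp add: algebra_simps)
qed

section \<open>Dirichlet series\<close>

text \<open>Index \<open>n\<close> stands for the integer \<open>n + 1\<close>, as in the sums that
  characterise \<open>riemann_zeta\<close>.\<close>

definition dterm :: "complex \<Rightarrow> nat \<Rightarrow> complex" where
  "dterm s n = of_nat (Suc n) powr (- s)"

lemma norm_dterm: "norm (dterm s n) = real (Suc n) powr (- Re s)"
  unfolding dterm_def by (subst norm_powr_real_powr) auto

lemma dterm_deriv: "((\<lambda>s. dterm s n) has_field_derivative (- of_real (ln (real (Suc n))) * dterm s n)) (at s)"
proof -
  have L: "Ln (of_nat (Suc n)) = of_real (ln (real (Suc n)))"
    using Ln_of_real[of "real (Suc n)"] by (simp del: of_nat_Suc)
  have n: "complex_of_nat (Suc n) \<noteq> 0" by (simp del: of_nat_Suc)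
  show ?thesis unfolding dterm_def
    by (rule DERIV_cong[OF DERIV_chain2[OF has_field_derivative_powr_right[OF n] DERIV_minus[OF DERIV_ident]]])
       (simp only: L, simp)
qed

text \<open>Absolute convergence at the real point \<open>c\<close> dominates the series uniformly
  on \<open>Re s > c\<close>, so it can be differentiated term by term there.\<close>

lemma Dirichlet_series_deriv:
  fixes a :: "nat \<Rightarrow> complex" and c :: real
  assumes sm: "summable (\<lambda>n. norm (a n) * real (Suc n) powr (- c))" and s: "Re s > c"
  defines "F \<equiv> \<lambda>s. \<Sum>n. a n * dterm s n"
  shows "(F has_field_derivative deriv F s) (at s)"
    and "(\<lambda>n. - of_real (ln (real (Suc n))) * (a n * dterm s n)) sums deriv F s"
proof -
  let ?S = "{s. Re s > c}"
  let ?f = "\<lambda>N s. \<Sum>n<N. a n * dterm s n"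
  let ?f' = "\<lambda>N s. \<Sum>n<N. - of_real (ln (real (Suc n))) * (a n * dterm s n)"
  have op: "open ?S" by (rule open_halfspace_Re_gt)
  have ul: "uniform_limit ?S ?f F sequentially"
    unfolding F_def
  proof (rule Weierstrass_m_test[OF _ sm])
    fix n and s :: complex assume "s \<in> ?S"
    then have "real (Suc n) powr (- Re s) \<le> real (Suc n) powr (- c)" by (intro powr_mono) auto
    then show "norm (a n * dterm s n) \<le> norm (a n) * real (Suc n) powr (- c)"
      by (simp only: norm_mult norm_dterm mult_left_mono norm_ge_zero)
  qed
  have "\<exists>g'. \<forall>x\<in>?S. (F has_field_derivative g' x) (at x) \<and> (\<lambda>n. ?f' n x) \<longlonglongrightarrow> g' x"
  proof (rule has_complex_derivative_uniform_sequence[OF op])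
    fix n x show "(?f n has_field_derivative ?f' n x) (at x)"
      by (rule derivative_eq_intros dterm_deriv refl)+ (simp add: mult_ac)
  next
    fix x assume "x \<in> ?S"
    then obtain d where d: "d > 0" "cball x d \<subseteq> ?S" using op open_contains_cball by blast
    then show "\<exists>d>0. cball x d \<subseteq> ?S \<and> uniform_limit (cball x d) ?f F sequentially"
      using uniform_limit_on_subset[OF ul] by blast
  qed
  then obtain g' where g': "\<And>x. x \<in> ?S \<Longrightarrow> (F has_field_derivative g' x) (at x) \<and> (\<lambda>n. ?f' n x) \<longlonglongrightarrow> g' x" by blast
  have e: "deriv F s = g' s" using g'[of s] s DERIV_imp_deriv by auto
  show "(F has_field_derivative deriv F s) (at s)" unfolding e using g'[of s] s by auto
  show "(\<lambda>n. - of_real (ln (real (Suc n))) * (a n * dterm s n)) sums deriv F s"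
    unfolding e sums_def using g'[of s] s by auto
qed

lemma summable_Suc_powr: "c > 1 \<Longrightarrow> summable (\<lambda>n. real (Suc n) powr (- c))"
  using summable_real_powr_iff[of "-c"] by (subst (asm) summable_Suc_iff[symmetric]) simp

definition zser :: "complex \<Rightarrow> complex" where "zser s = (\<Sum>n. dterm s n)"

lemma zser_summable: "Re s > 1 \<Longrightarrow> summable (\<lambda>n. norm (dterm s n))"
  unfolding norm_dterm by (rule summable_Suc_powr)

lemma zser_deriv:
  assumes "Re s > 1"
  shows "(zser has_field_derivative deriv zser s) (at s)"
    and "(\<lambda>n. - of_real (ln (real (Suc n))) * dterm s n) sums deriv zser s"
proof -
  obtain c where c: "1 < c" "c < Re s" using dense assms by blast
  have sm: "summable (\<lambda>n. norm (1::complex) * real (Suc n) powr (- c))" using summable_Suc_powr[OF c(1)] by simp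
  have e: "(\<lambda>s. \<Sum>n. 1 * dterm s n) = zser" unfolding zser_def by simp
  show "(zser has_field_derivative deriv zser s) (at s)"
    using Dirichlet_series_deriv(1)[OF sm c(2)] unfolding e .
  show "(\<lambda>n. - of_real (ln (real (Suc n))) * dterm s n) sums deriv zser s"
    using Dirichlet_series_deriv(2)[OF sm c(2)] unfolding e by simp
qed

lemma zg_eq_zser_real:
  assumes s: "s > (1::real)"
  shows "zg (of_real s) = (of_real s - 1) * zser (of_real s)"
proof -
  define K where "K = Gamma (s/2) * pi powr (-(s/2))"
  have pos: "Gamma (s/2) > 0" using s by (intro Gamma_real_pos) auto
  have zr: "zser (of_real s) = of_real (\<Sum>n. (real n + 1) powr (-s))"
  proof -
    have "dterm (of_real s) = (\<lambda>n. of_real ((real n + 1) powr (-s)))"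
      unfolding dterm_def[abs_def] using powr_of_real[of "real _ + 1" "-s"] by (simp add: add.commute)
    moreover have "summable (\<lambda>n. (real n + 1) powr (-s))" using summable_Suc_powr[OF s] by (simp add: add.commute)
    moreover from this have "(\<lambda>n. complex_of_real ((real n + 1) powr (-s))) sums of_real (\<Sum>n. (real n + 1) powr (-s))"
      by (intro sums_of_real summable_sums)
    ultimately show ?thesis unfolding zser_def by (simp add: sums_iff)
  qed
  have P: "Phi (of_real s) = of_real K * zser (of_real s) - of_real (1 / (s - 1) - 1 / s)"
    using zeta_Mellin[OF s] unfolding zr K_def[symmetric] by simp
  have x: "xi (of_real s) = of_real (s * (s - 1) / 2 * K) * zser (of_real s)"
  proof -
    \<comment> \<open>The two pole terms of the Mellin formula cancel the summand 1 in
      \<open>xi\<close>, which explains the form of that definition.\<close>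
    have "s * (s - 1) * (1 / (s - 1) - 1 / s) = 1" using s by (simp add: field_simps)
    from arg_cong[OF this, of complex_of_real] have 1: "complex_of_real s * (of_real s - 1) * of_real (1 / (s - 1) - 1 / s) = 1"
      by (simp only: of_real_mult of_real_diff of_real_1)
    have "1 + A * (B - D) = A * B" if "A * D = 1" for A B D :: complex using that by (simp add: algebra_simps)
    note this[OF 1]
    then have "xi (of_real s) = of_real s * (of_real s - 1) * (of_real K * zser (of_real s)) / 2"
      unfolding xi_def P by (rule arg_cong)
    then show ?thesis by simp
  qed
  have rG: "rGamma (complex_of_real s / 2 + 1) = of_real (1 / (s / 2 * Gamma (s/2)))"
  proof -
    have "rGamma (complex_of_real s / 2 + 1) = of_real (rGamma (s/2 + 1))"
      using rGamma_complex_of_real[of "s/2 + 1"] by simp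
    also have "rGamma (s/2 + 1) = inverse (Gamma (s/2 + 1))" by (simp add: rGamma_inverse_Gamma)
    also have "Gamma (s/2 + 1) = s/2 * Gamma (s/2)"
      using s Gamma_plus1[of "s/2"] by (auto simp: nonpos_Ints_def)
    finally show ?thesis by (simp add: inverse_eq_divide)
  qed
  have p: "complex_of_real pi powr (of_real s / 2) = of_real (pi powr (s/2))"
    using powr_of_real[of pi "s/2"] by simp
  have "zg (of_real s) = of_real (pi powr (s/2) * (1 / (s / 2 * Gamma (s/2))) * (s * (s - 1) / 2 * K)) * zser (of_real s)"
    unfolding zg_def x rG p by simp
  also have "pi powr (s/2) * (1 / (s / 2 * Gamma (s/2))) * (s * (s - 1) / 2 * K) = (s - 1) * (pi powr (s/2) * pi powr (-(s/2)))"
  proof -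
    have "a * (1 / (s / 2 * G)) * (s * (s - 1) / 2 * (G * Q)) = (s - 1) * (a * Q)" if "G > 0" for a G Q :: real
      using that s by (simp add: divide_simps)
    from this[OF pos] show ?thesis unfolding K_def by blast
  qed
  also have "pi powr (s/2) * pi powr (-(s/2)) = 1" by (simp flip: powr_add)
  finally show ?thesis by simp
qed

text \<open>Both sides are analytic for \<open>Re s > 1\<close> and agree on the real ray, whose
  points accumulate at 2.\<close>

lemma zg_eq_zser:
  assumes s: "Re s > 1"
  shows "zg s = (s - 1) * zser s"
proof -
  let ?S = "{s. Re s > 1}"
  have op: "open ?S" by (rule open_halfspace_Re_gt)
  have "zg s - (s - 1) * zser s = 0"
  proof (rule analytic_continuation[where S = ?S and U = "of_real ` {1<..}" and \<xi> = 2 and f = "\<lambda>s. zg s - (s - 1) * zser s"])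
    have "zser holomorphic_on ?S"
      by (rule holomorphic_onI) (use zser_deriv(1) has_field_derivative_at_within field_differentiable_def in blast)
    then show "(\<lambda>s. zg s - (s - 1) * zser s) holomorphic_on ?S" by (intro holomorphic_intros)
    show "connected ?S" by (rule convex_connected, rule convex_halfspace_Re_gt)
    show "(2::complex) islimpt complex_of_real ` {1<..}"
    proof (rule islimptI)
      fix T :: "complex set" assume T: "2 \<in> T" "open T"
      then obtain e where e: "e > 0" "ball 2 e \<subseteq> T" by (meson open_contains_ball)
      have "of_real (2 + e/2) \<in> ball (2::complex) e" using e by (simp add: dist_norm norm_mult)
      moreover have "of_real (2 + e/2) \<in> complex_of_real ` {1<..}" using e by (intro imageI) auto
      moreover have "of_real (2 + e/2) \<noteq> (2::complex)" using e by (simp add: complex_eq_iff)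
      ultimately show "\<exists>y\<in>complex_of_real ` {1<..}. y \<in> T \<and> y \<noteq> 2"
        using e by blast
    qed
  qed (use s zg_eq_zser_real op in auto)
  then show ?thesis by simp
qed

text \<open>The right-hand side has the property required of the chosen function, so the choice is
  not vacuous. Whatever is chosen agrees with it on \<open>Re s > 1\<close>, hence on the connected
  punctured plane.\<close>

lemma riemann_zeta_eq:
  assumes s: "s \<noteq> 1"
  shows "riemann_zeta s = zg s / (s - 1)"
proof -
  let ?P = "\<lambda>f. f holomorphic_on (- {1}) \<and> (\<forall>s. Re s > 1 \<longrightarrow> (\<lambda>n::nat. of_nat (Suc n) powr (- s)) sums f s)"
  have P: "?P (\<lambda>s. zg s / (s - 1))"
  proof (intro conjI allI impI)
    show "(\<lambda>s. zg s / (s - 1)) holomorphic_on - {1}" by (intro holomorphic_intros) auto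
    fix s :: complex assume s: "Re s > 1"
    then have "s \<noteq> 1" by auto
    then have "zg s / (s - 1) = zser s" using zg_eq_zser[OF s] by simp
    then show "(\<lambda>n::nat. of_nat (Suc n) powr (- s)) sums (zg s / (s - 1))"
      using summable_norm_cancel[OF zser_summable[OF s]] summable_sums unfolding zser_def dterm_def[abs_def] by metis
  qed
  then have "?P riemann_zeta" unfolding riemann_zeta_def by (rule someI[of ?P])
  then have hol: "riemann_zeta holomorphic_on - {1}" and
    sm: "Re s > 1 \<Longrightarrow> (\<lambda>n::nat. of_nat (Suc n) powr (- s)) sums riemann_zeta s" for s by auto
  show ?thesis
  proof (rule analytic_continuation_open[where s = "{s. Re s > 1}" and s' = "- {1}" and f = riemann_zeta and g = "\<lambda>s. zg s / (s - 1)"])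
    show "open {s. 1 < Re s}" by (rule open_halfspace_Re_gt)
    show "{s. 1 < Re s} \<noteq> {}" by (auto intro!: exI[of _ 2])
    show "connected (- {1::complex})" by (rule connected_punctured_universe) simp
    show "riemann_zeta z = zg z / (z - 1)" if "z \<in> {s. 1 < Re s}" for z
      using sums_unique2[OF sm] P that by blast
  qed (use s hol P in auto)
qed

section \<open>Freedom from zeros under the Riemann hypothesis\<close>

lemma xi_1: "xi 1 = 1/2" by (simp add: xi_def)

text \<open>This factor vanishes exactly at -2, -4, and so on, the trivial zeros of zeta.\<close>

lemma rGamma_half_nonzero: "Re s > -2 \<Longrightarrow> rGamma (s / 2 + 1) \<noteq> 0"
  unfolding rGamma_eq_zero_iff
proof
  assume "Re s > -2" "s / 2 + 1 \<in> \<int>\<^sub>\<le>\<^sub>0"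
  then obtain n where n: "n \<le> 0" "s / 2 + 1 = of_int n" by (auto elim: nonpos_Ints_cases)
  then have "Re s / 2 + 1 = of_int n" by (metis Re_divide_numeral complex_Re_of_int one_complex.sel(1) plus_complex.sel(1))
  with n \<open>Re s > -2\<close> show False by simp
qed

text \<open>Right of the critical line a zero of \<open>zg\<close> other than 1 would be a
  nontrivial zero of zeta. The point 1, where the value of \<open>riemann_zeta\<close> is arbitrary,
  is settled by \<open>xi 1 = 1/2\<close>.\<close>

lemma RH_nonzero:
  assumes RH: riemann_hypothesis and s: "Re s > 1/2"
  shows "zg s \<noteq> 0" "xi s \<noteq> 0"
proof -
  show "zg s \<noteq> 0"
  proof
    assume z: "zg s = 0"
    show False
    proof (cases "s = 1")
      case True
      with z show False using rGamma_half_nonzero[of 1] by (simp add: zg_def xi_1)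
    next
      case False
      then have "riemann_zeta s = 0" using z riemann_zeta_eq by simp
      moreover have "s \<noteq> - of_nat (2 * n)" for n
      proof
        assume "s = - of_nat (2 * n)"
        then have "Re s = - real (2 * n)" by simp
        with s show False by simp
      qed
      ultimately have "nontrivial_zeta_zero s" using False unfolding nontrivial_zeta_zero_def by blast
      then show False using RH s unfolding riemann_hypothesis_def by auto
    qed
  qed
  then show "xi s \<noteq> 0" by (auto simp: zg_def)
qed

section \<open>The Dirichlet series of the von Mangoldt function\<close>

lemma has_sum_product_nat:
  fixes f g :: "nat \<Rightarrow> complex"
  assumes f: "summable (\<lambda>n. norm (f n))" and g: "summable (\<lambda>n. norm (g n))"
  shows "((\<lambda>(i,j). f i * g j) has_sum (suminf f * suminf g)) (UNIV \<times> UNIV)"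
proof -
  have F: "(f has_sum suminf f) UNIV" "(g has_sum suminf g) UNIV"
    by (rule norm_summable_imp_has_sum; use f g summable_norm_cancel summable_sums in blast)+
  have NF: "((\<lambda>n. norm (f n)) has_sum suminf (\<lambda>n. norm (f n))) UNIV" "((\<lambda>n. norm (g n)) has_sum suminf (\<lambda>n. norm (g n))) UNIV"
    by (rule norm_summable_imp_has_sum; use f g summable_sums in auto)+
  have "(\<lambda>p. norm (case p of (i,j) \<Rightarrow> f i * g j)) summable_on (UNIV \<times> UNIV)"
  proof (rule summable_on_SigmaI[where g = "\<lambda>i. norm (f i) * suminf (\<lambda>n. norm (g n))"])
    show "((\<lambda>j. norm (case (i, j) of (i, j) \<Rightarrow> f i * g j)) has_sum norm (f i) * suminf (\<lambda>n. norm (g n))) UNIV" for i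
      using has_sum_cmult_right[OF NF(2), of "norm (f i)"] by (simp add: norm_mult)
    show "(\<lambda>i. norm (f i) * suminf (\<lambda>n. norm (g n))) summable_on UNIV"
      using has_sum_cmult_left[OF NF(1)] has_sum_imp_summable by blast
  qed auto
  then have "(\<lambda>(i,j). f i * g j) summable_on (UNIV \<times> UNIV)"
    by (rule abs_summable_summable)
  then obtain S where S: "((\<lambda>(i,j). f i * g j) has_sum S) (UNIV \<times> UNIV)" using has_sum_infsum by blast
  have "((\<lambda>i. f i * suminf g) has_sum S) UNIV"
    by (rule has_sum_SigmaD[OF S]) (use has_sum_cmult_right[OF F(2)] in auto)
  moreover have "((\<lambda>i. f i * suminf g) has_sum suminf f * suminf g) UNIV"
    by (rule has_sum_cmult_left[OF F(1)])
  ultimately have "S = suminf f * suminf g" using has_sum_unique by blast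
  with S show ?thesis by simp
qed

text \<open>The comparison series with \<open>ln n\<close> in place of \<open>mangoldt n\<close>
  converges, being minus the derivative of the zeta series.\<close>

lemma mangoldt_summable:
  assumes "c > (1::real)"
  shows "summable (\<lambda>n. mangoldt (Suc n) * real (Suc n) powr (- c))"
proof -
  have "(\<lambda>n. - of_real (ln (real (Suc n))) * dterm (of_real c) n) sums deriv zser (of_real c)"
    by (rule zser_deriv(2)) (use assms in auto)
  then have "summable (\<lambda>n. - of_real (ln (real (Suc n))) * dterm (of_real c) n)" by (rule sums_summable)
  moreover have "dterm (of_real c) n = of_real (real (Suc n) powr (- c))" for n
    unfolding dterm_def using powr_of_real[of "real n + 1" "-c"] by (simp add: add.commute)
  ultimately have "summable (\<lambda>n. complex_of_real (- (ln (real (Suc n)) * real (Suc n) powr (- c))))"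
    by simp
  then have "summable (\<lambda>n. - (ln (real (Suc n)) * real (Suc n) powr (- c)))" by (simp only: summable_of_real_iff)
  then have sm: "summable (\<lambda>n. ln (real (Suc n)) * real (Suc n) powr (- c))" by (simp only: summable_minus_iff)
  show ?thesis
    by (rule summable_comparison_test'[OF sm, of 0])
       (use mangoldt_le[of "Suc _"] in \<open>auto simp: abs_mult mangoldt_nonneg intro!: mult_right_mono\<close>)
qed

text \<open>Summing \<open>mangoldt\<close> over the divisors of an integer gives its logarithm, so
  this series times zeta is minus the derivative of zeta. In terms of \<open>zg\<close> the extra
  factor \<open>s - 1\<close> produces the summand \<open>1 / (s - 1)\<close>.\<close>

lemma mangoldt_Dirichlet:
  assumes s: "Re s > 1" and nz: "zg s \<noteq> 0"
  shows "(\<lambda>n. of_real (mangoldt (Suc n)) * dterm s n) sums (1 / (s - 1) - deriv zg s / zg s)"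
proof -
  define f where "f n = of_real (mangoldt (Suc n)) * dterm s n" for n
  define h where "h n = of_real (ln (real (Suc n))) * dterm s n" for n
  have fs: "summable (\<lambda>n. norm (f n))"
    unfolding f_def norm_mult norm_dterm using mangoldt_summable[OF s] by (simp add: mangoldt_nonneg)
  have hs: "h sums (- deriv zser s)"
    using sums_minus[OF zser_deriv(2)[OF s]] by (simp add: h_def[abs_def])
  have prod: "((\<lambda>(i,j). f i * dterm s j) has_sum (suminf f * zser s)) (UNIV \<times> UNIV)"
    unfolding zser_def by (rule has_sum_product_nat[OF fs zser_summable[OF s]])
  let ?D = "SIGMA n:UNIV. {d. d dvd Suc n}"
  let ?g = "\<lambda>(n,d). (d - 1, Suc n div d - 1)"
  \<comment> \<open>Pairs \<open>(i, j)\<close> are grouped by the product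
    \<open>(i + 1) * (j + 1) = n + 1\<close>; the shifts by one come from indexing from 0.\<close>
  have bij: "bij_betw ?g ?D (UNIV \<times> UNIV)"
  proof (rule bij_betwI[where g = "\<lambda>(i,j). (Suc i * Suc j - 1, Suc i)"])
    show "?g \<in> ?D \<rightarrow> UNIV \<times> UNIV" by auto
    show "(\<lambda>(i, j). (Suc i * Suc j - 1, Suc i)) \<in> UNIV \<times> UNIV \<rightarrow> ?D"
      by (auto simp: dvd_def simp del: mult_Suc mult_Suc_right intro: exI[of _ "Suc _"])
    fix x assume x: "x \<in> ?D"
    obtain n d where nd: "x = (n, d)" "d dvd Suc n" using x by auto
    then obtain k where k: "Suc n = d * k" by (auto simp: dvd_def)
    then have "d > 0" "k > 0" by (metis gr0I mult_0 mult_0_right nat.distinct(1))+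
    then show "(case ?g x of (i, j) \<Rightarrow> (Suc i * Suc j - 1, Suc i)) = x"
      using nd k by (simp del: mult_Suc mult_Suc_right)
  next
    fix y :: "nat \<times> nat" assume "y \<in> UNIV \<times> UNIV"
    show "?g (case y of (i, j) \<Rightarrow> (Suc i * Suc j - 1, Suc i)) = y"
      by (cases y) (simp del: mult_Suc mult_Suc_right)
  qed
  have "((\<lambda>x. (case ?g x of (i,j) \<Rightarrow> f i * dterm s j)) has_sum (suminf f * zser s)) ?D"
    using prod by (subst has_sum_reindex_bij_betw[OF bij])
  then have "(h has_sum (suminf f * zser s)) UNIV"
  proof (rule has_sum_SigmaD)
    fix n :: nat
    have e: "(case ?g (n, d) of (i,j) \<Rightarrow> f i * dterm s j) = of_real (mangoldt d) * dterm s n" if "d dvd Suc n" for d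
    proof -
      from that obtain k where k: "Suc n = d * k" by (auto simp: dvd_def)
      then have dk: "d > 0" "k > 0" by (metis gr0I mult_0 mult_0_right nat.distinct(1))+
      have "dterm s (d - 1) * dterm s (k - 1) = dterm s n"
        unfolding dterm_def k using dk powr_times_real[of "of_nat d" "of_nat k" "-s"] by simp
      then show ?thesis using k dk by (simp add: f_def)
    qed
    have "((\<lambda>d. case ?g (n, d) of (i,j) \<Rightarrow> f i * dterm s j) has_sum (\<Sum>d | d dvd Suc n. (case ?g (n, d) of (i,j) \<Rightarrow> f i * dterm s j))) {d. d dvd Suc n}"
      by (rule has_sum_finite) auto
    also have "(\<Sum>d | d dvd Suc n. (case ?g (n, d) of (i,j) \<Rightarrow> f i * dterm s j)) = (\<Sum>d | d dvd Suc n. mangoldt d) * dterm s n"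
      unfolding sum_distrib_right by (rule sum.cong) (use e in auto)
    also have "\<dots> = h n" unfolding h_def by (subst mangoldt_sum) auto
    finally show "((\<lambda>d. case ?g (n, d) of (i,j) \<Rightarrow> f i * dterm s j) has_sum h n) {d. d dvd Suc n}" .
  qed
  then have "h sums (suminf f * zser s)" by (rule has_sum_imp_sums)
  with hs have eq: "suminf f * zser s = - deriv zser s" using sums_unique2 by blast
  have s1: "s - 1 \<noteq> 0" using s by auto
  have zs: "zser s \<noteq> 0" using nz zg_eq_zser[OF s] by auto
  have "(zg has_field_derivative (1 * zser s + deriv zser s * (s - 1))) (at s)"
  proof (rule DERIV_cong_ev[THEN iffD1, OF refl _ refl])
    show "((\<lambda>s. (s - 1) * zser s) has_field_derivative (1 * zser s + deriv zser s * (s - 1))) (at s)"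
      by (rule DERIV_mult) (auto intro!: derivative_eq_intros zser_deriv(1) s)
    have "eventually (\<lambda>x. x \<in> {s. Re s > 1}) (nhds s)"
      by (rule eventually_nhds_in_open) (use s open_halfspace_Re_gt in auto)
    then show "\<forall>\<^sub>F x in nhds s. (x - 1) * zser x = zg x"
      by eventually_elim (simp add: zg_eq_zser)
  qed
  then have "deriv zg s = zser s + deriv zser s * (s - 1)" using DERIV_imp_deriv by fastforce
  then have "deriv zg s / zg s = 1 / (s - 1) + deriv zser s / zser s"
    unfolding zg_eq_zser[OF s] using s1 zs by (simp add: field_simps)
  moreover have "suminf f = - deriv zser s / zser s" using eq zs by (simp add: field_simps)
  ultimately have "suminf f = 1 / (s - 1) - deriv zg s / zg s" by simp
  then show ?thesis using summable_sums[OF summable_norm_cancel[OF fs]] unfolding f_def by simp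
qed

section \<open>Growth estimates\<close>

text \<open>The expression is \<open>s - 1\<close> times the integral of
  \<open>a powr (-s) - u powr (-s)\<close> over \<open>a \<le> u \<le> a + 1\<close>, and
  \<open>u powr (-s)\<close> moves there by at most \<open>norm s * a powr (- Re s - 1)\<close>. Two
  mean value inequalities give the same bound without the integral.\<close>

lemma powr_Suc_diff_bound:
  fixes s :: complex and a :: real
  assumes a: "a > 0" and s: "Re s > 0"
  shows "norm ((s - 1) * of_real a powr (-s) + of_real (a + 1) powr (1 - s) - of_real a powr (1 - s))
           \<le> norm (s - 1) * norm s * a powr (- Re s - 1)"
proof -
  define S where "S = closed_segment (complex_of_real a) (of_real (a + 1))"
  have S: "\<exists>x\<in>{a..a+1}. u = of_real x" if "u \<in> S" for u
  proof -
    from that obtain t where t: "0 \<le> t" "t \<le> 1" "u = (1 - t) *\<^sub>R of_real a + t *\<^sub>R of_real (a + 1)"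
      unfolding S_def in_segment by auto
    then have "u = of_real (a + t)" by (simp add: scaleR_conv_of_real algebra_simps)
    with t show ?thesis by (intro bexI[of _ "a + t"]) auto
  qed
  have aS: "of_real a \<in> S" "of_real (a + 1) \<in> S" unfolding S_def by auto
  have cS: "convex S" unfolding S_def by (rule convex_closed_segment)
  have np: "u \<notin> \<real>\<^sub>\<le>\<^sub>0" if "u \<in> S" for u using S[OF that] a by auto
  define B where "B = norm s * a powr (- Re s - 1)"
  have g: "norm (u powr (-s) - of_real a powr (-s)) \<le> B" if u: "u \<in> S" for u
  proof -
    have "norm (u powr (-s) - of_real a powr (-s)) \<le> B * norm (u - of_real a)"
    proof (rule field_differentiable_bound[OF cS _ _ u aS(1)])
      show "((\<lambda>u. u powr (-s)) has_field_derivative (- s * z powr (- s - 1))) (at z within S)" if "z \<in> S" for z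
        by (rule has_field_derivative_at_within[OF has_field_derivative_powr[OF np[OF that]]])
      show "norm (- s * z powr (- s - 1)) \<le> B" if z: "z \<in> S" for z
      proof -
        obtain x where x: "x \<in> {a..a+1}" "z = of_real x" using S[OF z] by auto
        have "norm (z powr (- s - 1)) = x powr (- Re s - 1)"
          using x a by (subst norm_powr_real_powr) auto
        also have "\<dots> \<le> a powr (- Re s - 1)"
          using x a s by (intro powr_mono2') auto
        finally show ?thesis unfolding B_def norm_mult norm_minus_cancel by (intro mult_left_mono) auto
      qed
    qed
    also have "\<dots> \<le> B * 1"
    proof (rule mult_left_mono)
      obtain x where x: "x \<in> {a..a+1}" "u = of_real x" using S[OF u] by auto
      have "norm (u - of_real a) = norm (complex_of_real (x - a))" using x by simp
      also have "\<dots> = x - a" using x by (simp only: norm_of_real) auto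
      finally show "norm (u - of_real a) \<le> 1" using x by simp
    qed (simp add: B_def)
    finally show ?thesis by simp
  qed
  define F where "F u = (s - 1) * of_real a powr (-s) * u + u powr (1 - s)" for u :: complex
  have "norm (F (of_real (a + 1)) - F (of_real a)) \<le> (norm (s - 1) * B) * norm (of_real (a + 1) - complex_of_real a)"
  proof (rule field_differentiable_bound[OF cS _ _ aS(2) aS(1)])
    fix u assume u: "u \<in> S"
    have "((\<lambda>u. u powr (1 - s)) has_field_derivative ((1 - s) * u powr (1 - s - 1))) (at u within S)"
      by (rule has_field_derivative_at_within[OF has_field_derivative_powr[OF np[OF u]]])
    moreover have "((\<lambda>u. (s - 1) * of_real a powr (-s) * u) has_field_derivative ((s - 1) * of_real a powr (-s))) (at u within S)"
      by (auto intro!: derivative_eq_intros)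
    ultimately show "(F has_field_derivative ((s - 1) * of_real a powr (-s) + (1 - s) * u powr (- s))) (at u within S)"
      unfolding F_def using DERIV_add by fastforce
    have "(s - 1) * of_real a powr (-s) + (1 - s) * u powr (- s) = (1 - s) * (u powr (-s) - of_real a powr (-s))"
      by (simp add: algebra_simps)
    also have "norm \<dots> \<le> norm (s - 1) * B"
      unfolding norm_mult norm_minus_commute[of 1 s] by (intro mult_left_mono g u) auto
    finally show "norm ((s - 1) * of_real a powr (-s) + (1 - s) * u powr (- s)) \<le> norm (s - 1) * B" .
  qed
  moreover have "F (of_real (a + 1)) - F (of_real a) =
     (s - 1) * of_real a powr (-s) + of_real (a + 1) powr (1 - s) - of_real a powr (1 - s)"
    by (simp add: F_def algebra_simps)
  ultimately show ?thesis by (simp add: B_def mult_ac)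
qed

definition zdiff :: "complex \<Rightarrow> nat \<Rightarrow> complex" where
  "zdiff s n = (s - 1) * of_real (real (Suc n)) powr (-s) + of_real (real (Suc n) + 1) powr (1 - s) - of_real (real (Suc n)) powr (1 - s)"

lemma zdiff_bound: "Re s > 0 \<Longrightarrow> norm (zdiff s n) \<le> norm (s - 1) * norm s * real (Suc n) powr (- Re s - 1)"
  unfolding zdiff_def by (rule powr_Suc_diff_bound) auto

text \<open>For \<open>Re s > 1\<close> the partial sums telescope to \<open>s - 1\<close> times
  those of zeta, plus a power of \<open>N + 1\<close> that tends to 0, minus 1. The terms are
  \<open>O(n powr (- Re s - 1))\<close>, so the series continues \<open>zg\<close> to
  \<open>Re s > 0\<close>.\<close>

lemma zg_series:
  assumes s: "Re s > 0"
  shows "zg s = 1 + (\<Sum>n. zdiff s n)"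
proof -
  let ?S = "{s. Re s > 0}"
  have op: "open ?S" by (rule open_halfspace_Re_gt)
  have hol: "(\<lambda>s. \<Sum>n. zdiff s n) holomorphic_on ?S"
  proof (rule holomorphic_uniform_sequence[OF op])
    show "(\<lambda>s. \<Sum>n<N. zdiff s n) holomorphic_on ?S" for N
      unfolding zdiff_def by (intro holomorphic_intros)
    fix x assume x: "x \<in> ?S"
    define r where "r = Re x / 2"
    have r: "r > 0" using x by (simp add: r_def)
    have Re: "Re y \<ge> r" "norm y \<le> norm x + r" if "y \<in> cball x r" for y
    proof -
      have d: "norm (x - y) \<le> r" using that by (simp add: dist_norm)
      have "Re (x - y) \<le> r" using complex_Re_le_cmod[of "x - y"] d by linarith
      then show "Re y \<ge> r" by (simp add: r_def)
      show "norm y \<le> norm x + r" using d norm_triangle_sub[of y x] by (simp add: norm_minus_commute)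
    qed
    have "uniform_limit (cball x r) (\<lambda>N s. \<Sum>n<N. zdiff s n) (\<lambda>s. \<Sum>n. zdiff s n) sequentially"
    proof (rule Weierstrass_m_test)
      fix n y assume y: "y \<in> cball x r"
      have "norm (zdiff y n) \<le> norm (y - 1) * norm y * real (Suc n) powr (- Re y - 1)"
        by (rule zdiff_bound) (use Re(1)[OF y] r in auto)
      also have "\<dots> \<le> (norm x + r + 1) * (norm x + r) * real (Suc n) powr (- (r + 1))"
        using Re[OF y] norm_triangle_ineq4[of y 1] r
        by (intro mult_mono powr_mono) (auto intro: order.trans)
      finally show "norm (zdiff y n) \<le> (norm x + r + 1) * (norm x + r) * real (Suc n) powr (- (r + 1))" .
    next
      show "summable (\<lambda>n. (norm x + r + 1) * (norm x + r) * real (Suc n) powr (- (r + 1)))"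
        by (intro summable_mult summable_Suc_powr) (use r in auto)
    qed
    moreover have "cball x r \<subseteq> ?S" using Re r by force
    ultimately show "\<exists>d>0. cball x d \<subseteq> ?S \<and> uniform_limit (cball x d) (\<lambda>N s. \<Sum>n<N. zdiff s n) (\<lambda>s. \<Sum>n. zdiff s n) sequentially"
      using r by blast
  qed
  have eq: "zg z = 1 + (\<Sum>n. zdiff z n)" if z: "Re z > 1" for z
  proof -
    have part: "(\<Sum>n<N. zdiff z n) = (z - 1) * (\<Sum>n<N. dterm z n) + of_real (real (Suc N)) powr (1 - z) - 1" for N
      by (induction N) (auto simp: zdiff_def dterm_def algebra_simps)
    have "(\<lambda>N. norm (of_real (real (Suc N)) powr (1 - z))) \<longlonglongrightarrow> 0"
    proof -
      have "(\<lambda>N. real (Suc N) powr (- (Re z - 1))) \<longlonglongrightarrow> 0"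
        by (rule tendsto_neg_powr) (use z filterlim_compose[OF filterlim_real_sequentially filterlim_Suc] in auto)
      then show ?thesis by (subst norm_powr_real_powr) auto
    qed
    then have l0: "(\<lambda>N. of_real (real (Suc N)) powr (1 - z)) \<longlonglongrightarrow> 0" by (rule tendsto_norm_zero_cancel)
    have "(\<lambda>N. \<Sum>n<N. dterm z n) \<longlonglongrightarrow> zser z"
      unfolding zser_def by (rule summable_LIMSEQ[OF summable_norm_cancel[OF zser_summable[OF z]]])
    then have "(\<lambda>N. (z - 1) * (\<Sum>n<N. dterm z n) + of_real (real (Suc N)) powr (1 - z) - 1) \<longlonglongrightarrow> (z - 1) * zser z + 0 - 1"
      by (intro tendsto_intros l0)
    then have "(\<lambda>n. zdiff z n) sums (zg z - 1)"
      unfolding sums_def part zg_eq_zser[OF z] by simp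
    then show ?thesis by (simp add: sums_iff)
  qed
  show ?thesis
  proof (rule analytic_continuation_open[where s = "{s. Re s > 1}" and s' = ?S and f = zg and g = "\<lambda>s. 1 + (\<Sum>n. zdiff s n)"])
    show "open {s. 1 < Re s}" "open ?S" by (rule open_halfspace_Re_gt)+
    show "{s. 1 < Re s} \<noteq> {}" by (auto intro!: exI[of _ 2])
    show "connected ?S" by (rule convex_connected, rule convex_halfspace_Re_gt)
    show "(\<lambda>s. 1 + (\<Sum>n. zdiff s n)) holomorphic_on ?S" using hol by (intro holomorphic_intros)
  qed (use s eq zg_holomorphic in auto)
qed

text \<open>For \<open>Re s \<ge> 1/4\<close> the exponent in \<open>zdiff_bound\<close> is at most
  -5/4. The range has to reach left of the critical line, because \<open>xi (s - h)\<close> with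
  \<open>h < 1/4\<close> is estimated later.\<close>

lemma zg_bound:
  obtains C where "C \<ge> 1" "\<And>s. Re s \<ge> 1/4 \<Longrightarrow> norm (zg s) \<le> C * (1 + norm s)\<^sup>2"
proof -
  define D where "D = (\<Sum>n. real (Suc n) powr (- (5/4)))"
  have sm: "summable (\<lambda>n. real (Suc n) powr (- (5/4)))" by (rule summable_Suc_powr) auto
  have D0: "D \<ge> 0" unfolding D_def by (rule suminf_nonneg[OF sm]) auto
  show ?thesis
  proof (rule that)
    show "1 + D \<ge> 1" using D0 by simp
    fix s :: complex assume s: "Re s \<ge> 1/4"
    have b: "norm (zdiff s n) \<le> (1 + norm s)\<^sup>2 * real (Suc n) powr (- (5/4))" for n
    proof -
      have "norm (zdiff s n) \<le> norm (s - 1) * norm s * real (Suc n) powr (- Re s - 1)"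
        by (rule zdiff_bound) (use s in auto)
      also have "\<dots> \<le> ((1 + norm s) * (1 + norm s)) * real (Suc n) powr (- (5/4))"
        using s norm_triangle_ineq4[of s 1] by (intro mult_mono powr_mono) auto
      finally show ?thesis by (simp add: power2_eq_square)
    qed
    have sm2: "summable (\<lambda>n. (1 + norm s)\<^sup>2 * real (Suc n) powr (- (5/4)))" by (intro summable_mult sm)
    have sn: "summable (\<lambda>n. norm (zdiff s n))"
      by (rule summable_comparison_test'[OF sm2, of 0]) (use b in auto)
    have "norm (zg s) \<le> 1 + norm (\<Sum>n. zdiff s n)"
      using zg_series[of s] s norm_triangle_ineq[of 1 "\<Sum>n. zdiff s n"] by simp
    also have "norm (\<Sum>n. zdiff s n) \<le> (\<Sum>n. norm (zdiff s n))" by (rule summable_norm[OF sn])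
    also have "\<dots> \<le> (\<Sum>n. (1 + norm s)\<^sup>2 * real (Suc n) powr (- (5/4)))" by (rule suminf_le[OF b sn sm2])
    also have "\<dots> = (1 + norm s)\<^sup>2 * D" unfolding D_def by (rule suminf_mult[OF sm])
    finally have "norm (zg s) \<le> 1 + (1 + norm s)\<^sup>2 * D" by simp
    moreover have "1 \<le> (1 + norm s)\<^sup>2" by (rule one_le_power) auto
    moreover have "(1 + D) * (1 + norm s)\<^sup>2 = (1 + norm s)\<^sup>2 + (1 + norm s)\<^sup>2 * D" by (simp add: algebra_simps)
    ultimately show "norm (zg s) \<le> (1 + D) * (1 + norm s)\<^sup>2" by linarith
  qed
qed

text \<open>The terms after the first have moduli with sum at most
  \<open>pi\<^sup>2 / 6 - 1\<close>, which is below 3/4.\<close>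

lemma zser_lower:
  assumes s: "Re s \<ge> 2"
  shows "norm (zser s) \<ge> 1/4"
proof -
  have s1: "Re s > 1" using s by simp
  have sm: "summable (\<lambda>n. norm (dterm s n))" by (rule zser_summable[OF s1])
  have sm': "summable (\<lambda>n. norm (dterm s (Suc n)))" using sm by (subst summable_Suc_iff)
  have q: "(\<lambda>n. 1 / real (Suc n) ^ 2) sums (pi\<^sup>2 / 6)" using inverse_squares_sums by (simp add: add.commute)
  then have q': "(\<lambda>n. 1 / real (Suc (Suc n)) ^ 2) sums (pi\<^sup>2 / 6 - 1)"
    by (subst sums_Suc_iff) simp
  have "zser s = dterm s 0 + (\<Sum>n. dterm s (Suc n))"
    unfolding zser_def using suminf_split_head[OF summable_norm_cancel[OF sm]] by simp
  then have "zser s = 1 + (\<Sum>n. dterm s (Suc n))" by (simp add: dterm_def)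
  moreover have "norm (\<Sum>n. dterm s (Suc n)) \<le> pi\<^sup>2 / 6 - 1"
  proof -
    have "norm (\<Sum>n. dterm s (Suc n)) \<le> (\<Sum>n. norm (dterm s (Suc n)))" by (rule summable_norm[OF sm'])
    also have "\<dots> \<le> (\<Sum>n. 1 / real (Suc (Suc n)) ^ 2)"
    proof (rule suminf_le[OF _ sm' sums_summable[OF q']])
      fix n
      have "real (Suc (Suc n)) powr (- Re s) \<le> real (Suc (Suc n)) powr (- 2)" using s by (intro powr_mono) auto
      also have "\<dots> = 1 / real (Suc (Suc n)) ^ 2" by (simp add: powr_minus_divide)
      finally show "norm (dterm s (Suc n)) \<le> 1 / real (Suc (Suc n)) ^ 2" unfolding norm_dterm .
    qed
    also have "\<dots> = pi\<^sup>2 / 6 - 1" using q' by (simp add: sums_iff)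
    finally show ?thesis .
  qed
  moreover have "pi\<^sup>2 \<le> (16/5)\<^sup>2" using pi_approx by (intro power_mono) auto
  moreover have "1 \<le> norm (zser s) + norm (\<Sum>n. dterm s (Suc n))" if "zser s = 1 + (\<Sum>n. dterm s (Suc n))"
    using norm_triangle_ineq4[of "zser s" "\<Sum>n. dterm s (Suc n)"] that by simp
  ultimately show ?thesis by (simp add: power2_eq_square)
qed

section \<open>Digamma and Gamma in the right half-plane\<close>

lemma Ln_Suc_diff_bound:
  assumes w: "Re w \<ge> 1"
  shows "norm (Ln (w + 1) - Ln w - inverse w) \<le> 1 / (norm w)\<^sup>2"
proof -
  define S where "S = closed_segment w (w + 1)"
  have S: "\<exists>t\<in>{0..1}. u = w + of_real t" if "u \<in> S" for u
  proof -
    from that obtain t where t: "0 \<le> t" "t \<le> 1" "u = (1 - t) *\<^sub>R w + t *\<^sub>R (w + 1)"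
      unfolding S_def in_segment by auto
    then have "u = w + of_real t" by (simp add: scaleR_conv_of_real algebra_simps)
    with t show ?thesis by (intro bexI[of _ t]) auto
  qed
  have w0: "w \<noteq> 0" using w by auto
  have nS: "norm w \<le> norm u" "u \<noteq> 0" "u \<notin> \<real>\<^sub>\<le>\<^sub>0" "norm (u - w) \<le> 1" if uS: "u \<in> S" for u
  proof -
    obtain t where t: "t \<in> {0..1}" "u = w + of_real t" using S[OF uS] by blast
    have "(Re w)\<^sup>2 \<le> (Re u)\<^sup>2" using t w by (intro power_mono) auto
    then show "norm w \<le> norm u" unfolding cmod_def using t by (intro real_sqrt_le_mono) auto
    then show "u \<noteq> 0" using w0 by auto
    have "Re u > 0" using t w by simp
    then show "u \<notin> \<real>\<^sub>\<le>\<^sub>0" by (auto simp: complex_nonpos_Reals_iff)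
    show "norm (u - w) \<le> 1" using t by simp
  qed
  have "norm ((\<lambda>u. Ln u - u * inverse w) (w + 1) - (\<lambda>u. Ln u - u * inverse w) w) \<le> (1 / (norm w)\<^sup>2) * norm (w + 1 - w)"
  proof (rule field_differentiable_bound[where S = S])
    fix u assume u: "u \<in> S"
    show "((\<lambda>u. Ln u - u * inverse w) has_field_derivative (inverse u - inverse w)) (at u within S)"
      by (rule has_field_derivative_at_within) (auto intro!: derivative_eq_intros nS[OF u] simp: nS[OF u] w0 inverse_eq_divide)
    have "inverse u - inverse w = (w - u) / (u * w)" using nS[OF u] w0 by (simp add: field_simps)
    then have "norm (inverse u - inverse w) = norm (u - w) / (norm u * norm w)" by (simp add: norm_divide norm_mult norm_minus_commute)
    also have "\<dots> \<le> 1 / (norm w * norm w)"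
      using nS[OF u] w0 by (intro frac_le mult_mono) auto
    finally show "norm (inverse u - inverse w) \<le> 1 / (norm w)\<^sup>2" by (simp add: power2_eq_square)
  qed (auto simp: S_def)
  moreover have "(w + 1) * inverse w - w * inverse w = inverse w" using w0 by (simp add: field_simps)
  ultimately show ?thesis by (simp add: algebra_simps)
qed

text \<open>The limit formula for \<open>Digamma\<close> turns the difference into the sum over
  \<open>k\<close> of \<open>Ln (z + k + 1) - Ln (z + k) - 1 / (z + k)\<close>, whose terms are
  small of second order.\<close>

lemma Digamma_bound:
  assumes z: "Re z \<ge> 1"
  shows "norm (Digamma z - Ln z) \<le> 4 / norm z"
proof -
  have z0: "z \<noteq> 0" using z by auto
  define a where "a = norm z"
  have a: "a \<ge> 1" using z complex_Re_le_cmod[of z] unfolding a_def by linarith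
  have "(\<lambda>m. of_real (ln (real m)) - (\<Sum>n<m. inverse (z + of_nat n))) \<longlonglongrightarrow> Digamma z"
    by (rule Digamma_LIMSEQ) (rule z0)
  then have l1: "(\<lambda>m. of_real (ln (real m)) - (\<Sum>n<m. inverse (z + of_nat n)) - Ln z) \<longlonglongrightarrow> Digamma z - Ln z"
    by (intro tendsto_intros)
  have l2: "(\<lambda>m. Ln (z + of_nat m) - of_real (ln (real m))) \<longlonglongrightarrow> 0"
  proof -
    have "(\<lambda>m. Ln (1 + z / of_nat m)) \<longlonglongrightarrow> Ln (1 + 0)"
      by (intro tendsto_intros tendsto_divide_0[OF tendsto_const] tendsto_of_nat) auto
    then have "(\<lambda>m. Ln (1 + z / of_nat m)) \<longlonglongrightarrow> 0" by simp
    moreover have "eventually (\<lambda>m. Ln (1 + z / of_nat m) = Ln (z + of_nat m) - of_real (ln (real m))) sequentially"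
      using eventually_gt_at_top[of 0]
    proof eventually_elim
      case (elim m)
      have "Re (1 + z / of_nat m) > 0" using z elim by (simp add: Re_divide_of_nat add_pos_nonneg)
      then have ne: "1 + z / of_nat m \<noteq> 0" by (metis less_irrefl zero_complex.sel(1))
      have "z + of_nat m = of_real (real m) * (1 + z / of_nat m)" using elim by (simp add: field_simps)
      then have "Ln (z + of_nat m) = of_real (ln (real m)) + Ln (1 + z / of_nat m)"
        using Ln_times_of_real[of "real m" "1 + z / of_nat m"] elim ne by simp
      then show ?case by simp
    qed
    ultimately show ?thesis by (rule Lim_transform_eventually)
  qed
  have l3: "(\<lambda>m. \<Sum>k<m. Ln (z + of_nat k + 1) - Ln (z + of_nat k) - inverse (z + of_nat k)) \<longlonglongrightarrow> Digamma z - Ln z"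
  proof -
    have tel: "(\<Sum>k<m. Ln (z + of_nat k + 1) - Ln (z + of_nat k)) = Ln (z + of_nat m) - Ln z" for m
      by (induction m) (auto simp: algebra_simps)
    have "(\<Sum>k<m. Ln (z + of_nat k + 1) - Ln (z + of_nat k) - inverse (z + of_nat k)) =
      (of_real (ln (real m)) - (\<Sum>n<m. inverse (z + of_nat n)) - Ln z) + (Ln (z + of_nat m) - of_real (ln (real m)))" for m
      by (subst sum_subtractf) (simp add: tel)
    then show ?thesis using tendsto_add[OF l1 l2] by simp
  qed
  have "norm (\<Sum>k<m. Ln (z + of_nat k + 1) - Ln (z + of_nat k) - inverse (z + of_nat k)) \<le> 4 / a" for m
  proof -
    have "norm (\<Sum>k<m. Ln (z + of_nat k + 1) - Ln (z + of_nat k) - inverse (z + of_nat k)) \<le>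
      (\<Sum>k<m. norm (Ln (z + of_nat k + 1) - Ln (z + of_nat k) - inverse (z + of_nat k)))" by (rule norm_sum)
    also have "\<dots> \<le> (\<Sum>k<m. 2 / (a + real k - 1/2) - 2 / (a + real (Suc k) - 1/2))"
    proof (rule sum_mono)
      fix k
      have "norm (Ln (z + of_nat k + 1) - Ln (z + of_nat k) - inverse (z + of_nat k)) \<le> 1 / (norm (z + of_nat k))\<^sup>2"
        by (rule Ln_Suc_diff_bound) (use z in auto)
      \<comment> \<open>Since \<open>Re z > 0\<close>, the square of \<open>norm (z + k)\<close> is
        at least half that of \<open>a + k\<close>. Subtracting 1/4 makes the reciprocal
        telescope.\<close>
      also have "\<dots> \<le> 1 / (((a + real k)\<^sup>2 - 1/4) / 2)"
      proof (rule divide_left_mono)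
        have "(a + real k)\<^sup>2 \<le> 2 * (a\<^sup>2 + (real k)\<^sup>2)" using sum_squares_bound[of a "real k"] by (simp add: power2_sum)
        moreover have "a\<^sup>2 + (real k)\<^sup>2 \<le> (norm (z + of_nat k))\<^sup>2"
          unfolding a_def cmod_power2 using z by (simp add: power2_sum)
        ultimately show "((a + real k)\<^sup>2 - 1/4) / 2 \<le> (norm (z + of_nat k))\<^sup>2" by simp
        have "1 \<le> (a + real k)\<^sup>2" using a by (intro one_le_power) auto
        moreover have "z + of_nat k \<noteq> 0" using z by (auto simp: complex_eq_iff)
        ultimately show "0 < (norm (z + of_nat k))\<^sup>2 * (((a + real k)\<^sup>2 - 1/4) / 2)" by simp
      qed auto
      also have "\<dots> = 2 / (a + real k - 1/2) - 2 / (a + real (Suc k) - 1/2)"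
      proof -
        have "a + real k - 1/2 > 0" "a + real k + 1/2 > 0" using a by auto
        then show ?thesis by (simp add: field_simps power2_eq_square)
      qed
      finally show "norm (Ln (z + of_nat k + 1) - Ln (z + of_nat k) - inverse (z + of_nat k)) \<le> 2 / (a + real k - 1/2) - 2 / (a + real (Suc k) - 1/2)" .
    qed
    also have "\<dots> = 2 / (a - 1/2) - 2 / (a + real m - 1/2)"
      using sum_lessThan_telescope'[of "\<lambda>k. 2 / (a + real k - 1/2)" m] by simp
    also have "\<dots> \<le> 2 / (a - 1/2)" using a by simp
    also have "\<dots> \<le> 4 / a" using a by (simp add: field_simps)
    finally show ?thesis .
  qed
  then show ?thesis unfolding a_def using l3
    by (intro Lim_norm_ubound[OF _ l3] always_eventually) auto
qed

text \<open>On the horizontal ray the real part of \<open>Digamma\<close> is at least -4, because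
  that of \<open>Ln\<close> is nonnegative when the modulus is at least 1. Hence
  \<open>ln (norm (Gamma (w + x))) + 4 * x\<close> does not decrease.\<close>

lemma Gamma_ratio_bound:
  assumes w: "Re w \<ge> 1" and u: "u \<ge> 0"
  shows "norm (Gamma w) \<le> exp (4 * u) * norm (Gamma (w + of_real u))"
proof -
  have nG: "norm (Gamma z) = exp (Re (ln_Gamma z))" if "Re z \<ge> 1" for z
  proof -
    have "z \<notin> \<int>\<^sub>\<le>\<^sub>0" using that by (auto elim!: nonpos_Ints_cases)
    then show ?thesis by (simp add: Gamma_complex_altdef)
  qed
  define h where "h x = Re (ln_Gamma (w + of_real x))" for x
  have "(\<lambda>x. h x + 4 * x) 0 \<le> (\<lambda>x. h x + 4 * x) u"
  proof (rule DERIV_nonneg_imp_nondecreasing[where f = "\<lambda>x. h x + 4 * x"])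
    show "0 \<le> u" by fact
    fix x :: real assume x: "0 \<le> x" "x \<le> u"
    have R: "Re (w + of_real x) \<ge> 1" using w x by simp
    then have np: "w + of_real x \<notin> \<real>\<^sub>\<le>\<^sub>0" by (auto simp: complex_nonpos_Reals_iff)
    have "((\<lambda>x. ln_Gamma (w + of_real x)) has_vector_derivative (1 * Digamma (w + of_real x))) (at x)"
    proof (rule field_vector_diff_chain_at[unfolded o_def, where f = "\<lambda>x. w + of_real x"])
      show "((\<lambda>x. w + complex_of_real x) has_vector_derivative 1) (at x)"
        unfolding has_vector_derivative_def by (auto intro!: derivative_eq_intros simp: scaleR_conv_of_real)
      show "(ln_Gamma has_field_derivative Digamma (w + of_real x)) (at (w + of_real x))"
        by (rule has_field_derivative_ln_Gamma_complex[OF np])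
    qed
    then have "((\<lambda>x. Re (ln_Gamma (w + of_real x))) has_vector_derivative Re (Digamma (w + of_real x))) (at x)"
      using bounded_linear.has_vector_derivative[OF bounded_linear_Re] by fastforce
    then have "(h has_real_derivative Re (Digamma (w + of_real x))) (at x)"
      unfolding h_def has_real_derivative_iff_has_vector_derivative .
    then have d: "((\<lambda>x. h x + 4 * x) has_real_derivative Re (Digamma (w + of_real x)) + 4) (at x)"
      by (auto intro!: derivative_eq_intros)
    have n1: "norm (w + of_real x) \<ge> 1" using R complex_Re_le_cmod[of "w + of_real x"] by linarith
    have "norm (Digamma (w + of_real x) - Ln (w + of_real x)) \<le> 4 / norm (w + of_real x)" by (rule Digamma_bound[OF R])
    also have "\<dots> \<le> 4" using n1 by (simp add: divide_le_eq)
    finally have "\<bar>Re (Digamma (w + of_real x)) - Re (Ln (w + of_real x))\<bar> \<le> 4"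
      using abs_Re_le_cmod[of "Digamma (w + of_real x) - Ln (w + of_real x)"] by simp
    moreover have "Re (Ln (w + of_real x)) \<ge> 0" using n1 by (subst Re_Ln) auto
    ultimately have "Re (Digamma (w + of_real x)) + 4 \<ge> 0" by linarith
    with d show "\<exists>y. ((\<lambda>x. h x + 4 * x) has_real_derivative y) (at x) \<and> 0 \<le> y" by blast
  qed
  then have "exp (h 0) \<le> exp (4 * u + h u)" by simp
  then show ?thesis using nG[of w] nG[of "w + of_real u"] w u by (simp add: h_def exp_add)
qed

text \<open>A Cayley transform that sends \<open>F z0\<close> to 0 maps the half-plane into the unit
  disc, where Schwarz's lemma applies. A nonnegative real part is the form in which the information
  on \<open>Glog\<close> is available.\<close>

lemma Borel_Caratheodory_pos:
  assumes hol: "F holomorphic_on ball z0 R" and pos: "\<And>z. z \<in> ball z0 R \<Longrightarrow> Re (F z) \<ge> 0"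
    and z: "norm (z - z0) = r" "r < R"
  shows "norm (F z - F z0) \<le> 2 * r / (R - r) * Re (F z0)"
proof -
  have R: "R > 0" "r \<ge> 0" using z norm_ge_zero[of "z - z0"] by linarith+
  \<comment> \<open>The shift by \<open>e\<close> makes the real parts strictly positive, so that
    the denominator of the Cayley transform cannot vanish; at the end \<open>e\<close> tends to
    0.\<close>
  have main: "norm (F z - F z0) \<le> 2 * r / (R - r) * (Re (F z0) + e)" if e: "e > 0" for e
  proof -
    define c where "c = F z0 + of_real e"
    have c: "Re c > 0" using pos[of z0] R e by (simp add: c_def add_nonneg_pos)
    define \<phi> where "\<phi> w = (F (z0 + of_real R * w) - F z0) / (F (z0 + of_real R * w) + of_real e + cnj c)" for w
    have inb: "z0 + of_real R * w \<in> ball z0 R" if "norm w < 1" for w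
      using that R by (simp add: dist_norm norm_mult)
    have den: "Re (F (z0 + of_real R * w) + of_real e + cnj c) > 0" if "norm w < 1" for w
      using pos[OF inb[OF that]] c e by simp
    have lt: "norm (\<phi> w) < 1" if w: "norm w < 1" for w
    proof -
      define v where "v = F (z0 + of_real R * w) + of_real e"
      have v: "Re v > 0" unfolding v_def using pos[OF inb[OF w]] e by simp
      have "0 < Re v * Re c" using v c by simp
      then have "(norm (v - c))\<^sup>2 < (norm (v + cnj c))\<^sup>2"
        unfolding cmod_power2 by (simp add: power2_eq_square algebra_simps)
      then have "norm (v - c) < norm (v + cnj c)" by (rule power2_less_imp_less) simp
      moreover have "v - c = F (z0 + of_real R * w) - F z0" by (simp add: c_def v_def)
      ultimately show ?thesis using order.strict_trans1[OF norm_ge_zero, of "v - c"]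
        unfolding \<phi>_def norm_divide v_def[symmetric] by (simp add: divide_less_eq)
    qed
    have hF: "(\<lambda>w. F (z0 + of_real R * w)) holomorphic_on ball 0 1"
    proof -
      have "(F \<circ> (\<lambda>w. z0 + of_real R * w)) holomorphic_on ball 0 1"
        by (rule holomorphic_on_compose_gen[OF _ hol]) (auto intro!: holomorphic_intros simp: inb simp del: mem_ball)
      then show ?thesis by (simp add: o_def)
    qed
    have "\<phi> holomorphic_on ball 0 1" unfolding \<phi>_def
    proof (intro holomorphic_intros hF)
      fix w :: complex assume "w \<in> ball 0 1"
      then show "F (z0 + of_real R * w) + of_real e + cnj c \<noteq> 0" using den[of w] by force
    qed
    moreover have "\<phi> 0 = 0" by (simp add: \<phi>_def)
    moreover define w where "w = (z - z0) / of_real R"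
    have w: "norm w = r / R" "norm w < 1" using z R by (simp_all add: w_def norm_divide)
    ultimately have "norm (\<phi> w) \<le> norm w" using lt by (intro Schwarz_Lemma(1)) auto
    moreover have zw: "z0 + of_real R * w = z" using R by (simp add: w_def)
    moreover have "F z + of_real e + cnj c \<noteq> 0" using den[OF w(2)] zw by force
    ultimately have "norm (F z - F z0) \<le> r / R * norm (F z + of_real e + cnj c)"
      unfolding \<phi>_def w(1) zw norm_divide by (simp add: divide_le_eq)
    also have "\<dots> \<le> r / R * (norm (F z - F z0) + 2 * Re c)"
    proof (rule mult_left_mono)
      have "F z + of_real e + cnj c = (F z - F z0) + of_real (2 * Re c)"
        by (simp add: c_def complex_eq_iff)
      also have "norm \<dots> \<le> norm (F z - F z0) + 2 * Re c"
        using norm_triangle_ineq[of "F z - F z0" "of_real (2 * Re c)"] c by simp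
      finally show "norm (F z + of_real e + cnj c) \<le> norm (F z - F z0) + 2 * Re c" .
    qed (use R in simp)
    finally have "norm (F z - F z0) * (R - r) \<le> 2 * r * Re c" using R by (simp add: field_simps)
    then have "norm (F z - F z0) \<le> 2 * r * Re c / (R - r)"
      by (subst pos_le_divide_eq) (use z in auto)
    then show ?thesis using z by (simp add: c_def)
  qed
  show ?thesis
  proof (rule tendsto_lowerbound)
    show "((\<lambda>e. 2 * r / (R - r) * (Re (F z0) + e)) \<longlongrightarrow> 2 * r / (R - r) * Re (F z0)) (at_right 0)"
      by (rule tendsto_eq_intros refl)+ (use z in auto)
    show "\<forall>\<^sub>F e in at_right 0. norm (F z - F z0) \<le> 2 * r / (R - r) * (Re (F z0) + e)"
      using eventually_at_right_less by (rule eventually_mono) (rule main)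
  qed auto
qed

text \<open>The radius 3/2 is the largest for which the disc about \<open>2 + it\<close> stays right
  of the critical line.\<close>

lemma ball_Re_Im:
  assumes "z \<in> ball (Complex 2 t) (3/2)"
  shows "Re z > 1/2" "norm z \<le> 4 + \<bar>t\<bar>"
proof -
  have d: "norm (Complex 2 t - z) < 3/2" using assms by (simp add: dist_norm)
  have "\<bar>Re (Complex 2 t - z)\<bar> < 3/2" using abs_Re_le_cmod[of "Complex 2 t - z"] d by linarith
  then show "Re z > 1/2" by (simp add: abs_if split: if_splits)
  have "norm (Complex 2 t) \<le> 2 + \<bar>t\<bar>" using cmod_le[of "Complex 2 t"] by simp
  then show "norm z \<le> 4 + \<bar>t\<bar>" using d norm_triangle_sub[of z "Complex 2 t"] by (simp add: norm_minus_commute)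
qed

text \<open>Upper bounds for \<open>zg\<close> turn into lower bounds through the Borel-Caratheodory inequality for
  \<open>M - log zg\<close>, which has nonnegative real part and is defined on the zero-free half-plane.\<close>

lemma zg_lower:
  assumes RH: riemann_hypothesis and h: "h > 0"
  obtains K k where "K > 0" "\<And>s. Re s \<ge> 1/2 + h \<Longrightarrow> inverse (norm (zg s)) \<le> K * (5 + \<bar>Im s\<bar>) ^ k"
proof -
  let ?H = "{s. Re s > 1/2}"
  obtain f where f: "f holomorphic_on ?H" "\<And>s. s \<in> ?H \<Longrightarrow> exp (f s) = zg s"
  proof (rule holomorphic_logarithm_exists[of ?H zg 2])
    show "convex ?H" "open ?H" by (rule convex_halfspace_Re_gt open_halfspace_Re_gt)+
  qed (use RH_nonzero[OF RH] zg_holomorphic in auto)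
  obtain C where C: "C \<ge> 1" "\<And>s. Re s \<ge> 1/4 \<Longrightarrow> norm (zg s) \<le> C * (1 + norm s)\<^sup>2" using zg_bound by blast
  have Ref: "Re (f s) = ln (norm (zg s))" if "Re s > 1/2" for s
    using f(2)[of s] that by (metis mem_Collect_eq norm_exp_eq_Re ln_exp)
  obtain k where k: "2 * (1 + 3 / h) \<le> real k" using real_arch_simple by blast
  \<comment> \<open>At distance \<open>h\<close> from the critical line the Borel-Caratheodory
    factor is at most \<open>3 / h\<close>; the summand 1 collects the value at the centre of the
    disc.\<close>
  define q where "q = 1 + 3 / h"
  have q: "q \<ge> 1" using h by (simp add: q_def)
  define K where "K = (4 * C) powr q"
  have "4 * C \<ge> 1" using C by simp
  then have K1: "K \<ge> 1" using q unfolding K_def by (intro ge_one_powr_ge_zero) auto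
  have right: "norm (zg s) \<ge> 1/4" if s: "Re s \<ge> 2" for s
  proof -
    have s1: "Re s > 1" using s by simp
    have "1 \<le> norm (s - 1)" using complex_Re_le_cmod[of "s - 1"] s by simp
    then have "1 * (1/4) \<le> norm (s - 1) * norm (zser s)" using zser_lower[OF s] by (intro mult_mono) auto
    then show ?thesis unfolding zg_eq_zser[OF s1] norm_mult by simp
  qed
  show ?thesis
  proof (rule that)
    show "4 * K > 0" using K1 by simp
    fix s :: complex assume s: "Re s \<ge> 1/2 + h"
    define t where "t = Im s"
    have t5: "(5 + \<bar>t\<bar>) ^ k \<ge> 1" by (rule one_le_power) auto
    show "inverse (norm (zg s)) \<le> 4 * K * (5 + \<bar>Im s\<bar>) ^ k"
    proof (cases "Re s \<ge> 2")
      case True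
      have "inverse (norm (zg s)) \<le> inverse (1/4)" using right[OF True] by (intro le_imp_inverse_le) auto
      also have "\<dots> \<le> 4 * (K * (5 + \<bar>t\<bar>) ^ k)" using K1 t5 mult_mono[of 1 K 1 "(5 + \<bar>t\<bar>) ^ k"] by simp
      finally show ?thesis by (simp add: t_def mult_ac)
    next
      case False
      define z0 where "z0 = Complex 2 t"
      \<comment> \<open>An upper bound for \<open>ln (norm (zg z))\<close> on the whole disc, so
        that \<open>M - f\<close> has nonnegative real part there.\<close>
      define M where "M = ln (C * (5 + \<bar>t\<bar>)\<^sup>2)"
      define r where "r = 2 - Re s"
      have r: "0 < r" "r \<le> 3/2 - h" using False s by (auto simp: r_def)
      have "norm (s - z0) = r"
        unfolding z0_def r_def t_def cmod_def using False by simp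
      have Mpos: "M \<ge> 0"
      proof -
        have "1 * 1 \<le> C * (5 + \<bar>t\<bar>)\<^sup>2" using C(1) by (intro mult_mono one_le_power) auto
        then show ?thesis unfolding M_def by simp
      qed
      have "norm ((of_real M - f s) - (of_real M - f z0)) \<le> 2 * r / (3/2 - r) * Re (of_real M - f z0)"
      proof (rule Borel_Caratheodory_pos[where F = "\<lambda>s. of_real M - f s"])
        show "(\<lambda>s. of_real M - f s) holomorphic_on ball z0 (3/2)"
          using ball_Re_Im unfolding z0_def by (intro holomorphic_intros holomorphic_on_subset[OF f(1)]) auto
        fix z assume z: "z \<in> ball z0 (3/2)"
        note b = ball_Re_Im[OF z[unfolded z0_def]]
        have "norm (zg z) \<le> C * (1 + norm z)\<^sup>2" by (rule C(2)) (use b in auto)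
        also have "\<dots> \<le> C * (5 + \<bar>t\<bar>)\<^sup>2" using b C(1) by (intro mult_left_mono power_mono) auto
        finally have "ln (norm (zg z)) \<le> M" unfolding M_def using RH_nonzero(1)[OF RH b(1)] C(1)
          by (subst ln_le_cancel_iff) auto
        then show "0 \<le> Re (of_real M - f z)" using Ref[OF b(1)] by simp
      qed (use \<open>norm (s - z0) = r\<close> r h in auto)
      then have 1: "Re (f z0) - Re (f s) \<le> 2 * r / (3/2 - r) * (M - Re (f z0))"
        using complex_Re_le_cmod[of "(of_real M - f s) - (of_real M - f z0)"] by simp
      have z0: "Re (f z0) \<ge> - ln 4"
      proof -
        have "ln (1/4) \<le> ln (norm (zg z0))" using right[of z0] by (subst ln_le_cancel_iff) (auto simp: z0_def)
        then show ?thesis using Ref[of z0] by (simp add: z0_def ln_div)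
      qed
      have "2 * r / (3/2 - r) * (M - Re (f z0)) \<le> 3 / h * (M + ln 4)"
      proof -
        have "2 * r / (3/2 - r) \<le> 3 / h" using r h by (intro frac_le) auto
        moreover have "0 \<le> 2 * r / (3/2 - r)" using r h by simp
        moreover have "M - Re (f z0) \<le> M + ln 4" using z0 by simp
        moreover have "0 \<le> M + ln 4" using Mpos by simp
        ultimately show ?thesis by (meson mult_left_mono mult_right_mono order_trans)
      qed
      with 1 z0 have "- Re (f s) \<le> 3 / h * (M + ln 4) + ln 4" by linarith
      also have "\<dots> \<le> q * (M + ln 4)" using Mpos by (simp add: q_def algebra_simps)
      finally have le: "- ln (norm (zg s)) \<le> q * (M + ln 4)" using Ref[of s] s h by simp
      have nz: "norm (zg s) > 0" using RH_nonzero(1)[OF RH, of s] s h by simp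
      have "inverse (norm (zg s)) = exp (- ln (norm (zg s)))" using nz by (simp add: exp_minus)
      also have "\<dots> \<le> exp (q * (M + ln 4))" using le by simp
      also have "\<dots> = (4 * C * (5 + \<bar>t\<bar>)\<^sup>2) powr q"
      proof -
        have "M + ln 4 = ln (4 * C * (5 + \<bar>t\<bar>)\<^sup>2)" unfolding M_def using C(1)
          by (simp add: ln_mult_pos mult.assoc)
        moreover have "4 * C * (5 + \<bar>t\<bar>)\<^sup>2 \<noteq> 0" using C(1) by auto
        ultimately show ?thesis by (simp add: powr_def)
      qed
      also have "\<dots> = K * ((5 + \<bar>t\<bar>)\<^sup>2) powr q" unfolding K_def using C(1) by (subst powr_mult) auto
      also have "((5 + \<bar>t\<bar>)\<^sup>2) powr q = (5 + \<bar>t\<bar>) powr (2 * q)"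
        by (simp add: powr_powr flip: powr_numeral)
      also have "K * (5 + \<bar>t\<bar>) powr (2 * q) \<le> K * (5 + \<bar>t\<bar>) powr (real k)"
        using k K1 by (intro mult_left_mono powr_mono) (auto simp: q_def)
      also have "\<dots> = K * (5 + \<bar>t\<bar>) ^ k" by (subst powr_realpow) auto
      also have "\<dots> \<le> 4 * K * (5 + \<bar>t\<bar>) ^ k" using K1 by simp
      finally show ?thesis by (simp add: t_def)
    qed
  qed
qed

lemma xi_eq_zg: "Re s > -2 \<Longrightarrow> xi s = zg s * of_real pi powr (- (s / 2)) * Gamma (s / 2 + 1)"
proof -
  assume s: "Re s > -2"
  have "rGamma (s / 2 + 1) * Gamma (s / 2 + 1) = 1"
    using rGamma_half_nonzero[OF s] by (simp add: Gamma_def)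
  moreover have "complex_of_real pi powr (s / 2) * of_real pi powr (- (s / 2)) = 1"
    by (simp flip: powr_add)
  moreover have "zg s * of_real pi powr (- (s / 2)) * Gamma (s / 2 + 1) =
     (complex_of_real pi powr (s / 2) * of_real pi powr (- (s / 2))) * (rGamma (s / 2 + 1) * Gamma (s / 2 + 1)) * xi s"
    unfolding zg_def by (simp add: mult_ac)
  ultimately show ?thesis by simp
qed

text \<open>\<open>zg\<close> is bounded polynomially from above, and at distance \<open>h\<close>
  from the critical line also from below. The arguments of the two Gamma factors differ by
  \<open>h\<close>, so their quotient is bounded. The degree may depend on \<open>h\<close>, which
  does no harm in the Phragmen-Lindelof argument.\<close>

lemma xi_quotient_bound:
  assumes RH: riemann_hypothesis and h: "h > 0" "h < 1/4"
  obtains K k where "K > 0"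
    "\<And>s. Re s \<ge> 1/2 \<Longrightarrow> norm (xi (s - of_real h) / xi (s + of_real h)) \<le> K * (5 + norm s) ^ k"
proof -
  obtain C where C: "C \<ge> 1" "\<And>s. Re s \<ge> 1/4 \<Longrightarrow> norm (zg s) \<le> C * (1 + norm s)\<^sup>2" using zg_bound by blast
  obtain K k where K: "K > 0" "\<And>s. Re s \<ge> 1/2 + h \<Longrightarrow> inverse (norm (zg s)) \<le> K * (5 + \<bar>Im s\<bar>) ^ k"
    by (rule zg_lower[OF RH h(1)]) blast
  define c where "c = pi powr h * exp (4 * h)"
  have c0: "c > 0" by (simp add: c_def)
  show ?thesis
  proof (rule that)
    show "C * K * c > 0" using C K c0 by simp
    fix s :: complex assume s: "Re s \<ge> 1/2"
    let ?a = "s - of_real h" and ?b = "s + of_real h"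
    have ra: "Re ?a \<ge> 1/4" "Re ?b \<ge> 1/2 + h" using s h by auto
    have nb: "zg ?b \<noteq> 0" using RH_nonzero(1)[OF RH, of ?b] ra h by simp
    have G: "norm (Gamma (?a / 2 + 1)) \<le> exp (4 * h) * norm (Gamma (?b / 2 + 1))"
    proof -
      have e: "(?a / 2 + 1) + of_real h = ?b / 2 + 1" by (simp add: field_simps)
      have "norm (Gamma (?a / 2 + 1)) \<le> exp (4 * h) * norm (Gamma ((?a / 2 + 1) + of_real h))"
        by (rule Gamma_ratio_bound) (use ra h in auto)
      then show ?thesis unfolding e .
    qed
    have Gb: "Gamma (?b / 2 + 1) \<noteq> 0"
      using rGamma_half_nonzero[of ?b] ra h by (auto simp: Gamma_def)
    have p: "norm (complex_of_real pi powr (- (?a / 2))) = pi powr h * norm (complex_of_real pi powr (- (?b / 2)))"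
    proof -
      have "- ((Re s - h) / 2) = h + - ((Re s + h) / 2)" by (simp add: field_simps)
      then have "pi powr (- ((Re s - h) / 2)) = pi powr h * pi powr (- ((Re s + h) / 2))" by (simp only: powr_add)
      then show ?thesis by (simp add: norm_powr_real_powr)
    qed
    have pb: "norm (complex_of_real pi powr (- (?b / 2))) > 0" by simp
    have "norm (xi ?a / xi ?b) = norm (xi ?a) / norm (xi ?b)" by (rule norm_divide)
    also have "\<dots> = (norm (zg ?a) * norm (complex_of_real pi powr (- (?a / 2))) * norm (Gamma (?a / 2 + 1))) /
      (norm (zg ?b) * norm (complex_of_real pi powr (- (?b / 2))) * norm (Gamma (?b / 2 + 1)))"
      using ra h by (subst (1 2) xi_eq_zg) (auto simp: norm_mult)
    also have "\<dots> \<le> (norm (zg ?a) * norm (complex_of_real pi powr (- (?a / 2))) * (exp (4 * h) * norm (Gamma (?b / 2 + 1)))) /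
      (norm (zg ?b) * norm (complex_of_real pi powr (- (?b / 2))) * norm (Gamma (?b / 2 + 1)))"
      using G by (intro divide_right_mono mult_left_mono) auto
    also have "\<dots> = norm (zg ?a) * inverse (norm (zg ?b)) * c"
      unfolding p c_def using nb Gb pb by (simp add: field_simps)
    also have "\<dots> \<le> (C * (5 + norm s)\<^sup>2) * (K * (5 + norm s) ^ k) * c"
    proof (intro mult_right_mono mult_mono)
      have "norm (zg ?a) \<le> C * (1 + norm ?a)\<^sup>2" by (rule C(2)) (rule ra)
      also have "\<dots> \<le> C * (5 + norm s)\<^sup>2"
        using C(1) norm_triangle_ineq4[of s "of_real h"] h by (intro mult_left_mono power_mono) auto
      finally show "norm (zg ?a) \<le> C * (5 + norm s)\<^sup>2" .
      have "inverse (norm (zg ?b)) \<le> K * (5 + \<bar>Im ?b\<bar>) ^ k" by (rule K(2)) (rule ra)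
      also have "\<dots> \<le> K * (5 + norm s) ^ k"
        using K(1) abs_Im_le_cmod[of s] by (intro mult_left_mono power_mono) auto
      finally show "inverse (norm (zg ?b)) \<le> K * (5 + norm s) ^ k" .
    qed (use C c0 in auto)
    also have "\<dots> = C * K * c * (5 + norm s) ^ (2 + k)" by (simp add: power_add power2_eq_square mult_ac)
    finally show "norm (xi ?a / xi ?b) \<le> C * K * c * (5 + norm s) ^ (2 + k)" .
  qed
qed

section \<open>Positivity of the real part of \<open>\<xi>'/\<xi>\<close>\<close>

text \<open>Polynomial growth can be damped by a polynomial: the power \<open>k + 1\<close> of
  \<open>1 + \<eta> * s\<close> has modulus at least 1 on the half-plane and outgrows the given
  bound. Letting \<open>\<eta>\<close> tend to 0 removes it.\<close>

lemma Phragmen_Lindelof_half_plane: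
  assumes hol: "B holomorphic_on {s. Re s \<ge> 0}"
    and bd: "\<And>s. Re s = 0 \<Longrightarrow> norm (B s) \<le> 1"
    and gr: "\<And>s. Re s \<ge> 0 \<Longrightarrow> norm (B s) \<le> K * (6 + norm s) ^ k" and K: "K > 0"
    and s: "Re s \<ge> 0"
  shows "norm (B s) \<le> 1"
proof -
  have main: "norm (B s) \<le> norm (1 + of_real \<eta> * s) ^ Suc k" if \<eta>: "0 < \<eta>" "\<eta> < 1" for \<eta> :: real
  proof -
    have n1: "norm (1 + of_real \<eta> * z) \<ge> 1" "norm (1 + of_real \<eta> * z) \<ge> \<eta> * norm z" if "Re z \<ge> 0" for z
    proof -
      have "Re (1 + of_real \<eta> * z) \<ge> 1" using that \<eta> by simp
      then show "norm (1 + of_real \<eta> * z) \<ge> 1" using complex_Re_le_cmod[of "1 + of_real \<eta> * z"] by linarith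
      have "norm (of_real \<eta> * z) \<le> norm (1 + of_real \<eta> * z)"
      proof -
        have "(Re (of_real \<eta> * z))\<^sup>2 \<le> (Re (1 + of_real \<eta> * z))\<^sup>2" using that \<eta> by (intro power_mono) auto
        then show ?thesis unfolding cmod_def by (intro real_sqrt_le_mono) auto
      qed
      then show "norm (1 + of_real \<eta> * z) \<ge> \<eta> * norm z" using \<eta> by (simp add: norm_mult)
    qed
    define F where "F z = B z / (1 + of_real \<eta> * z) ^ Suc k" for z
    \<comment> \<open>Large enough to enclose \<open>s\<close>, to have
      \<open>6 + R \<le> 2 * R\<close>, and to let one factor \<open>\<eta> * R\<close> absorb the
      constant \<open>K * (2 / \<eta>) ^ k\<close> on the arc.\<close>
    define R where "R = norm s + 6 + K * (2 / \<eta>) ^ k / \<eta>"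
    have R: "R \<ge> 6" "norm s \<le> R" "\<eta> * R \<ge> K * (2 / \<eta>) ^ k"
    proof -
      have "K * (2 / \<eta>) ^ k / \<eta> \<ge> 0" using K \<eta> by simp
      then show "R \<ge> 6" "norm s \<le> R" by (auto simp: R_def)
      have "K * (2 / \<eta>) ^ k / \<eta> \<le> R" by (simp add: R_def)
      then show "\<eta> * R \<ge> K * (2 / \<eta>) ^ k" using \<eta> by (simp add: field_simps)
    qed
    let ?D = "{z. Re z \<ge> 0} \<inter> cball 0 R"
    have clD: "closed ?D" by (intro closed_Int closed_halfspace_Re_ge) auto
    have nz: "1 + of_real \<eta> * z \<noteq> 0" if "Re z \<ge> 0" for z using n1(1)[OF that] by auto
    have "norm (F s) \<le> 1"
    proof (rule maximum_modulus_frontier[of F ?D])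
      have i: "{z. Re z > 0} \<inter> ball 0 R \<subseteq> interior ?D"
        by (rule interior_maximal) (auto intro!: open_Int open_halfspace_Re_gt)
      have holF: "F holomorphic_on {z. Re z \<ge> 0}" unfolding F_def
        by (intro holomorphic_intros hol) (use nz in \<open>auto simp del: power_Suc\<close>)
      show "F holomorphic_on interior ?D"
        by (rule holomorphic_on_subset[OF holF]) (use interior_subset in blast)
      show "continuous_on (closure ?D) F" unfolding closure_closed[OF clD]
        by (rule continuous_on_subset[OF holomorphic_on_imp_continuous_on[OF holF]]) auto
      show "bounded ?D" by (rule bounded_subset[OF bounded_cball]) auto
      show "s \<in> ?D" using s R by simp
      fix z assume "z \<in> frontier ?D"
      then have z: "Re z \<ge> 0" "norm z \<le> R" "Re z = 0 \<or> norm z = R"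
        using i unfolding frontier_def closure_closed[OF clD] by (force simp: less_le)+
      show "norm (F z) \<le> 1"
      proof (cases "Re z = 0")
        case True
        have "norm (B z) \<le> 1" by (rule bd[OF True])
        also have "\<dots> \<le> norm (1 + of_real \<eta> * z) ^ Suc k" by (rule one_le_power[OF n1(1)[OF z(1)]])
        finally show ?thesis using nz[OF z(1)] unfolding F_def norm_divide norm_power by (simp add: divide_le_eq_1 del: power_Suc)
      next
        case False
        then have nR: "norm z = R" using z by auto
        have "norm (B z) \<le> K * (6 + R) ^ k" using gr[OF z(1)] nR by simp
        also have "\<dots> \<le> K * (2 * R) ^ k" using R K by (intro mult_left_mono power_mono) auto
        also have "\<dots> = K * (2 / \<eta>) ^ k * (\<eta> * R) ^ k" using \<eta> by (simp add: power_mult_distrib power_divide)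
        also have "\<dots> \<le> (\<eta> * R) * (\<eta> * R) ^ k" using R \<eta> by (intro mult_right_mono) auto
        also have "\<dots> = (\<eta> * R) ^ Suc k" by simp
        also have "\<dots> \<le> norm (1 + of_real \<eta> * z) ^ Suc k" using n1(2)[OF z(1)] nR R \<eta> by (intro power_mono) auto
        finally show ?thesis using nz[OF z(1)] unfolding F_def norm_divide norm_power by (simp add: divide_le_eq_1 del: power_Suc)
      qed
    qed
    then show ?thesis using nz[OF s] unfolding F_def norm_divide norm_power by (simp add: divide_le_eq_1 del: power_Suc)
  qed
  show ?thesis
  proof (rule tendsto_lowerbound)
    have "((\<lambda>\<eta>. norm (1 + of_real \<eta> * s) ^ Suc k) \<longlongrightarrow> norm (1 + of_real 0 * s) ^ Suc k) (at_right 0)"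
      by (intro tendsto_intros)
    then show "((\<lambda>\<eta>. norm (1 + of_real \<eta> * s) ^ Suc k) \<longlongrightarrow> 1) (at_right 0)" by simp
    have "\<forall>\<^sub>F \<eta> in at_right 0. \<eta> \<in> {0<..<1::real}" by (rule eventually_at_right_real) simp
    then show "\<forall>\<^sub>F \<eta> in at_right 0. norm (B s) \<le> norm (1 + of_real \<eta> * s) ^ Suc k"
      by eventually_elim (use main in auto)
  qed auto
qed

text \<open>By the functional equation the quotient \<open>xi (s - h) / xi (s + h)\<close> has modulus 1 on the critical line, and it has
  polynomial growth to the right of it.\<close>

lemma xi_monotone:
  assumes RH: riemann_hypothesis and h: "h > 0" "h < 1/4" and s: "Re s \<ge> 1/2"
  shows "norm (xi (s - of_real h)) \<le> norm (xi (s + of_real h))"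
proof -
  obtain K k where K: "K > 0"
    "\<And>s. Re s \<ge> 1/2 \<Longrightarrow> norm (xi (s - of_real h) / xi (s + of_real h)) \<le> K * (5 + norm s) ^ k"
    by (rule xi_quotient_bound[OF RH h]) blast
  define B where "B z = xi (z + 1/2 - of_real h) / xi (z + 1/2 + of_real h)" for z
  have nz: "xi (z + 1/2 + of_real h) \<noteq> 0" if "Re z \<ge> 0" for z
    by (rule RH_nonzero(2)[OF RH]) (use that h in simp)
  have xih: "(\<lambda>z. xi (z + c)) holomorphic_on A" for c A
  proof -
    have "(xi \<circ> (\<lambda>z. z + c)) holomorphic_on A"
      by (rule holomorphic_on_compose) (auto intro!: holomorphic_intros)
    then show ?thesis by (simp add: o_def)
  qed
  have hol: "B holomorphic_on {z. Re z \<ge> 0}" unfolding B_def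
  proof (rule holomorphic_on_divide)
    show "(\<lambda>z. xi (z + 1/2 - of_real h)) holomorphic_on {z. Re z \<ge> 0}" using xih[of "1/2 - of_real h"] by (simp add: algebra_simps)
    show "(\<lambda>z. xi (z + 1/2 + of_real h)) holomorphic_on {z. Re z \<ge> 0}" using xih[of "1/2 + of_real h"] by (simp add: algebra_simps)
  qed (use nz in auto)
  have "norm (B (s - 1/2)) \<le> 1"
  proof (rule Phragmen_Lindelof_half_plane[where K = K and k = k and B = B and s = "s - 1/2", OF hol])
    show "norm (B z) \<le> 1" if z: "Re z = 0" for z
    proof -
      have "z + 1/2 - of_real h = 1 - cnj (z + 1/2 + of_real h)" using z by (simp add: complex_eq_iff)
      then have "xi (z + 1/2 - of_real h) = cnj (xi (z + 1/2 + of_real h))" by (metis xi_cnj xi_reflect)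
      then show ?thesis unfolding B_def norm_divide by simp
    qed
    show "norm (B z) \<le> K * (6 + norm z) ^ k" if z: "Re z \<ge> 0" for z
    proof -
      have "norm (B z) \<le> K * (5 + norm (z + 1/2)) ^ k" unfolding B_def by (rule K(2)) (use z in simp)
      also have "\<dots> \<le> K * (6 + norm z) ^ k"
        using K(1) norm_triangle_ineq[of z "1/2"] by (intro mult_left_mono power_mono) auto
      finally show ?thesis .
    qed
  qed (use K s in auto)
  moreover have "xi (s + of_real h) \<noteq> 0" using nz[of "s - 1/2"] s by simp
  ultimately show ?thesis by (simp add: B_def norm_divide divide_le_eq_1)
qed

definition Glog :: "complex \<Rightarrow> complex" where "Glog s = deriv xi s / xi s"

lemma xi_deriv: "(xi has_field_derivative deriv xi s) (at s)"
  using xi_holomorphic[of UNIV] by (auto simp: holomorphic_derivI)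

text \<open>\<open>xi_monotone\<close> compares points symmetric about \<open>s\<close>, so the
  symmetric difference quotient of the square of \<open>norm (xi (s + x))\<close> at
  \<open>x = 0\<close> is nonnegative. Its limit is twice the derivative, which is a positive
  multiple of \<open>Re (Glog s)\<close>.\<close>

lemma Glog_Re_nonneg:
  assumes RH: riemann_hypothesis and s: "Re s > 1/2"
  shows "Re (Glog s) \<ge> 0"
proof -
  have nz: "xi s \<noteq> 0" by (rule RH_nonzero(2)[OF RH s])
  define N where "N x = (norm (xi (s + of_real x)))\<^sup>2" for x
  have "((\<lambda>x. xi (s + of_real x)) has_vector_derivative (1 * deriv xi (s + of_real 0))) (at 0)"
  proof (rule field_vector_diff_chain_at[unfolded o_def, where f = "\<lambda>x. s + of_real x"])
    show "((\<lambda>x. s + complex_of_real x) has_vector_derivative 1) (at 0)"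
      unfolding has_vector_derivative_def by (auto intro!: derivative_eq_intros simp: scaleR_conv_of_real)
    show "(xi has_field_derivative deriv xi (s + of_real 0)) (at (s + of_real 0))" by (rule xi_deriv)
  qed
  then have d: "((\<lambda>x. xi (s + of_real x)) has_vector_derivative deriv xi s) (at 0)" by simp
  have dRe: "((\<lambda>x. Re (xi (s + of_real x))) has_real_derivative Re (deriv xi s)) (at 0)"
    using bounded_linear.has_vector_derivative[OF bounded_linear_Re d] by (simp add: has_real_derivative_iff_has_vector_derivative)
  have dIm: "((\<lambda>x. Im (xi (s + of_real x))) has_real_derivative Im (deriv xi s)) (at 0)"
    using bounded_linear.has_vector_derivative[OF bounded_linear_Im d] by (simp add: has_real_derivative_iff_has_vector_derivative)
  define D where "D = 2 * (Re (xi s) * Re (deriv xi s) + Im (xi s) * Im (deriv xi s))"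
  have dN: "(N has_real_derivative D) (at 0)"
    unfolding N_def cmod_power2 D_def by (rule derivative_eq_intros dRe dIm refl)+ (simp add: algebra_simps)
  have dN': "((\<lambda>x. N (- x)) has_real_derivative (- D)) (at 0)"
    using DERIV_mirror[of N D 0] dN by simp
  have "((\<lambda>x. N x - N (- x)) has_real_derivative (D - - D)) (at 0)" by (intro derivative_intros dN dN')
  then have "((\<lambda>x. (N x - N (- x)) / x) \<longlongrightarrow> 2 * D) (at 0)" by (simp add: has_field_derivative_iff)
  then have "((\<lambda>x. (N x - N (- x)) / x) \<longlongrightarrow> 2 * D) (at_right 0)" by (rule tendsto_mono[OF at_le[OF subset_UNIV]])
  then have "0 \<le> 2 * D"
  proof (rule tendsto_lowerbound)
    have "\<forall>\<^sub>F x in at_right 0. x \<in> {0<..<1/4::real}" by (rule eventually_at_right_real) simp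
    then show "\<forall>\<^sub>F x in at_right 0. 0 \<le> (N x - N (- x)) / x"
    proof eventually_elim
      case (elim x)
      have "norm (xi (s - of_real x)) \<le> norm (xi (s + of_real x))" using xi_monotone[OF RH, of x s] elim s by simp
      then have "N (-x) \<le> N x" unfolding N_def by (simp add: power_mono)
      then show ?case using elim by simp
    qed
  qed auto
  moreover have "Re (Glog s) = (D / 2) / (norm (xi s))\<^sup>2"
    unfolding Glog_def D_def complex_div_cnj[of "deriv xi s" "xi s"] cmod_power2 by (simp add: Re_divide power2_eq_square mult_ac add_divide_distrib)
  ultimately show ?thesis by simp
qed

section \<open>Perron's formula\<close>

text \<open>The integration is in \<open>dt\<close>, without the factor \<open>\<i>\<close>. Perron
  integrals in this form equal \<open>2 * pi\<close> times the arithmetic quantity.\<close>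

definition vint :: "(complex \<Rightarrow> complex) \<Rightarrow> real \<Rightarrow> real \<Rightarrow> real \<Rightarrow> complex" where
  "vint f a T1 T2 = integral {T1..T2} (\<lambda>t. f (Complex a t))"

lemma Complex_cont [continuous_intros]:
  "continuous_on A f \<Longrightarrow> continuous_on A g \<Longrightarrow> continuous_on A (\<lambda>t. Complex (f t) (g t))"
  unfolding Complex_eq by (intro continuous_intros)

lemma vline_cont:
  assumes "f holomorphic_on S" "\<And>t. t \<in> {T1..T2} \<Longrightarrow> Complex a t \<in> S"
  shows "continuous_on {T1..T2} (\<lambda>t. f (Complex a t))"
  by (rule continuous_on_compose2[OF holomorphic_on_imp_continuous_on[OF assms(1)]])
     (use assms(2) in \<open>auto intro!: continuous_intros\<close>)

text \<open>Cauchy's theorem for a rectangle, by way of a primitive on the convex set: the two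
  vertical integrals differ by the contributions of the horizontal sides.\<close>

lemma vint_shift:
  assumes hol: "f holomorphic_on S" and S: "open S" "convex S" and ab: "a \<le> b" and T: "T1 \<le> T2"
    and sub: "\<And>u t. u \<in> {a..b} \<Longrightarrow> t \<in> {T1..T2} \<Longrightarrow> Complex u t \<in> S"
    and M1: "\<And>u. u \<in> {a..b} \<Longrightarrow> norm (f (Complex u T1)) \<le> M1"
    and M2: "\<And>u. u \<in> {a..b} \<Longrightarrow> norm (f (Complex u T2)) \<le> M2"
  shows "norm (vint f b T1 T2 - vint f a T1 T2) \<le> (b - a) * (M1 + M2)"
proof -
  obtain F where F: "\<And>x. x \<in> S \<Longrightarrow> (F has_field_derivative f x) (at x within S)"
    using holomorphic_convex_primitive'[OF S(2,1) hol] by blast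
  then have F': "(F has_field_derivative f x) (at x)" if "x \<in> S" for x
    using that S(1) by (metis at_within_open)
  have v: "\<i> * vint f u T1 T2 = F (Complex u T2) - F (Complex u T1)" if u: "u \<in> {a..b}" for u
  proof -
    have "((\<lambda>t. f (Complex u t)) has_integral (-\<i> * F (Complex u T2) - -\<i> * F (Complex u T1))) {T1..T2}"
    proof (rule fundamental_theorem_of_calculus[OF T])
      fix t assume t: "t \<in> {T1..T2}"
      have "((F \<circ> Complex u) has_vector_derivative (\<i> * f (Complex u t))) (at t within {T1..T2})"
      proof (rule field_vector_diff_chain_within)
        show "(Complex u has_vector_derivative \<i>) (at t within {T1..T2})"
          unfolding has_vector_derivative_def Complex_eq
          by (auto intro!: derivative_eq_intros simp: scaleR_conv_of_real)
        show "(F has_field_derivative f (Complex u t)) (at (Complex u t) within Complex u ` {T1..T2})"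
          by (rule has_field_derivative_at_within[OF F'[OF sub[OF u t]]])
      qed
      then have "((\<lambda>t. -\<i> * F (Complex u t)) has_vector_derivative (-\<i> * (\<i> * f (Complex u t)))) (at t within {T1..T2})"
        unfolding o_def by (rule has_vector_derivative_mult_right)
      then show "((\<lambda>t. -\<i> * F (Complex u t)) has_vector_derivative f (Complex u t)) (at t within {T1..T2})"
        by (simp add: mult.assoc[symmetric])
    qed
    then have "vint f u T1 T2 = -\<i> * F (Complex u T2) - -\<i> * F (Complex u T1)"
      unfolding vint_def by (rule integral_unique)
    then show ?thesis by (simp add: right_diff_distrib mult.assoc[symmetric])
  qed
  have hz: "norm (F (Complex b t) - F (Complex a t)) \<le> M * (b - a)"
    if t: "t \<in> {T1..T2}" and M: "\<And>u. u \<in> {a..b} \<Longrightarrow> norm (f (Complex u t)) \<le> M" for t M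
  proof -
    define L where "L = {z. Im z = t \<and> Re z \<in> {a..b}}"
    have cL: "convex L"
    proof -
      have "L = ({z. Im z \<ge> t} \<inter> {z. Im z \<le> t}) \<inter> ({z. Re z \<ge> a} \<inter> {z. Re z \<le> b})" by (auto simp: L_def)
      then show ?thesis by (simp add: convex_Int convex_halfspace_Re_ge convex_halfspace_Re_le convex_halfspace_Im_ge convex_halfspace_Im_le)
    qed
    have "norm (F (Complex b t) - F (Complex a t)) \<le> M * norm (Complex b t - Complex a t)"
    proof (rule field_differentiable_bound[OF cL])
      fix z assume z: "z \<in> L"
      then have e: "z = Complex (Re z) t" "Re z \<in> {a..b}" by (auto simp: L_def complex_eq_iff)
      have "z \<in> S" using sub[OF e(2) t] e(1) by simp
      then show "(F has_field_derivative f z) (at z within L)" by (rule has_field_derivative_at_within[OF F'])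
      show "norm (f z) \<le> M" using M[OF e(2)] e(1) by simp
    qed (use ab in \<open>auto simp: L_def\<close>)
    also have "norm (Complex b t - Complex a t) = b - a" using ab by (simp add: cmod_def)
    finally show ?thesis .
  qed
  have "norm (\<i> * (vint f b T1 T2 - vint f a T1 T2)) = norm ((F (Complex b T2) - F (Complex a T2)) - (F (Complex b T1) - F (Complex a T1)))"
  proof -
    have "\<i> * (vint f b T1 T2 - vint f a T1 T2) = \<i> * vint f b T1 T2 - \<i> * vint f a T1 T2" by (rule right_diff_distrib)
    also have "\<dots> = (F (Complex b T2) - F (Complex b T1)) - (F (Complex a T2) - F (Complex a T1))"
      using v[of b] v[of a] ab by simp
    also have "\<dots> = (F (Complex b T2) - F (Complex a T2)) - (F (Complex b T1) - F (Complex a T1))"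
      by (simp add: algebra_simps)
    finally show ?thesis by (rule arg_cong)
  qed
  also have "\<dots> \<le> M2 * (b - a) + M1 * (b - a)"
    by (rule order.trans[OF norm_triangle_ineq4]) (intro add_mono hz M1 M2; use T in simp)
  also have "\<dots> = (b - a) * (M1 + M2)" by (simp add: algebra_simps)
  finally show ?thesis by (simp only: norm_mult norm_ii mult_1_left)
qed

lemma vint_bound:
  assumes "continuous_on {T1..T2} (\<lambda>t. f (Complex a t))" "T1 \<le> T2"
    "\<And>t. t \<in> {T1..T2} \<Longrightarrow> norm (f (Complex a t)) \<le> B"
  shows "norm (vint f a T1 T2) \<le> B * (T2 - T1)"
  unfolding vint_def by (rule integral_bound) (use assms in auto)

section \<open>The truncated Perron integral of a single term\<close>

definition perron_kernel :: "real \<Rightarrow> complex \<Rightarrow> complex" where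
  "perron_kernel y s = of_real y powr s / (s * (s + 1))"

lemma norm_Complex_ge:
  fixes a t :: real
  shows "\<bar>a\<bar> \<le> norm (Complex a t)" "\<bar>t\<bar> \<le> norm (Complex a t)"
  using abs_Re_le_cmod[of "Complex a t"] abs_Im_le_cmod[of "Complex a t"] by auto

lemma Complex_plus_1: "Complex u t + 1 = Complex (u + 1) t"
  by (simp add: complex_eq_iff)

text \<open>For \<open>y \<le> 1\<close> the line is moved to the right by \<open>T\<close>. No pole
  is crossed, and the quadratic decay of the kernel makes all three new sides of order
  \<open>1 / T\<close>.\<close>

lemma perron_small:
  assumes y: "0 < y" "y \<le> 1" and c: "c > 0" and T: "T > 0"
  shows "norm (vint (perron_kernel y) c (-T) T) \<le> 4 * y powr c / T"
proof -
  have hol: "perron_kernel y holomorphic_on {s. Re s > 0}" unfolding perron_kernel_def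
  proof (intro holomorphic_intros)
    fix s assume "s \<in> {s. Re s > 0}"
    then have "s \<noteq> 0" "s + 1 \<noteq> 0" by (auto simp: complex_eq_iff)
    then show "s * (s + 1) \<noteq> 0" by simp
  qed
  have kb: "norm (perron_kernel y (Complex u t)) \<le> y powr c / T\<^sup>2" if "u \<ge> c" "\<bar>t\<bar> \<ge> T \<or> u \<ge> T" for u t
  proof -
    have s: "norm (Complex u t) \<ge> T" using norm_Complex_ge[where a = u and t = t] that by linarith
    have "norm (Complex u t + 1) \<ge> T" unfolding Complex_plus_1 using norm_Complex_ge[where a = "u + 1" and t = t] that c by linarith
    then have "T * T \<le> norm (Complex u t) * norm (Complex u t + 1)" using s T by (intro mult_mono) auto
    moreover have "y powr u \<le> y powr c" using y that by (intro powr_mono') auto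
    ultimately show ?thesis unfolding perron_kernel_def norm_divide norm_mult using y T
      by (simp add: norm_powr_real_powr power2_eq_square frac_le)
  qed
  have "norm (vint (perron_kernel y) (c + T) (-T) T - vint (perron_kernel y) c (-T) T) \<le> (c + T - c) * (y powr c / T\<^sup>2 + y powr c / T\<^sup>2)"
    by (rule vint_shift[OF hol]) (use c T in \<open>auto intro!: kb open_halfspace_Re_gt convex_halfspace_Re_gt\<close>)
  moreover have "norm (vint (perron_kernel y) (c + T) (-T) T) \<le> y powr c / T\<^sup>2 * (T - - T)"
    by (rule vint_bound[OF vline_cont[OF hol]]) (use c T in \<open>auto intro!: kb\<close>)
  ultimately have "norm (vint (perron_kernel y) c (-T) T) \<le> (c + T - c) * (y powr c / T\<^sup>2 + y powr c / T\<^sup>2) + y powr c / T\<^sup>2 * (T - - T)"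
    using norm_triangle_ineq2[of "vint (perron_kernel y) c (-T) T" "vint (perron_kernel y) (c + T) (-T) T"]
      norm_minus_commute[of "vint (perron_kernel y) c (-T) T" "vint (perron_kernel y) (c + T) (-T) T"] by linarith
  also have "\<dots> = 4 * y powr c / T" using T by (simp add: power2_eq_square field_simps)
  finally show ?thesis .
qed

lemma vint_inverse:
  assumes "c \<noteq> 0" "T > 0"
  shows "vint (\<lambda>s. 1 / s) c (-T) T = of_real (2 * arctan (T / c))"
proof -
  define F where "F t = of_real (arctan (t / c)) - \<i> / 2 * of_real (ln (c\<^sup>2 + t\<^sup>2))" for t
  have pos: "c\<^sup>2 + t\<^sup>2 > 0" for t using assms by (simp add: add_pos_nonneg)
  have "((\<lambda>t. 1 / Complex c t) has_integral (F T - F (-T))) {-T..T}"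
  proof (rule fundamental_theorem_of_calculus)
    fix t
    have d1: "((\<lambda>t. arctan (t / c)) has_real_derivative (c / (c\<^sup>2 + t\<^sup>2))) (at t within {-T..T})"
      using assms pos[of t] by (auto intro!: derivative_eq_intros simp: field_simps power2_eq_square)
    have d2: "((\<lambda>t. ln (c\<^sup>2 + t\<^sup>2)) has_real_derivative (2 * t / (c\<^sup>2 + t\<^sup>2))) (at t within {-T..T})"
      using pos[of t] by (auto intro!: derivative_eq_intros)
    have "(F has_vector_derivative (of_real (c / (c\<^sup>2 + t\<^sup>2)) - \<i> / 2 * of_real (2 * t / (c\<^sup>2 + t\<^sup>2)))) (at t within {-T..T})"
      unfolding F_def
      by (intro has_vector_derivative_diff has_vector_derivative_mult_right has_vector_derivative_of_real)
         (use d1 d2 in \<open>auto simp: has_real_derivative_iff_has_vector_derivative\<close>)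
    moreover have "of_real (c / (c\<^sup>2 + t\<^sup>2)) - \<i> / 2 * of_real (2 * t / (c\<^sup>2 + t\<^sup>2)) = 1 / Complex c t"
      using pos[of t] by (simp add: complex_eq_iff Re_divide Im_divide power2_eq_square[of "c\<^sup>2 + t\<^sup>2"])
    ultimately show "(F has_vector_derivative 1 / Complex c t) (at t within {-T..T})" by simp
  qed (use assms in auto)
  then have "vint (\<lambda>s. 1 / s) c (-T) T = F T - F (-T)" unfolding vint_def by (rule integral_unique)
  also have "\<dots> = of_real (2 * arctan (T / c))" by (simp add: F_def arctan_minus)
  finally show ?thesis .
qed

lemma arctan_near_half_pi:
  assumes "c > 0" "T > 0"
  shows "\<bar>pi - 2 * arctan (T / c)\<bar> \<le> 2 * c / T"
proof -
  have "arctan (inverse (T / c)) = pi / 2 - arctan (T / c)" by (rule arctan_inverse) (use assms in auto)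
  then have "arctan (c / T) = pi / 2 - arctan (T / c)" by simp
  moreover have "arctan (c / T) \<le> c / T" "0 \<le> arctan (c / T)" using assms by (auto intro: arctan_le_self)
  ultimately show ?thesis by auto
qed

text \<open>The map from \<open>s\<close> to \<open>- 1 - s\<close> exchanges the poles 0 and -1. It
  turns a line left of both poles into one right of them, with \<open>1 / y\<close> in place of
  \<open>y\<close>.\<close>

lemma perron_reflect:
  assumes y: "y > 0"
  shows "vint (perron_kernel y) (- 1 - c) (-T) T = of_real (1 / y) * vint (perron_kernel (1 / y)) c (-T) T"
proof -
  have "perron_kernel y (Complex (- 1 - c) t) = of_real (1 / y) * perron_kernel (1 / y) (Complex c (- t))" for t
  proof -
    define s where "s = Complex c (- t)"
    have s: "Complex (- 1 - c) t = - 1 - s" by (simp add: s_def complex_eq_iff)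
    have p: "complex_of_real y powr (- 1 - s) = of_real (1 / y) * of_real (1 / y) powr s"
    proof -
      have "complex_of_real y powr (- 1 - s) = exp (- of_real (ln y) + - (s * of_real (ln y)))"
        using y by (simp add: powr_def Ln_of_real algebra_simps)
      also have "\<dots> = exp (- of_real (ln y)) * exp (s * (- of_real (ln y)))" by (simp only: exp_add mult_minus_right)
      also have "exp (- complex_of_real (ln y)) = of_real (1 / y)"
        using y by (metis exp_ln exp_minus exp_of_real inverse_eq_divide of_real_minus)
      also have "exp (s * (- of_real (ln y))) = of_real (1 / y) powr s"
        using y Ln_of_real[of "1/y"] by (simp add: powr_def ln_div)
      finally show ?thesis .
    qed
    show ?thesis unfolding s s_def[symmetric] perron_kernel_def p by (simp add: algebra_simps)
  qed
  then have "vint (perron_kernel y) (- 1 - c) (-T) T = of_real (1 / y) * integral {-T..T} (\<lambda>t. perron_kernel (1 / y) (Complex c (- t)))"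
    unfolding vint_def by simp
  also have "integral {-T..T} (\<lambda>t. perron_kernel (1 / y) (Complex c (- t))) = vint (perron_kernel (1 / y)) c (-T) T"
    unfolding vint_def using Henstock_Kurzweil_Integration.integral_reflect_real[of T "-T" "\<lambda>t. perron_kernel (1 / y) (Complex c t)"] by simp
  finally show ?thesis .
qed

definition diff_quot :: "(complex \<Rightarrow> complex) \<Rightarrow> complex \<Rightarrow> complex \<Rightarrow> complex" where
  "diff_quot f a z = (if z = a then deriv f a else (f z - f a) / (z - a))"

lemma diff_quot_holomorphic: "f holomorphic_on UNIV \<Longrightarrow> diff_quot f a holomorphic_on UNIV"
  unfolding diff_quot_def[abs_def] by (rule pole_lemma) auto

text \<open>The line is moved from \<open>c\<close> to \<open>- 1 - c\<close>, across both poles.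
  The polar parts are split off and integrate to arctangents; the rest is entire and can be shifted.
  On the new line reflection reduces to the case of small \<open>y\<close>.\<close>

lemma perron_large:
  assumes y: "y \<ge> 1" and c: "0 < c" "c \<le> 2" and T: "T \<ge> 1"
  shows "norm (vint (perron_kernel y) c (-T) T - of_real (2 * pi * (1 - 1 / y))) \<le> 64 * y powr c / T"
proof -
  define E where "E s = complex_of_real y powr s" for s
  have hE: "E holomorphic_on UNIV" unfolding E_def by (intro holomorphic_intros) (use y in auto)
  \<comment> \<open>Partial fractions: the difference quotients are \<open>E s / s\<close> and
    \<open>E s / (s + 1)\<close> without their polar parts.\<close>
  define g where "g s = diff_quot E 0 s - diff_quot E (- 1) s" for s
  have hg: "g holomorphic_on UNIV" unfolding g_def by (intro holomorphic_intros diff_quot_holomorphic hE)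
  have E0: "E 0 = 1" "E (- 1) = of_real (1 / y)" using y by (simp_all add: E_def powr_minus_divide)
  have nE: "norm (E s) = y powr Re s" for s using y by (simp add: E_def norm_powr_real_powr)
  have decomp: "perron_kernel y s = g s + 1 / s - of_real (1 / y) * (1 / (s + 1))" if "s \<noteq> 0" "s \<noteq> - 1" for s
  proof -
    have s1: "s + 1 \<noteq> 0" using that(2) by (metis add.inverse_unique add.commute)
    have "perron_kernel y s = E s / s - E s / (s + 1)"
      unfolding perron_kernel_def E_def using that(1) s1 by (simp add: field_simps)
    moreover have "g s = (E s - 1) / s - (E s - of_real (1 / y)) / (s + 1)"
      unfolding g_def diff_quot_def using that E0 by simp
    ultimately show ?thesis by (simp add: diff_divide_distrib)
  qed
  have yc: "y powr c \<ge> 1" using y c by (intro ge_one_powr_ge_zero) auto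
  have vi: "vint (perron_kernel y) u (-T) T = vint g u (-T) T + of_real (2 * arctan (T / u)) - of_real (1 / y) * of_real (2 * arctan (T / (u + 1)))"
    if u: "u \<noteq> 0" "u \<noteq> - 1" for u
  proof -
    have u1: "u + 1 \<noteq> 0" using u(2) by linarith
    have cg: "continuous_on {-T..T} (\<lambda>t. g (Complex u t))" by (rule vline_cont[OF hg]) auto
    have ci: "continuous_on {-T..T} (\<lambda>t. 1 / Complex a t)" if "a \<noteq> 0" for a
      using that by (intro continuous_intros) (auto simp: complex_eq_iff)
    have "vint (perron_kernel y) u (-T) T = integral {-T..T} (\<lambda>t. (g (Complex u t) + 1 / Complex u t) - of_real (1 / y) * (1 / Complex (u + 1) t))"
      unfolding vint_def
    proof (rule integral_cong)
      fix t
      show "perron_kernel y (Complex u t) = (g (Complex u t) + 1 / Complex u t) - of_real (1 / y) * (1 / Complex (u + 1) t)"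
        unfolding Complex_plus_1[symmetric] by (rule decomp) (use u in \<open>auto simp: complex_eq_iff\<close>)
    qed
    also have "\<dots> = integral {-T..T} (\<lambda>t. g (Complex u t) + 1 / Complex u t) - integral {-T..T} (\<lambda>t. of_real (1 / y) * (1 / Complex (u + 1) t))"
      by (rule integral_diff) (intro integrable_continuous_real continuous_intros cg ci[OF u(1)] ci[OF u1])+
    also have "integral {-T..T} (\<lambda>t. g (Complex u t) + 1 / Complex u t) = vint g u (-T) T + integral {-T..T} (\<lambda>t. 1 / Complex u t)"
      unfolding vint_def by (rule integral_add) (intro integrable_continuous_real cg ci[OF u(1)])+
    also have "integral {-T..T} (\<lambda>t. 1 / Complex u t) = of_real (2 * arctan (T / u))"
      using vint_inverse[OF u(1), of T] T by (simp add: vint_def)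
    also have "integral {-T..T} (\<lambda>t. of_real (1 / y) * (1 / Complex (u + 1) t)) = of_real (1 / y) * of_real (2 * arctan (T / (u + 1)))"
      unfolding integral_mult_right using vint_inverse[OF u1, of T] T by (simp add: vint_def)
    finally show ?thesis .
  qed
  have gb: "norm (g (Complex u t)) \<le> 4 * y powr c / T" if u: "u \<in> {- 1 - c..c}" and t: "\<bar>t\<bar> = T" for u t
  proof -
    have t0: "t \<noteq> 0" using t T by auto
    have nn: "norm (Complex u t) \<ge> T" "norm (Complex u t + 1) \<ge> T"
      unfolding Complex_plus_1 using norm_Complex_ge[where a = u and t = t] norm_Complex_ge[where a = "u + 1" and t = t] t by auto
    have ney: "Complex u t \<noteq> 0" "Complex u t \<noteq> - 1" using t0 by (auto simp: complex_eq_iff)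
    have nb: "norm (E (Complex u t)) \<le> y powr c" unfolding nE using u y by (auto intro!: powr_mono)
    have a: "norm (E (Complex u t) - 1) \<le> 2 * y powr c"
      using norm_triangle_ineq4[of "E (Complex u t)" 1] nb yc by simp
    have b: "norm (E (Complex u t) - of_real (1 / y)) \<le> 2 * y powr c"
    proof -
      have "norm (complex_of_real (1 / y)) \<le> 1" using y by (simp add: norm_divide)
      then show ?thesis using norm_triangle_ineq4[of "E (Complex u t)" "of_real (1 / y)"] nb yc by simp
    qed
    have "g (Complex u t) = (E (Complex u t) - 1) / Complex u t - (E (Complex u t) - of_real (1 / y)) / (Complex u t + 1)"
      unfolding g_def diff_quot_def using ney E0 by simp
    then have "norm (g (Complex u t)) \<le> norm (E (Complex u t) - 1) / norm (Complex u t) + norm (E (Complex u t) - of_real (1 / y)) / norm (Complex u t + 1)"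
      by (simp only: norm_divide[symmetric] norm_triangle_ineq4)
    also have "\<dots> \<le> 2 * y powr c / T + 2 * y powr c / T" using a b nn T by (intro add_mono frac_le) auto
    finally show ?thesis by simp
  qed
  define A where "A = 2 * arctan (T / c)"
  define B where "B = 2 * arctan (T / (c + 1))"
  have AB: "\<bar>pi - A\<bar> \<le> 4 / T" "\<bar>pi - B\<bar> \<le> 6 / T"
  proof -
    have "2 * c / T \<le> 4 / T" "2 * (c + 1) / T \<le> 6 / T" using c T by (auto intro!: divide_right_mono)
    then show "\<bar>pi - A\<bar> \<le> 4 / T" "\<bar>pi - B\<bar> \<le> 6 / T"
      unfolding A_def B_def using arctan_near_half_pi[of c T] arctan_near_half_pi[of "c+1" T] c T by linarith+
  qed
  have v1: "vint (perron_kernel y) c (-T) T = vint g c (-T) T + of_real A - of_real (1 / y) * of_real B"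
    unfolding A_def B_def by (rule vi) (use c in auto)
  have v2: "vint (perron_kernel y) (- 1 - c) (-T) T = vint g (- 1 - c) (-T) T - of_real B + of_real (1 / y) * of_real A"
  proof -
    have "arctan (T / (- 1 - c)) = - arctan (T / (c + 1))"
    proof -
      have "T / (- 1 - c) = - (T / (c + 1))" using c by (simp add: field_simps)
      then show ?thesis by (simp only: arctan_minus)
    qed
    moreover have "arctan (T / (- 1 - c + 1)) = - arctan (T / c)"
    proof -
      have "T / (- 1 - c + 1) = - (T / c)" using c by (simp add: field_simps)
      then show ?thesis by (simp only: arctan_minus)
    qed
    moreover have "vint (perron_kernel y) (- 1 - c) (-T) T = vint g (- 1 - c) (-T) T +
      of_real (2 * arctan (T / (- 1 - c))) - of_real (1 / y) * of_real (2 * arctan (T / (- 1 - c + 1)))"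
      by (rule vi) (use c in auto)
    ultimately have "vint (perron_kernel y) (- 1 - c) (-T) T = vint g (- 1 - c) (-T) T +
      of_real (2 * (- arctan (T / (c + 1)))) - of_real (1 / y) * of_real (2 * (- arctan (T / c)))"
      by (simp only:)
    then show ?thesis unfolding A_def B_def by (simp only: mult_minus_right of_real_minus) simp
  qed
  have sh: "norm (vint g c (-T) T - vint g (- 1 - c) (-T) T) \<le> (c - (- 1 - c)) * (4 * y powr c / T + 4 * y powr c / T)"
    by (rule vint_shift[OF hg]) (use c T gb in auto)
  also have "\<dots> \<le> 5 * (4 * y powr c / T + 4 * y powr c / T)" using c T yc by (intro mult_right_mono) auto
  finally have sh: "norm (vint g c (-T) T - vint g (- 1 - c) (-T) T) \<le> 40 * y powr c / T" by simp
  have re: "norm (vint (perron_kernel y) (- 1 - c) (-T) T) \<le> 4 * y powr c / T"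
  proof -
    have "norm (vint (perron_kernel y) (- 1 - c) (-T) T) = 1 / y * norm (vint (perron_kernel (1 / y)) c (-T) T)"
      using y by (subst perron_reflect) (auto simp: norm_mult norm_divide)
    also have "\<dots> \<le> 1 * (4 * (1 / y) powr c / T)"
      using y c T perron_small[of "1/y" c T] by (intro mult_mono) (auto simp: divide_le_eq)
    also have "\<dots> \<le> 4 * y powr c / T"
    proof -
      have "1 / y \<le> 1" using y by simp
      then have "1 / y \<le> y" using y by linarith
      then have "(1 / y) powr c \<le> y powr c" using y c by (intro powr_mono2) auto
      then show ?thesis using T by (simp add: divide_right_mono)
    qed
    finally show ?thesis .
  qed
  \<comment> \<open>Between the two lines the polar terms \<open>1 / s\<close> and
    \<open>1 / (s + 1)\<close> each change by \<open>A + B\<close>, which is close to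
    \<open>2 * pi\<close>: the residues in disguise.\<close>
  have "vint (perron_kernel y) c (-T) T - of_real (2 * pi * (1 - 1 / y)) =
     vint (perron_kernel y) (- 1 - c) (-T) T + (vint g c (-T) T - vint g (- 1 - c) (-T) T)
     + of_real (1 - 1 / y) * of_real ((A - pi) + (B - pi))"
    unfolding v1 v2 by (simp add: algebra_simps)
  also have "norm \<dots> \<le> 4 * y powr c / T + 40 * y powr c / T + 1 * (10 / T)"
  proof (intro norm_triangle_le add_mono re sh)
    have "\<bar>1 - 1 / y\<bar> \<le> 1" using y by simp
    moreover have "\<bar>(A - pi) + (B - pi)\<bar> \<le> 10 / T" using AB by (simp add: abs_le_iff)
    ultimately show "norm (complex_of_real (1 - 1 / y) * of_real ((A - pi) + (B - pi))) \<le> 1 * (10 / T)"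
      unfolding norm_mult norm_of_real by (intro mult_mono) auto
  qed
  also have "\<dots> \<le> 64 * y powr c / T" using yc T by (simp add: field_simps)
  finally show ?thesis .
qed

lemma perron:
  assumes y: "y > 0" and c: "0 < c" "c \<le> 2" and T: "T \<ge> 1"
  shows "norm (vint (perron_kernel y) c (-T) T - of_real (2 * pi * max 0 (1 - 1 / y))) \<le> 64 * y powr c / T"
proof (cases "y \<ge> 1")
  case True
  then have "max 0 (1 - 1 / y) = 1 - 1 / y" by simp
  then show ?thesis using perron_large[OF True c T] by simp
next
  case False
  then have "max 0 (1 - 1 / y) = 0" using y by (simp add: max_def)
  moreover have "4 * y powr c / T \<le> 64 * y powr c / T" using T by (intro divide_right_mono) auto
  ultimately show ?thesis using perron_small[of y c T] False y c T by simp
qed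

section \<open>Perron's formula for the integral of \<open>chebyshev_psi\<close>\<close>

definition Dser :: "complex \<Rightarrow> complex" where
  "Dser s = (\<Sum>n. of_real (mangoldt (Suc n)) * dterm s n)"

text \<open>The Dirichlet series of \<open>mangoldt\<close> at 2; by absolute convergence it bounds
  that series on the whole line \<open>Re s = 2\<close>.\<close>

definition LamC :: real where "LamC = (\<Sum>n. mangoldt (Suc n) * real (Suc n) powr (- 2))"

lemma LamC_summable: "summable (\<lambda>n. mangoldt (Suc n) * real (Suc n) powr (- 2))"
  by (rule mangoldt_summable) simp

lemma LamC_nonneg: "LamC \<ge> 0"
  unfolding LamC_def by (rule suminf_nonneg[OF LamC_summable]) (auto simp: mangoldt_nonneg)

lemma mangoldt_dterm_norm: "norm (of_real (mangoldt (Suc n)) * dterm (Complex 2 t) n) = mangoldt (Suc n) * real (Suc n) powr (- 2)"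
  by (simp add: norm_mult norm_dterm mangoldt_nonneg)

lemma Dser_uniform: "uniform_limit A (\<lambda>N t. \<Sum>n<N. of_real (mangoldt (Suc n)) * dterm (Complex 2 t) n) (\<lambda>t. Dser (Complex 2 t)) sequentially"
  unfolding Dser_def by (rule Weierstrass_m_test[OF _ LamC_summable]) (simp only: mangoldt_dterm_norm order.refl)

lemma dterm_vline_cont: "continuous_on A (\<lambda>t. dterm (Complex c t) n)"
  unfolding dterm_def by (intro continuous_intros) (auto simp del: of_nat_Suc)

lemma Dser_cont: "continuous_on A (\<lambda>t. Dser (Complex 2 t))"
  by (rule uniform_limit_theorem[OF _ Dser_uniform])
     (auto intro!: always_eventually continuous_intros dterm_vline_cont)

lemma Dser_bound: "norm (Dser (Complex 2 t)) \<le> LamC"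
proof -
  have "summable (\<lambda>n. norm (of_real (mangoldt (Suc n)) * dterm (Complex 2 t) n))"
    unfolding mangoldt_dterm_norm by (rule LamC_summable)
  then have "norm (Dser (Complex 2 t)) \<le> (\<Sum>n. norm (of_real (mangoldt (Suc n)) * dterm (Complex 2 t) n))"
    unfolding Dser_def by (rule summable_norm)
  then show ?thesis unfolding mangoldt_dterm_norm LamC_def .
qed

text \<open>\<open>Wf a\<close> is the integral of \<open>\<psi>\<close> over \<open>[0, a]\<close>, \<open>Vf\<close> is its truncated Perron integral, and \<open>Vd\<close>, the
  derivative of \<open>Vf\<close>, is the one of \<open>\<psi>\<close>. Integrating first makes the Perron integral absolutely convergent; the mean
  value theorem goes back at the cost of moving \<open>x\<close> by at most \<open>h\<close>.\<close>

definition Wf :: "real \<Rightarrow> real" where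
  "Wf a = (\<Sum>n. mangoldt (Suc n) * max 0 (a - real (Suc n)))"

lemma finite_Suc_le: "finite {n. real (Suc n) \<le> a}"
proof -
  obtain m :: nat where "a \<le> real m" using real_arch_simple by blast
  then have "{n. real (Suc n) \<le> a} \<subseteq> {..m}" by auto
  then show ?thesis using finite_subset by blast
qed

lemma Wf_summable: "summable (\<lambda>n. mangoldt (Suc n) * max 0 (a - real (Suc n)))"
  by (rule summable_finite[OF finite_Suc_le[of a]]) (auto simp: max_def)

lemma psi_Suc: "chebyshev_psi x = (\<Sum>n | real (Suc n) \<le> x. mangoldt (Suc n))"
proof -
  have "(\<Sum>n | n \<ge> 1 \<and> real n \<le> x. mangoldt n :: real) = (\<Sum>n\<in>Suc ` {n. real (Suc n) \<le> x}. mangoldt n)"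
  proof (rule sum.cong)
    show "{n. n \<ge> 1 \<and> real n \<le> x} = Suc ` {n. real (Suc n) \<le> x}"
    proof (intro set_eqI iffI)
      fix n assume n: "n \<in> {n. n \<ge> 1 \<and> real n \<le> x}"
      then have "n = Suc (n - 1)" by auto
      with n show "n \<in> Suc ` {n. real (Suc n) \<le> x}" by (metis imageI mem_Collect_eq)
    qed auto
  qed simp
  also have "\<dots> = (\<Sum>n | real (Suc n) \<le> x. mangoldt (Suc n))" by (subst sum.reindex) auto
  finally show ?thesis unfolding chebyshev_psi_def .
qed

text \<open>\<open>Wf\<close> is convex with slope \<open>chebyshev_psi\<close>, so the chord to the
  right of \<open>x\<close> is at least as steep as the slope at \<open>x\<close>; the chord to the
  left, in \<open>psi_lower\<close>, is at most as steep.\<close>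

lemma psi_upper:
  assumes h: "h > 0"
  shows "h * chebyshev_psi x \<le> Wf (x + h) - Wf x"
proof -
  let ?f = "\<lambda>n. mangoldt (Suc n) * max 0 (x + h - real (Suc n)) - mangoldt (Suc n) * max 0 (x - real (Suc n))"
  have sm: "summable ?f" by (intro summable_diff Wf_summable)
  have "h * chebyshev_psi x = (\<Sum>n | real (Suc n) \<le> x. mangoldt (Suc n) * h)"
    unfolding psi_Suc sum_distrib_left by (simp add: mult.commute)
  also have "\<dots> \<le> (\<Sum>n | real (Suc n) \<le> x. ?f n)"
    by (rule sum_mono) (use h in \<open>auto simp: max_def right_diff_distrib[symmetric]\<close>)
  also have "\<dots> \<le> (\<Sum>n. ?f n)"
    by (rule sum_le_suminf[OF sm finite_Suc_le])
       (use h in \<open>auto intro!: mult_left_mono simp: mangoldt_nonneg\<close>)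
  also have "\<dots> = Wf (x + h) - Wf x" unfolding Wf_def by (rule suminf_diff[symmetric]; rule Wf_summable)
  finally show ?thesis .
qed

lemma psi_lower:
  assumes h: "h > 0"
  shows "Wf x - Wf (x - h) \<le> h * chebyshev_psi x"
proof -
  let ?f = "\<lambda>n. mangoldt (Suc n) * max 0 (x - real (Suc n)) - mangoldt (Suc n) * max 0 (x - h - real (Suc n))"
  have "Wf x - Wf (x - h) = (\<Sum>n. ?f n)" unfolding Wf_def by (rule suminf_diff; rule Wf_summable)
  also have "\<dots> = (\<Sum>n | real (Suc n) \<le> x. ?f n)"
    by (rule suminf_finite[OF finite_Suc_le]) (use h in \<open>auto simp: max_def\<close>)
  also have "\<dots> \<le> (\<Sum>n | real (Suc n) \<le> x. mangoldt (Suc n) * h)"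
    unfolding right_diff_distrib[symmetric]
    by (intro sum_mono mult_left_mono) (use h in \<open>auto simp: mangoldt_nonneg max_def\<close>)
  also have "\<dots> = h * chebyshev_psi x" unfolding psi_Suc sum_distrib_left by (simp add: mult.commute)
  finally show ?thesis .
qed

definition Vf :: "real \<Rightarrow> real \<Rightarrow> complex" where
  "Vf T a = vint (\<lambda>s. Dser s * (of_real a powr (s + 1) / (s * (s + 1)))) 2 (-T) T"

lemma kernel_eq:
  assumes a: "a > 0"
  shows "dterm s n * (of_real a powr (s + 1) / (s * (s + 1))) = of_real a * perron_kernel (a / real (Suc n)) s"
proof -
  have "complex_of_real (a / real (Suc n)) powr s = of_real a powr s * of_real (inverse (real (Suc n))) powr s"
    using a by (subst powr_times_real[symmetric]) (auto simp: divide_inverse)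
  also have "complex_of_real (inverse (real (Suc n))) powr s = dterm s n"
  proof -
    have "Ln (complex_of_real (inverse (real (Suc n)))) = of_real (ln (inverse (real (Suc n))))" by (rule Ln_of_real) simp
    also have "\<dots> = - of_real (ln (real (Suc n)))" by (subst ln_inverse) simp
    also have "\<dots> = - Ln (of_nat (Suc n))" using Ln_of_real[of "real (Suc n)"] by (simp del: of_nat_Suc)
    finally have "Ln (complex_of_real (inverse (real (Suc n)))) = - Ln (of_nat (Suc n))" .
    then show ?thesis unfolding dterm_def powr_def by (simp del: of_nat_Suc)
  qed
  finally have "complex_of_real (a / real (Suc n)) powr s = of_real a powr s * dterm s n" .
  moreover have "complex_of_real a powr (s + 1) = of_real a powr s * of_real a"
    using a by (simp add: powr_add)
  ultimately show ?thesis unfolding perron_kernel_def by simp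
qed

lemma Complex_2_nonzero: "Complex 2 t \<noteq> 0" "Complex 2 t + 1 \<noteq> 0"
  by (auto simp: complex_eq_iff)

lemma kernel_norm_le:
  assumes "a > 0"
  shows "norm (complex_of_real a powr (Complex 2 t + 1) / (Complex 2 t * (Complex 2 t + 1))) \<le> a ^ 3"
proof -
  have "1 \<le> norm (Complex 2 t)" using norm_Complex_ge(1)[where a = 2 and t = t] by linarith
  moreover have "1 \<le> norm (Complex 2 t + 1)" unfolding Complex_plus_1 using norm_Complex_ge(1)[where a = "2 + 1" and t = t] by linarith
  ultimately have n: "1 * 1 \<le> norm (Complex 2 t) * norm (Complex 2 t + 1)" by (intro mult_mono) auto
  have "norm (complex_of_real a powr (Complex 2 t + 1)) = a powr 3"
    using assms by (simp add: norm_powr_real_powr)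
  also have "\<dots> = a ^ 3" using assms by simp
  finally show ?thesis unfolding norm_divide norm_mult using n assms
    by (simp add: divide_le_eq mult_left_le)
qed

text \<open>The series converges uniformly on \<open>Re s = 2\<close>, so Perron's formula applies
  term by term, and the errors of the terms add up to a multiple of \<open>LamC\<close>.\<close>

lemma Vf_Wf:
  assumes a: "a > 0" and T: "T \<ge> 1"
  shows "norm (Vf T a - of_real (2 * pi * Wf a)) \<le> 64 * LamC * a ^ 3 / T"
proof -
  define k where "k t = complex_of_real a powr (Complex 2 t + 1) / (Complex 2 t * (Complex 2 t + 1))" for t
  define L where "L n = (mangoldt (Suc n) :: real)" for n
  define f where "f n t = of_real (L n) * dterm (Complex 2 t) n * k t" for n t
  have kc: "continuous_on A k" for A unfolding k_def
    by (intro continuous_intros) (use a Complex_2_nonzero in auto)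
  have fc: "continuous_on A (f n)" for A n unfolding f_def by (intro continuous_intros kc dterm_vline_cont)
  have sm: "summable (\<lambda>n. (L n * real (Suc n) powr (- 2)) * a ^ 3)"
    unfolding L_def by (rule summable_mult2[OF LamC_summable])
  have ul: "uniform_limit {-T..T} (\<lambda>N t. \<Sum>n<N. f n t) (\<lambda>t. \<Sum>n. f n t) sequentially"
  proof (rule Weierstrass_m_test[OF _ sm])
    show "norm (f n t) \<le> (L n * real (Suc n) powr (- 2)) * a ^ 3" for n t
    proof -
      have "norm (f n t) = (L n * real (Suc n) powr (- 2)) * norm (k t)"
        unfolding f_def norm_mult[of "of_real (L n) * dterm (Complex 2 t) n"] unfolding L_def mangoldt_dterm_norm ..
      also have "\<dots> \<le> (L n * real (Suc n) powr (- 2)) * a ^ 3"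
        unfolding k_def by (intro mult_left_mono kernel_norm_le a) (simp add: L_def mangoldt_nonneg)
      finally show ?thesis .
    qed
  qed
  have fs: "(\<Sum>n. f n t) = Dser (Complex 2 t) * k t" for t
  proof -
    have "summable (\<lambda>n. norm (of_real (L n) * dterm (Complex 2 t) n))"
      unfolding L_def mangoldt_dterm_norm by (rule LamC_summable)
    then have "summable (\<lambda>n. of_real (L n) * dterm (Complex 2 t) n)" by (rule summable_norm_cancel)
    from suminf_mult2[OF this, of "k t"] show ?thesis unfolding f_def Dser_def L_def by simp
  qed
  have l1: "(\<lambda>N. integral {-T..T} (\<lambda>t. \<Sum>n<N. f n t)) \<longlonglongrightarrow> Vf T a"
  proof -
    have "(\<lambda>N. integral {-T..T} (\<lambda>t. \<Sum>n<N. f n t)) \<longlonglongrightarrow> integral {-T..T} (\<lambda>t. \<Sum>n. f n t)"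
      by (rule tendsto_integral_uniform_limit[OF ul]) (auto intro!: continuous_intros fc)
    then show ?thesis unfolding Vf_def vint_def fs k_def .
  qed
  have fi: "integral {-T..T} (f n) = of_real (L n * a) * vint (perron_kernel (a / real (Suc n))) 2 (-T) T" for n
  proof -
    have "f n t = of_real (L n * a) * perron_kernel (a / real (Suc n)) (Complex 2 t)" for t
      unfolding f_def k_def mult.assoc kernel_eq[OF a] by simp
    then have "f n = (\<lambda>t. of_real (L n * a) * perron_kernel (a / real (Suc n)) (Complex 2 t))" by blast
    then show ?thesis unfolding vint_def by simp
  qed
  have "(\<lambda>N. \<Sum>n<N. L n * max 0 (a - real (Suc n))) \<longlonglongrightarrow> Wf a"
    unfolding Wf_def L_def by (rule summable_LIMSEQ[OF Wf_summable])
  then have l2: "(\<lambda>N. complex_of_real (2 * pi * (\<Sum>n<N. L n * max 0 (a - real (Suc n))))) \<longlonglongrightarrow> of_real (2 * pi * Wf a)"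
    by (intro tendsto_intros)
  have b: "norm (integral {-T..T} (\<lambda>t. \<Sum>n<N. f n t) - complex_of_real (2 * pi * (\<Sum>n<N. L n * max 0 (a - real (Suc n))))) \<le> 64 * LamC * a ^ 3 / T" for N
  proof -
    have "integral {-T..T} (\<lambda>t. \<Sum>n<N. f n t) = (\<Sum>n<N. integral {-T..T} (f n))"
      by (rule integral_sum) (simp, intro integrable_continuous_real fc)
    then have eq: "integral {-T..T} (\<lambda>t. \<Sum>n<N. f n t) - complex_of_real (2 * pi * (\<Sum>n<N. L n * max 0 (a - real (Suc n)))) =
      (\<Sum>n<N. of_real (L n * a) * (vint (perron_kernel (a / real (Suc n))) 2 (-T) T - of_real (2 * pi * max 0 (1 - 1 / (a / real (Suc n))))))"
    proof -
      have "2 * pi * (\<Sum>n<N. L n * max 0 (a - real (Suc n))) = (\<Sum>n<N. (L n * a) * (2 * pi * max 0 (1 - 1 / (a / real (Suc n)))))"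
        unfolding sum_distrib_left
      proof (rule sum.cong[OF refl])
        fix n
        have "max 0 (a - real (Suc n)) = a * max 0 (1 - 1 / (a / real (Suc n)))"
        proof -
          have "a * max 0 (1 - 1 / (a / real (Suc n))) = max (a * 0) (a * (1 - 1 / (a / real (Suc n))))"
            using a by (intro max_mult_distrib_left[THEN trans]) auto
          also have "a * (1 - 1 / (a / real (Suc n))) = a - real (Suc n)" using a by (simp add: field_simps)
          finally show ?thesis by simp
        qed
        then show "2 * pi * (L n * max 0 (a - real (Suc n))) = (L n * a) * (2 * pi * max 0 (1 - 1 / (a / real (Suc n))))" by simp
      qed
      then show ?thesis using \<open>integral {-T..T} (\<lambda>t. \<Sum>n<N. f n t) = (\<Sum>n<N. integral {-T..T} (f n))\<close>
        unfolding fi right_diff_distrib sum_subtractf by (simp only: of_real_sum of_real_mult)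
    qed
    have "norm (integral {-T..T} (\<lambda>t. \<Sum>n<N. f n t) - complex_of_real (2 * pi * (\<Sum>n<N. L n * max 0 (a - real (Suc n))))) \<le> (\<Sum>n<N. (L n * a) * (64 * (a / real (Suc n)) powr 2 / T))"
      unfolding eq
    proof (rule order.trans[OF norm_sum], rule sum_mono)
      fix n
      have L0: "L n * a \<ge> 0" using a by (simp add: L_def mangoldt_nonneg)
      have "norm (vint (perron_kernel (a / real (Suc n))) 2 (-T) T - of_real (2 * pi * max 0 (1 - 1 / (a / real (Suc n))))) \<le> 64 * (a / real (Suc n)) powr 2 / T"
        by (rule perron) (use a T in auto)
      then show "norm (of_real (L n * a) * (vint (perron_kernel (a / real (Suc n))) 2 (-T) T - of_real (2 * pi * max 0 (1 - 1 / (a / real (Suc n)))))) \<le> (L n * a) * (64 * (a / real (Suc n)) powr 2 / T)"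
        unfolding norm_mult norm_of_real abs_of_nonneg[OF L0] using L0 by (rule mult_left_mono)
    qed
    also have "\<dots> = (64 * a ^ 3 / T) * (\<Sum>n<N. L n * real (Suc n) powr (- 2))"
      unfolding sum_distrib_left
    proof (rule sum.cong[OF refl])
      fix n
      have "(a / real (Suc n)) powr 2 = a ^ 2 * real (Suc n) powr (- 2)"
      proof -
        have "(a / b) powr 2 = a ^ 2 * b powr (- 2)" if "b > 0" for b :: real
        proof -
          have "b powr (- 2) = 1 / b powr 2" by (rule powr_minus_divide)
          also have "b powr 2 = b ^ 2" using that by simp
          moreover have "(a / b) powr 2 = (a / b) ^ 2" using a that by (simp only: powr_numeral divide_pos_pos zero_le_divide_iff less_imp_le simp_thms)
          ultimately show ?thesis by (simp add: power_divide)
        qed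
        then show ?thesis by simp
      qed
      then show "(L n * a) * (64 * (a / real (Suc n)) powr 2 / T) = (64 * a ^ 3 / T) * (L n * real (Suc n) powr (- 2))"
        by (simp add: power2_eq_square power3_eq_cube)
    qed
    also have "\<dots> \<le> (64 * a ^ 3 / T) * LamC"
    proof (rule mult_left_mono)
      show "(\<Sum>n<N. L n * real (Suc n) powr (- 2)) \<le> LamC"
        unfolding LamC_def L_def by (rule sum_le_suminf[OF LamC_summable]) (auto simp: mangoldt_nonneg)
    qed (use a T in auto)
    finally show ?thesis by (simp add: mult_ac)
  qed
  show ?thesis
    by (rule Lim_norm_ubound[OF _ tendsto_diff[OF l1 l2]], simp, rule always_eventually, rule allI, rule b)
qed

section \<open>Return to \<open>chebyshev_psi\<close> and removal of the main term\<close>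

definition Vd :: "real \<Rightarrow> real \<Rightarrow> complex" where
  "Vd T u = vint (\<lambda>s. Dser s * (of_real u powr s / s)) 2 (-T) T"

lemma Vf_deriv:
  assumes u: "u > 0"
  shows "(Vf T has_vector_derivative Vd T u) (at u)"
proof -
  let ?U = "{0<..} :: real set"
  let ?f = "\<lambda>a t. Dser (Complex 2 t) * (complex_of_real a powr (Complex 2 t + 1) / (Complex 2 t * (Complex 2 t + 1)))"
  let ?f' = "\<lambda>a t. Dser (Complex 2 t) * (complex_of_real a powr (Complex 2 t) / Complex 2 t)"
  have d: "((\<lambda>a. ?f a t) has_vector_derivative ?f' a t) (at a within ?U)" if a: "a \<in> ?U" for a t
  proof -
    have np: "complex_of_real a \<notin> \<real>\<^sub>\<le>\<^sub>0" using a by auto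
    have 1: "((\<lambda>w. w powr (Complex 2 t + 1)) has_field_derivative (Complex 2 t + 1) * of_real a powr (Complex 2 t + 1 - 1)) (at (of_real a))"
      by (rule has_field_derivative_powr[OF np])
    have "((\<lambda>a. of_real a powr (Complex 2 t + 1)) has_vector_derivative (1 * ((Complex 2 t + 1) * of_real a powr (Complex 2 t + 1 - 1)))) (at a within ?U)"
    proof (rule field_vector_diff_chain_within[unfolded o_def, where f = complex_of_real])
      show "(complex_of_real has_vector_derivative 1) (at a within ?U)"
        unfolding has_vector_derivative_def by (auto intro!: derivative_eq_intros simp: scaleR_conv_of_real)
      show "((\<lambda>w. w powr (Complex 2 t + 1)) has_field_derivative (Complex 2 t + 1) * of_real a powr (Complex 2 t + 1 - 1)) (at (of_real a) within complex_of_real ` ?U)"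
        by (rule has_field_derivative_at_within[OF 1])
    qed
    then have "((\<lambda>a. of_real a powr (Complex 2 t + 1)) has_vector_derivative ((Complex 2 t + 1) * of_real a powr Complex 2 t)) (at a within ?U)"
      by simp
    then have "((\<lambda>a. (Dser (Complex 2 t) / (Complex 2 t * (Complex 2 t + 1))) * of_real a powr (Complex 2 t + 1)) has_vector_derivative
      ((Dser (Complex 2 t) / (Complex 2 t * (Complex 2 t + 1))) * ((Complex 2 t + 1) * of_real a powr Complex 2 t))) (at a within ?U)"
      by (rule has_vector_derivative_mult_right)
    moreover have "(Dser (Complex 2 t) / (Complex 2 t * (Complex 2 t + 1))) * ((Complex 2 t + 1) * of_real a powr Complex 2 t) = ?f' a t"
      using Complex_2_nonzero[of t] by simp
    ultimately show ?thesis by simp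
  qed
  have "((\<lambda>a. integral (cbox (-T) T) (?f a)) has_vector_derivative integral (cbox (-T) T) (?f' u)) (at u within ?U)"
  proof (rule leibniz_rule_vector_derivative[where fx = ?f'])
    show "((\<lambda>a. ?f a t) has_vector_derivative ?f' a t) (at a within ?U)" if "a \<in> ?U" for a t using d[OF that] .
    show "?f a integrable_on cbox (-T) T" if "a \<in> ?U" for a
      by (rule integrable_continuous) (use that Complex_2_nonzero in \<open>auto intro!: continuous_intros Dser_cont\<close>)
    have "continuous_on (?U \<times> cbox (- T) T) (\<lambda>p. Dser (Complex 2 (snd p)))"
      by (rule continuous_on_compose2[OF Dser_cont[of UNIV]]) (auto intro!: continuous_intros)
    then show "continuous_on (?U \<times> cbox (- T) T) (\<lambda>(a, t). ?f' a t)"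
      unfolding case_prod_unfold
      by (intro continuous_intros) (use Complex_2_nonzero in auto)
  qed (use u in auto)
  then have "(Vf T has_vector_derivative Vd T u) (at u within ?U)"
    unfolding Vf_def[abs_def] Vd_def vint_def by simp
  then show ?thesis using u by (simp add: at_within_open[of u ?U])
qed

text \<open>Only the real part appears, because the mean value theorem fails for complex values;
  \<open>Wf\<close> is real, so nothing is lost.\<close>

lemma Vf_mean_value:
  assumes a: "a > 0" and h: "h > 0"
  obtains u where "a < u" "u < a + h" "Re (Vf T (a + h)) - Re (Vf T a) = h * Re (Vd T u)"
proof -
  have d: "((\<lambda>a. Re (Vf T a)) has_real_derivative Re (Vd T u)) (at u)" if "u > 0" for u
    using bounded_linear.has_vector_derivative[OF bounded_linear_Re Vf_deriv[OF that]]
    by (simp add: has_real_derivative_iff_has_vector_derivative)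
  have "\<exists>z>a. z < a + h \<and> Re (Vf T (a + h)) - Re (Vf T a) = (a + h - a) * Re (Vd T z)"
    by (rule MVT2) (use a h d in auto)
  then show ?thesis using that by auto
qed

text \<open>The archimedean part of \<open>\<xi>'/\<xi>\<close>.\<close>

definition Aco :: "complex \<Rightarrow> complex" where
  "Aco s = Digamma (s / 2 + 1) / 2 - of_real (ln pi) / 2"

text \<open>The logarithmic derivative of the factorisation \<open>xi_eq_zg\<close>.\<close>

lemma Glog_eq:
  assumes s: "Re s > -2" and nz: "zg s \<noteq> 0"
  shows "Glog s = deriv zg s / zg s + Aco s"
proof -
  have np: "s / 2 + 1 \<notin> \<int>\<^sub>\<le>\<^sub>0" using rGamma_half_nonzero[OF s] by (auto simp: rGamma_eq_zero_iff)
  have G0: "Gamma (s / 2 + 1) \<noteq> 0" using np by (simp add: Gamma_eq_zero_iff)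
  define p where "p s = complex_of_real pi powr (- (s / 2))" for s
  have p0: "p s \<noteq> 0" by (simp add: p_def)
  have dz: "(zg has_field_derivative deriv zg s) (at s)"
    using zg_holomorphic[of UNIV] by (auto simp: holomorphic_derivI)
  have dp: "(p has_field_derivative (- of_real (ln pi) / 2 * p s)) (at s)"
  proof -
    have 1: "((\<lambda>s::complex. - (s / 2)) has_field_derivative (- (1 / 2))) (at s)" by (auto intro!: derivative_eq_intros)
    have 2: "((powr) (complex_of_real pi) has_field_derivative Ln (of_real pi) * of_real pi powr (- (s / 2))) (at (- (s / 2)))"
      by (rule has_field_derivative_powr_right) simp
    from DERIV_chain2[where f = "(powr) (complex_of_real pi)" and g = "\<lambda>s. - (s / 2)" and x = s, OF 2 1]
    show ?thesis unfolding p_def by (simp add: Ln_of_real)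
  qed
  have dG: "((\<lambda>s. Gamma (s / 2 + 1)) has_field_derivative (Gamma (s / 2 + 1) * Digamma (s / 2 + 1)) * (1 / 2)) (at s)"

  proof (rule DERIV_chain2[where f = Gamma and g = "\<lambda>s. s / 2 + 1" and x = s])
    show "(Gamma has_field_derivative Gamma (s / 2 + 1) * Digamma (s / 2 + 1)) (at (s / 2 + 1))"
      by (rule has_field_derivative_Gamma[OF np])
    show "((\<lambda>s::complex. s / 2 + 1) has_field_derivative 1 / 2) (at s)" by (auto intro!: derivative_eq_intros)
  qed
  have "((\<lambda>s. zg s * p s * Gamma (s / 2 + 1)) has_field_derivative
     (deriv zg s * p s + (- of_real (ln pi) / 2 * p s) * zg s) * Gamma (s / 2 + 1) + (Gamma (s / 2 + 1) * Digamma (s / 2 + 1)) * (1 / 2) * (zg s * p s)) (at s)"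
    by (intro DERIV_mult dz dp dG)
  moreover have "\<forall>\<^sub>F z in nhds s. zg z * p z * Gamma (z / 2 + 1) = xi z"
  proof -
    have "\<forall>\<^sub>F z in nhds s. z \<in> {z. Re z > -2}" by (rule eventually_nhds_in_open) (use s open_halfspace_Re_gt in auto)
    then show ?thesis by eventually_elim (simp add: xi_eq_zg p_def)
  qed
  ultimately have "(xi has_field_derivative
     (deriv zg s * p s + (- of_real (ln pi) / 2 * p s) * zg s) * Gamma (s / 2 + 1) + (Gamma (s / 2 + 1) * Digamma (s / 2 + 1)) * (1 / 2) * (zg s * p s)) (at s)"
    by (subst DERIV_cong_ev[OF refl _ refl, symmetric]) assumption+
  then have "deriv xi s = (deriv zg s * p s + (- of_real (ln pi) / 2 * p s) * zg s) * Gamma (s / 2 + 1) + (Gamma (s / 2 + 1) * Digamma (s / 2 + 1)) * (1 / 2) * (zg s * p s)"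
    by (rule DERIV_imp_deriv)
  moreover have "xi s = zg s * p s * Gamma (s / 2 + 1)" using xi_eq_zg[OF s] by (simp add: p_def)
  ultimately show ?thesis unfolding Glog_def Aco_def using nz p0 G0 by (simp add: field_simps)
qed

lemma Dser_eq:
  assumes RH: riemann_hypothesis and s: "Re s > 1"
  shows "Dser s = 1 / (s - 1) + (Aco s - Glog s)"
proof -
  have nz: "zg s \<noteq> 0" using RH_nonzero(1)[OF RH] s by simp
  have "Dser s = 1 / (s - 1) - deriv zg s / zg s"
    unfolding Dser_def using mangoldt_Dirichlet[OF s nz] by (simp add: sums_iff)
  then show ?thesis using Glog_eq[OF _ nz] s by simp
qed

text \<open>\<open>Vd\<close> without the pole of the Dirichlet series at 1, that is, without its main term.\<close>

definition Zd :: "real \<Rightarrow> real \<Rightarrow> complex" where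
  "Zd T u = vint (\<lambda>s. (Aco s - Glog s) * (of_real u powr s / s)) 2 (-T) T"

text \<open>The pole at 1 contributes the integral of \<open>u powr s / (s * (s - 1))\<close>. With
  \<open>s = w + 1\<close> this is \<open>u\<close> times the Perron kernel on
  \<open>Re w = 1\<close>, and its value \<open>2 * pi * u * (1 - 1 / u)\<close> is the main
  term.\<close>

lemma Vd_Zd:
  assumes RH: riemann_hypothesis and u: "u \<ge> 1" and T: "T \<ge> 1"
  shows "norm (Vd T u - Zd T u - of_real (2 * pi * (u - 1))) \<le> 64 * u\<^sup>2 / T"
proof -
  have c1: "continuous_on {-T..T} (\<lambda>t. perron_kernel u (Complex 1 t))"
    unfolding perron_kernel_def using u
    by (intro continuous_intros) (auto simp: complex_eq_iff)
  have eq: "Dser (Complex 2 t) * (of_real u powr Complex 2 t / Complex 2 t) =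
     (Aco (Complex 2 t) - Glog (Complex 2 t)) * (of_real u powr Complex 2 t / Complex 2 t) + of_real u * perron_kernel u (Complex 1 t)" for t
  proof -
    have C: "Complex 2 t = Complex 1 t + 1" by (simp add: Complex_plus_1)
    have n: "Complex 1 t \<noteq> 0" by (simp add: complex_eq_iff)
    have "complex_of_real u powr (Complex 1 t + 1) = of_real u powr Complex 1 t * of_real u"
      using u by (simp add: powr_add)
    then have k: "1 / (Complex 2 t - 1) * (of_real u powr Complex 2 t / Complex 2 t) = of_real u * perron_kernel u (Complex 1 t)"
      unfolding C perron_kernel_def by simp
    have "Dser (Complex 2 t) = 1 / (Complex 2 t - 1) + (Aco (Complex 2 t) - Glog (Complex 2 t))" by (rule Dser_eq[OF RH]) simp
    then show ?thesis unfolding k[symmetric] by (simp only: distrib_right add.commute)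
  qed
  have cD: "continuous_on {-T..T} (\<lambda>t. Dser (Complex 2 t) * (of_real u powr Complex 2 t / Complex 2 t))"
    using u Complex_2_nonzero by (intro continuous_intros Dser_cont) auto
  have "continuous_on {-T..T} (\<lambda>t. Dser (Complex 2 t) * (of_real u powr Complex 2 t / Complex 2 t) - of_real u * perron_kernel u (Complex 1 t))"
    by (intro continuous_intros cD c1)
  then have cZ: "continuous_on {-T..T} (\<lambda>t. (Aco (Complex 2 t) - Glog (Complex 2 t)) * (of_real u powr Complex 2 t / Complex 2 t))"
    unfolding eq by simp
  have "Vd T u = Zd T u + of_real u * vint (perron_kernel u) 1 (-T) T"
  proof -
    have "integral {-T..T} (\<lambda>t. (Aco (Complex 2 t) - Glog (Complex 2 t)) * (of_real u powr Complex 2 t / Complex 2 t) + of_real u * perron_kernel u (Complex 1 t))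
      = integral {-T..T} (\<lambda>t. (Aco (Complex 2 t) - Glog (Complex 2 t)) * (of_real u powr Complex 2 t / Complex 2 t)) + integral {-T..T} (\<lambda>t. of_real u * perron_kernel u (Complex 1 t))"
      by (rule integral_add; rule integrable_continuous_real) (rule cZ, intro continuous_intros c1)
    then show ?thesis unfolding Vd_def Zd_def vint_def eq by simp
  qed
  then have "Vd T u - Zd T u - of_real (2 * pi * (u - 1)) = of_real u * (vint (perron_kernel u) 1 (-T) T - of_real (2 * pi * max 0 (1 - 1 / u)))"
    using u by (simp add: field_simps max_def)
  also have "norm \<dots> \<le> u * (64 * u powr 1 / T)"
    unfolding norm_mult norm_of_real using u T by (intro mult_mono perron) auto
  also have "\<dots> = 64 * u\<^sup>2 / T" using u by (simp add: power2_eq_square)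
  finally show ?thesis .
qed

text \<open>A deviation of \<open>chebyshev_psi\<close> forces a chord of \<open>Wf\<close> to
  deviate, to the right of \<open>x\<close> if it is positive and to the left if it is negative; the
  mean value theorem turns the chord into a value of \<open>Vd\<close>. Since
  \<open>h \<ge> 1\<close>, dividing by \<open>h\<close> does not enlarge the truncation
  error.\<close>

lemma psi_deviation:
  assumes RH: riemann_hypothesis and x: "x \<ge> 4" and h: "1 \<le> h" "h \<le> x / 2" and T: "T \<ge> 1"
    and dev: "\<bar>chebyshev_psi x - x\<bar> \<ge> \<eta>"
  obtains u where "\<bar>u - x\<bar> \<le> h" "2 * pi * (\<eta> - h - 1) - (1024 * LamC + 256) * x ^ 3 / T \<le> \<bar>Re (Zd T u)\<bar>"
proof -
  have VW: "\<bar>Re (Vf T a) - 2 * pi * Wf a\<bar> \<le> 512 * LamC * x ^ 3 / T" if a: "0 < a" "a \<le> 2 * x" for a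
  proof -
    have "\<bar>Re (Vf T a) - 2 * pi * Wf a\<bar> \<le> norm (Vf T a - of_real (2 * pi * Wf a))"
      using abs_Re_le_cmod[of "Vf T a - of_real (2 * pi * Wf a)"] by simp
    also have "\<dots> \<le> 64 * LamC * a ^ 3 / T" by (rule Vf_Wf[OF a(1) T])
    also have "\<dots> \<le> 64 * LamC * (2 * x) ^ 3 / T" using a T LamC_nonneg
      by (intro divide_right_mono mult_left_mono power_mono) auto
    finally show ?thesis by (simp add: power_mult_distrib)
  qed
  \<comment> \<open>The error of one value of \<open>Vf\<close>; the 512 is
    \<open>64 * 2 ^ 3\<close> from \<open>a \<le> 2 * x\<close>. Each chord involves two values,
    whence the final 1024.\<close>
  define e1 where "e1 = 512 * LamC * x ^ 3 / T"
  have e1: "e1 \<ge> 0" unfolding e1_def using LamC_nonneg x T by simp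
  have VZ: "\<bar>Re (Vd T u) - Re (Zd T u) - 2 * pi * (u - 1)\<bar> \<le> 256 * x ^ 3 / T" if u: "1 \<le> u" "u \<le> 2 * x" for u
  proof -
    have "\<bar>Re (Vd T u) - Re (Zd T u) - 2 * pi * (u - 1)\<bar> \<le> norm (Vd T u - Zd T u - of_real (2 * pi * (u - 1)))"
      using abs_Re_le_cmod[of "Vd T u - Zd T u - of_real (2 * pi * (u - 1))"] by simp
    also have "\<dots> \<le> 64 * u\<^sup>2 / T" by (rule Vd_Zd[OF RH u(1) T])
    also have "\<dots> \<le> 64 * (2 * x)\<^sup>2 / T" using u T by (intro divide_right_mono mult_left_mono power_mono) auto
    also have "\<dots> \<le> 256 * x ^ 3 / T" using x T by (simp add: power2_eq_square power3_eq_cube divide_right_mono)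
    finally show ?thesis .
  qed
  have fin: "2 * e1 / h \<le> 1024 * LamC * x ^ 3 / T"
  proof -
    have "2 * e1 / h \<le> 2 * e1 / 1" using e1 h by (intro divide_left_mono) auto
    then show ?thesis by (simp add: e1_def)
  qed
  have split: "(1024 * LamC + 256) * x ^ 3 / T = 1024 * LamC * x ^ 3 / T + 256 * x ^ 3 / T"
    by (simp add: algebra_simps add_divide_distrib)
  from dev consider "chebyshev_psi x - x \<ge> \<eta>" | "chebyshev_psi x - x \<le> - \<eta>" by linarith
  then show ?thesis
  proof cases
    case 1
    obtain u where u: "x < u" "u < x + h" "Re (Vf T (x + h)) - Re (Vf T x) = h * Re (Vd T u)"
      using Vf_mean_value[of x h T] x h by auto
    have "h * (x + \<eta>) \<le> Wf (x + h) - Wf x"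
      using psi_upper[of h x] h 1 mult_left_mono[of "x + \<eta>" "chebyshev_psi x" h] by linarith
    then have "2 * pi * (h * (x + \<eta>)) \<le> 2 * pi * (Wf (x + h) - Wf x)" by simp
    then have "2 * pi * (h * (x + \<eta>)) - 2 * e1 \<le> h * Re (Vd T u)"
      using VW[of "x + h"] VW[of x] x h u(3) unfolding e1_def[symmetric] by (simp add: right_diff_distrib abs_le_iff)
    then have "2 * pi * (x + \<eta>) - 2 * e1 / h \<le> Re (Vd T u)" using h by (simp add: field_simps)
    moreover have "2 * pi * (u - 1) \<le> 2 * pi * (x + h)" using u by (intro mult_left_mono) auto
    moreover have "\<bar>Re (Vd T u) - Re (Zd T u) - 2 * pi * (u - 1)\<bar> \<le> 256 * x ^ 3 / T" by (rule VZ) (use u x h in auto)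
    moreover have "2 * pi * (\<eta> - h - 1) \<le> 2 * pi * (x + \<eta>) - 2 * pi * (x + h)" by (simp add: algebra_simps)
    ultimately have "2 * pi * (\<eta> - h - 1) - (1024 * LamC + 256) * x ^ 3 / T \<le> Re (Zd T u)"
      using fin unfolding split by linarith
    then show ?thesis using that[of u] u by linarith
  next
    case 2
    obtain u where u: "x - h < u" "u < x" "Re (Vf T x) - Re (Vf T (x - h)) = h * Re (Vd T u)"
      using Vf_mean_value[of "x - h" h T] x h by auto
    have "Wf x - Wf (x - h) \<le> h * (x - \<eta>)"
      using psi_lower[of h x] h 2 mult_left_mono[of "chebyshev_psi x" "x - \<eta>" h] by linarith
    then have "2 * pi * (Wf x - Wf (x - h)) \<le> 2 * pi * (h * (x - \<eta>))" by simp
    then have "h * Re (Vd T u) \<le> 2 * pi * (h * (x - \<eta>)) + 2 * e1"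
      using VW[of "x - h"] VW[of x] x h u(3) unfolding e1_def[symmetric] by (simp add: right_diff_distrib abs_le_iff)
    then have "Re (Vd T u) \<le> 2 * pi * (x - \<eta>) + 2 * e1 / h" using h by (simp add: field_simps)
    moreover have "2 * pi * (x - h - 1) \<le> 2 * pi * (u - 1)" using u by (intro mult_left_mono) auto
    moreover have "\<bar>Re (Vd T u) - Re (Zd T u) - 2 * pi * (u - 1)\<bar> \<le> 256 * x ^ 3 / T" by (rule VZ) (use u x h in auto)
    moreover have "2 * pi * (\<eta> - h - 1) = 2 * pi * (x - h - 1) - 2 * pi * (x - \<eta>)" by (simp add: algebra_simps)
    ultimately have "2 * pi * (\<eta> - h - 1) - (1024 * LamC + 256) * x ^ 3 / T \<le> - Re (Zd T u)"
      using fin unfolding split by linarith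
    then show ?thesis using that[of u] u by linarith
  qed
qed

section \<open>The logarithmic derivative near the critical line\<close>

text \<open>The 6 makes the logarithm at least 1 for every \<open>t\<close>, so that constants can
  be absorbed into it.\<close>

abbreviation lt :: "real \<Rightarrow> real" where "lt t \<equiv> ln (6 + \<bar>t\<bar>)"

lemma lt_ge_1: "lt t \<ge> 1"
proof -
  have "exp 1 \<le> 6 + \<bar>t\<bar>" using exp_le by simp
  then have "ln (exp 1) \<le> lt t" by (subst ln_le_cancel_iff) auto
  then show ?thesis by simp
qed

lemma Aco_holomorphic: "Aco holomorphic_on {s. Re s > - 2}"
proof -
  have "(Digamma \<circ> (\<lambda>s. s / 2 + 1)) holomorphic_on {s. Re s > - 2}"
  proof (rule holomorphic_on_compose)
    have "(\<lambda>s. s / 2 + 1) ` {s. Re s > - 2} \<inter> \<int>\<^sub>\<le>\<^sub>0 = {}"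
      using rGamma_half_nonzero by (auto simp: rGamma_eq_zero_iff)
    then show "Digamma holomorphic_on (\<lambda>s. s / 2 + 1) ` {s. Re s > - 2}" by (rule holomorphic_on_Polygamma)
  qed (auto intro!: holomorphic_intros)
  then show ?thesis unfolding Aco_def[abs_def] o_def by (intro holomorphic_intros) auto
qed

lemma Glog_holomorphic:
  assumes RH: riemann_hypothesis
  shows "Glog holomorphic_on {s. Re s > 1/2}"
proof -
  have "open {s. Re s > 1/2}" by (rule open_halfspace_Re_gt)
  then show ?thesis unfolding Glog_def[abs_def]
    by (intro holomorphic_on_divide holomorphic_deriv xi_holomorphic) (use RH_nonzero(2)[OF RH] in auto)
qed

lemma Glog_cnj: "Glog (cnj s) = cnj (Glog s)"
proof -
  have "((cnj \<circ> xi \<circ> cnj) has_field_derivative cnj (deriv xi s)) (at (cnj s))"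
    using has_field_derivative_cnj_cnj[of xi "deriv xi s" "cnj s"] xi_deriv[of s] by simp
  moreover have "cnj \<circ> xi \<circ> cnj = xi" by (auto simp: xi_cnj)
  ultimately have "deriv xi (cnj s) = cnj (deriv xi s)" by (simp add: DERIV_imp_deriv)
  then show ?thesis unfolding Glog_def xi_cnj by simp
qed

lemma Aco_bound:
  assumes s: "0 \<le> Re s" "Re s \<le> 2"
  shows "norm (Aco s) \<le> 6 * lt (Im s)"
proof -
  define z where "z = s / 2 + 1"
  have z: "Re z \<ge> 1" "Re z \<le> 2" using s by (auto simp: z_def)
  have nz: "norm z \<ge> 1" using z complex_Re_le_cmod[of z] by linarith
  have nz2: "norm z \<le> 6 + \<bar>Im s\<bar>"
  proof -
    have "norm z \<le> \<bar>Re z\<bar> + \<bar>Im z\<bar>" by (rule cmod_le)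
    also have "\<dots> \<le> 6 + \<bar>Im s\<bar>" using z by (simp add: z_def)
    finally show ?thesis .
  qed
  have d: "norm (Digamma z - Ln z) \<le> 4"
  proof -
    have "norm (Digamma z - Ln z) \<le> 4 / norm z" by (rule Digamma_bound[OF z(1)])
    also have "\<dots> \<le> 4" using nz by (simp add: divide_le_eq)
    finally show ?thesis .
  qed
  have z0: "z \<noteq> 0" using nz by auto
  have "norm (Ln z) \<le> \<bar>Re (Ln z)\<bar> + \<bar>Im (Ln z)\<bar>" by (rule cmod_le)
  also have "\<dots> \<le> lt (Im s) + 4"
  proof (rule add_mono)
    have "ln (norm z) \<le> lt (Im s)" using nz nz2 by (subst ln_le_cancel_iff) auto
    moreover have "0 \<le> ln (norm z)" using nz by simp
    ultimately show "\<bar>Re (Ln z)\<bar> \<le> lt (Im s)" using z0 by simp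
    show "\<bar>Im (Ln z)\<bar> \<le> 4" using Im_Ln_le_pi[OF z0] mpi_less_Im_Ln[OF z0] pi_less_4 by linarith
  qed
  finally have "norm (Ln z) \<le> lt (Im s) + 4" .
  then have D: "norm (Digamma z) \<le> lt (Im s) + 8" using d norm_triangle_sub[of "Digamma z" "Ln z"] by linarith
  have lp: "\<bar>ln pi\<bar> \<le> 3"
  proof -
    have "ln pi \<le> pi - 1" using ln_le_minus_one[of pi] by simp
    moreover have "0 \<le> ln pi" using pi_gt3 by simp
    ultimately show ?thesis using pi_less_4 by simp
  qed
  have "norm (Aco s) \<le> norm (Digamma z) / 2 + \<bar>ln pi\<bar> / 2"
    unfolding Aco_def z_def[symmetric]
    using norm_triangle_ineq4[of "Digamma z / 2" "of_real (ln pi) / 2"] by (simp add: norm_divide)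
  then show ?thesis using D lp lt_ge_1[of "Im s"] by linarith
qed

text \<open>Stirling's formula: \<open>s / 2 + 1\<close> has modulus close to \<open>t / 2\<close>,
  uniformly in the strip. Up to a factor \<open>pi\<close> the main term is the classical density of
  the zeros at height \<open>t\<close>.\<close>

lemma Re_Aco:
  assumes s: "0 \<le> \<sigma>" "\<sigma> \<le> 2" and t: "t \<ge> 1"
  shows "\<bar>Re (Aco (Complex \<sigma> t)) - (ln t - ln (2 * pi)) / 2\<bar> \<le> 8 / t"
proof -
  define z where "z = Complex \<sigma> t / 2 + 1"
  have z: "Re z = \<sigma> / 2 + 1" "Im z = t / 2" by (auto simp: z_def)
  have z1: "Re z \<ge> 1" using z s by simp
  then have z0: "z \<noteq> 0" by auto
  have nzt: "norm z \<ge> t / 2" using abs_Im_le_cmod[of z] z t by simp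
  have "norm (Digamma z - Ln z) \<le> 4 / norm z" by (rule Digamma_bound[OF z1])
  also have "\<dots> \<le> 4 / (t / 2)" using nzt t z0 by (intro divide_left_mono) (auto intro!: mult_pos_pos)
  finally have d: "\<bar>Re (Digamma z) - ln (norm z)\<bar> \<le> 8 / t"
    using abs_Re_le_cmod[of "Digamma z - Ln z"] z0 by simp
  define q where "q = ((\<sigma> + 2) / t)\<^sup>2"
  have q: "0 \<le> q" "q \<le> 16 / t"
  proof -
    have "q \<le> (4 / t)\<^sup>2" unfolding q_def using s t by (intro power_mono divide_right_mono) auto
    also have "\<dots> = 16 / t * (1 / t)" by (simp add: power2_eq_square)
    also have "\<dots> \<le> 16 / t * 1" using t by (intro mult_left_mono) auto
    finally show "q \<le> 16 / t" by simp
  qed (simp add: q_def)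
  have "(norm z)\<^sup>2 = (t / 2)\<^sup>2 * (1 + q)"
    unfolding cmod_power2 z q_def using t by (simp add: field_simps power2_eq_square)
  then have "ln ((norm z)\<^sup>2) = ln ((t / 2)\<^sup>2) + ln (1 + q)"
    using t q by (simp add: ln_mult_pos add_pos_nonneg)
  moreover have "ln ((norm z)\<^sup>2) = 2 * ln (norm z)" using z0 by (simp add: ln_realpow)
  moreover have "ln ((t / 2)\<^sup>2) = 2 * (ln t - ln 2)" using t by (simp add: ln_realpow ln_div)
  moreover have "0 \<le> ln (1 + q)" "ln (1 + q) \<le> q" using q by (auto intro: ln_add_one_self_le_self)
  moreover have "16 / t = 2 * (8 / t)" "0 \<le> 8 / t" using t by auto
  moreover have "\<bar>a - b\<bar> \<le> c" if "2 * a = 2 * b + w" "0 \<le> w" "w \<le> q" "q \<le> d" "d = 2 * c" for a b c d w :: real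
    using that by linarith
  ultimately have e: "\<bar>ln (norm z) - (ln t - ln 2)\<bar> \<le> 8 / t" using q by (metis (no_types))
  have "Re (Aco (Complex \<sigma> t)) = Re (Digamma z) / 2 - ln pi / 2" by (simp add: Aco_def z_def)
  moreover have "ln (2 * pi) = ln 2 + ln pi" by (simp add: ln_mult_pos)
  ultimately have "Re (Aco (Complex \<sigma> t)) - (ln t - ln (2 * pi)) / 2 =
     (Re (Digamma z) - ln (norm z)) / 2 + (ln (norm z) - (ln t - ln 2)) / 2" by (simp add: field_simps)
  moreover have "\<bar>w\<bar> \<le> c" if "w = x / 2 + y / 2" "\<bar>x\<bar> \<le> c" "\<bar>y\<bar> \<le> c" for w x y c :: real
    using that by linarith
  ultimately show ?thesis using d e by blast
qed

text \<open>\<open>7 + LamC\<close> comes from the value of \<open>Glog\<close> at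
  \<open>2 + it\<close>, and the 5 from the Borel-Caratheodory factor in
  \<open>Glog_bound\<close>.\<close>

definition CG :: real where "CG = 5 * (7 + LamC)"

lemma CG_ge: "CG \<ge> 35" using LamC_nonneg by (simp add: CG_def)

lemma Zline_bound:
  assumes RH: riemann_hypothesis
  shows "norm (Aco (Complex 2 t) - Glog (Complex 2 t)) \<le> LamC + 1"
proof -
  have "Aco (Complex 2 t) - Glog (Complex 2 t) = Dser (Complex 2 t) - 1 / (Complex 2 t - 1)"
    using Dser_eq[OF RH, of "Complex 2 t"] by simp
  also have "norm \<dots> \<le> norm (Dser (Complex 2 t)) + norm (1 / (Complex 2 t - 1))" by (rule norm_triangle_ineq4)
  also have "\<dots> \<le> LamC + 1"
  proof (rule add_mono[OF Dser_bound])
    have "Complex 2 t - 1 = Complex 1 t" by (simp add: complex_eq_iff)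
    moreover have "1 \<le> norm (Complex 1 t)" using norm_Complex_ge(1)[where a = 1 and t = t] by simp
    ultimately show "norm (1 / (Complex 2 t - 1)) \<le> 1" by (simp add: norm_divide divide_le_eq)
  qed
  finally show ?thesis .
qed

text \<open>Positivity yields a bound for the modulus: by Borel-Caratheodory on the disc about
  \<open>2 + it\<close> that touches the critical line, \<open>Glog\<close> is controlled by its
  value at the centre, where the Dirichlet series converges.\<close>

lemma Glog_bound:
  assumes RH: riemann_hypothesis and s: "1/2 < Re s" "Re s \<le> 2"
  shows "norm (Glog s) \<le> CG * lt (Im s) / (Re s - 1/2)"
proof -
  define t where "t = Im s"
  define z0 where "z0 = Complex 2 t"
  define r where "r = 2 - Re s"
  have r: "0 \<le> r" "r < 3/2" "3/2 - r = Re s - 1/2" using s by (auto simp: r_def)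
  have G0: "norm (Glog z0) \<le> (7 + LamC) * lt t"
  proof -
    have "norm (Glog z0) \<le> norm (Aco z0) + norm (Aco z0 - Glog z0)"
      using norm_triangle_ineq4[of "Aco z0" "Aco z0 - Glog z0"] by simp
    also have "\<dots> \<le> 6 * lt t + (LamC + 1)"
      using Aco_bound[of z0] Zline_bound[OF RH, of t] unfolding z0_def by (intro add_mono) auto
    also have "\<dots> \<le> 6 * lt t + (LamC + 1) * lt t" using lt_ge_1[of t] LamC_nonneg mult_left_mono[of 1 "lt t" "LamC + 1"] by simp
    finally show ?thesis by (simp add: algebra_simps)
  qed
  have ns: "norm (s - z0) = r"
    unfolding z0_def r_def t_def cmod_def using s by simp
  have "norm (Glog s - Glog z0) \<le> 2 * r / (3/2 - r) * Re (Glog z0)"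
  proof (rule Borel_Caratheodory_pos[where F = Glog])
    show "Glog holomorphic_on ball z0 (3/2)"
      by (rule holomorphic_on_subset[OF Glog_holomorphic[OF RH]]) (use ball_Re_Im in \<open>auto simp: z0_def\<close>)
    show "0 \<le> Re (Glog z)" if "z \<in> ball z0 (3/2)" for z
      by (rule Glog_Re_nonneg[OF RH]) (use that ball_Re_Im in \<open>auto simp: z0_def\<close>)
  qed (use ns r in auto)
  also have "\<dots> \<le> 3 / (Re s - 1/2) * norm (Glog z0)"
    using r s complex_Re_le_cmod[of "Glog z0"] Glog_Re_nonneg[OF RH, of z0]
    by (intro mult_mono frac_le) (auto simp: z0_def)
  finally have "norm (Glog s) \<le> (1 + 3 / (Re s - 1/2)) * norm (Glog z0)"
    using norm_triangle_sub[of "Glog s" "Glog z0"] by (simp add: distrib_right)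
  also have "\<dots> \<le> (5 / (Re s - 1/2)) * ((7 + LamC) * lt t)"
  proof (intro mult_mono G0)
    have "1 \<le> 2 / (Re s - 1/2)" using s by (simp add: pos_le_divide_eq)
    moreover have "2 / (Re s - 1/2) + 3 / (Re s - 1/2) = 5 / (Re s - 1/2)" by (subst add_divide_distrib[symmetric]) simp
    ultimately show "1 + 3 / (Re s - 1/2) \<le> 5 / (Re s - 1/2)" by linarith
  qed (use s in auto)
  finally show ?thesis unfolding CG_def t_def by (simp only: mult_ac times_divide_eq_left times_divide_eq_right)
qed

section \<open>Reduction to the positive density\<close>

lemma integral_inverse_norm:
  assumes a: "a > 0" and T: "T \<ge> 0"
  shows "integral {-T..T} (\<lambda>t. 1 / norm (Complex a t)) \<le> 4 * ln (1 + T / a)"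
proof -
  have ct: "continuous_on A (\<lambda>t. 1 / norm (Complex a t))" for A
    using a by (intro continuous_intros) (auto simp: complex_eq_iff)
  have half: "integral {0..T} (\<lambda>t. 1 / norm (Complex a t)) \<le> 2 * ln (1 + T / a)"
  proof -
    have i: "((\<lambda>t. 2 / (a + t)) has_integral (2 * ln (a + T) - 2 * ln (a + 0))) {0..T}"
    proof (rule fundamental_theorem_of_calculus[OF T])
      fix t assume t: "t \<in> {0..T}"
      have "((\<lambda>t. 2 * ln (a + t)) has_real_derivative 2 / (a + t)) (at t within {0..T})"
        using t a by (auto intro!: derivative_eq_intros)
      then show "((\<lambda>t. 2 * ln (a + t)) has_vector_derivative 2 / (a + t)) (at t within {0..T})"
        by (simp add: has_real_derivative_iff_has_vector_derivative)
    qed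
    have "integral {0..T} (\<lambda>t. 1 / norm (Complex a t)) \<le> integral {0..T} (\<lambda>t. 2 / (a + t))"
    proof (rule integral_le)
      show "(\<lambda>t. 2 / (a + t)) integrable_on {0..T}" using i by blast
      fix t assume t: "t \<in> {0..T}"
      have "a + t \<le> 2 * norm (Complex a t)" using norm_Complex_ge[where a = a and t = t] a t by auto
      then show "1 / norm (Complex a t) \<le> 2 / (a + t)" using a t
        by (simp add: divide_simps)
    qed (intro integrable_continuous_real ct)
    also have "\<dots> = 2 * (ln (a + T) - ln a)" using i by (simp add: integral_unique)
    also have "ln (a + T) - ln a = ln (1 + T / a)"
    proof -
      have "1 + T / a = (a + T) / a" using a by (simp add: field_simps)
      then show ?thesis using a T by (simp add: ln_div)
    qed
    finally show ?thesis .
  qed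
  have "integral {-T..T} (\<lambda>t. 1 / norm (Complex a t)) = integral {-T..0} (\<lambda>t. 1 / norm (Complex a t)) + integral {0..T} (\<lambda>t. 1 / norm (Complex a t))"
    by (rule Henstock_Kurzweil_Integration.integral_combine[symmetric]) (use T in \<open>auto intro!: integrable_continuous_real ct\<close>)
  also have "integral {-T..0} (\<lambda>t. 1 / norm (Complex a t)) = integral {0..T} (\<lambda>t. 1 / norm (Complex a (- t)))"
    using Henstock_Kurzweil_Integration.integral_reflect_real[of T 0 "\<lambda>t. 1 / norm (Complex a (- t))"] by simp
  also have "(\<lambda>t. 1 / norm (Complex a (- t))) = (\<lambda>t. 1 / norm (Complex a t))" by (simp add: cmod_def)
  finally show ?thesis using half by simp
qed

definition upow :: "real \<Rightarrow> complex \<Rightarrow> complex" where "upow u s = of_real u powr s / s"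

lemma upow_norm: "u > 0 \<Longrightarrow> norm (upow u s) = u powr Re s / norm s"
  by (simp add: upow_def norm_divide norm_powr_real_powr)

lemma upow_holomorphic: "u > 0 \<Longrightarrow> 0 \<notin> A \<Longrightarrow> upow u holomorphic_on A"
  unfolding upow_def[abs_def] by (intro holomorphic_intros) auto

text \<open>For lines on which the power of \<open>u\<close> is already small enough, so that
  absolute values suffice; the decay \<open>1 / norm (Complex d t)\<close> costs one logarithm. The
  abscissa \<open>d\<close> is kept apart from \<open>a\<close> because the kernel may be a
  reflected one.\<close>

lemma vint_upow_bound:
  assumes a: "a \<ge> 1/4" and u: "u > 0" and T: "T \<ge> 1" and cF: "continuous_on {-T..T} (\<lambda>t. F (Complex a t))"
    and ck: "continuous_on {-T..T} (\<lambda>t. k (Complex a t))"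
    and F: "\<And>t. t \<in> {-T..T} \<Longrightarrow> norm (F (Complex a t)) \<le> B" and B: "B \<ge> 0"
    and k: "\<And>t. norm (k (Complex a t)) \<le> M / norm (Complex d t)" and M: "M \<ge> 0" and d: "d \<ge> 1/4"
  shows "norm (vint (\<lambda>s. F s * k s) a (-T) T) \<le> 12 * B * M * lt T"
proof -
  have ct: "continuous_on A (\<lambda>t. 1 / norm (Complex d t))" for A
    using d by (intro continuous_intros) (auto simp: complex_eq_iff)
  have "norm (vint (\<lambda>s. F s * k s) a (-T) T) \<le> integral {-T..T} (\<lambda>t. (B * M) * (1 / norm (Complex d t)))"
    unfolding vint_def
  proof (rule integral_norm_bound_integral)
    show "norm (F (Complex a t) * k (Complex a t)) \<le> (B * M) * (1 / norm (Complex d t))" if "t \<in> {-T..T}" for t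
    proof -
      have "norm (F (Complex a t) * k (Complex a t)) \<le> B * (M / norm (Complex d t))"
        unfolding norm_mult using F[OF that] k[of t] B by (intro mult_mono) auto
      then show ?thesis by simp
    qed
  qed (intro integrable_continuous_real continuous_intros cF ck ct)+
  also have "\<dots> = (B * M) * integral {-T..T} (\<lambda>t. 1 / norm (Complex d t))" by (rule integral_mult_right)
  also have "\<dots> \<le> (B * M) * (4 * ln (1 + T / d))"
    using B M d T by (intro mult_left_mono integral_inverse_norm) auto
  also have "\<dots> \<le> (B * M) * (4 * (3 * lt T))"
  proof (intro mult_left_mono)
    have "1 + T / d \<le> (6 + \<bar>T\<bar>) ^ 3"
    proof -
      have "T / d \<le> T / (1/4)" using T d by (intro divide_left_mono) auto
      then have "1 + T / d \<le> 6 * (6 + T)" using T by simp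
      also have "\<dots> \<le> (6 + T) * (6 + T)" using T by (intro mult_right_mono) auto
      also have "\<dots> \<le> (6 + T) * (6 + T) * (6 + T)" using T mult_left_mono[of 1 "6 + T" "(6 + T) * (6 + T)"] by simp
      finally show ?thesis using T by (simp add: power3_eq_cube)
    qed
    moreover have "0 < 1 + T / d" using T d by (simp add: add_pos_nonneg)
    ultimately have "ln (1 + T / d) \<le> ln ((6 + \<bar>T\<bar>) ^ 3)" by (subst ln_le_cancel_iff) auto
    also have "\<dots> = 3 * lt T" by (subst ln_realpow) auto
    finally show "ln (1 + T / d) \<le> 3 * lt T" .
  qed (use B M in auto)
  finally show ?thesis by (simp add: mult_ac)
qed

definition ReG :: "real \<Rightarrow> real \<Rightarrow> real" where "ReG \<sigma> t = Re (Glog (Complex \<sigma> t))"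

lemma ReG_nonneg: "riemann_hypothesis \<Longrightarrow> \<sigma> > 1/2 \<Longrightarrow> ReG \<sigma> t \<ge> 0"
  unfolding ReG_def by (rule Glog_Re_nonneg) auto

lemma ReG_cont:
  assumes "riemann_hypothesis" "\<sigma> > 1/2"
  shows "continuous_on A (ReG \<sigma>)"
proof -
  have "continuous_on A (\<lambda>t. Glog (Complex \<sigma> t))"
    by (rule continuous_on_compose2[OF holomorphic_on_imp_continuous_on[OF Glog_holomorphic[OF assms(1)]]])
       (use assms in \<open>auto intro!: continuous_intros\<close>)
  then show ?thesis unfolding ReG_def[abs_def] by (intro continuous_intros)
qed

lemma upow_cont: "u > 0 \<Longrightarrow> \<sigma> > 0 \<Longrightarrow> continuous_on A (\<lambda>t. upow u (Complex \<sigma> t))"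
  unfolding upow_def by (intro continuous_intros) (auto simp: complex_eq_iff)

text \<open>On the line \<open>Re s = \<sigma>\<close> one has \<open>Glog = 2 Re Glog - cnj Glog\<close>, and \<open>cnj (Glog s) = Glog (2\<sigma> - s)\<close>
  continues to the left, where the powers of \<open>u\<close> are small: only the positive density
  \<open>Re Glog\<close> survives.\<close>

lemma Zd_reduce:
  assumes RH: riemann_hypothesis and u: "u \<ge> 1" and T: "T \<ge> 1" and b: "0 < b" "b \<le> 1/8"
  shows "\<bar>Re (Zd T u)\<bar> \<le> 4 * \<bar>Re (integral {0..T} (\<lambda>t. of_real (ReG (1/2 + b) t) * upow u (Complex (1/2 + b) t)))\<bar>
     + 120 * CG * (lt T)\<^sup>2 * u powr (1/4 + 2 * b) + 25 * CG * lt T * u\<^sup>2 / (b * T)"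
proof -
  define \<sigma> where "\<sigma> = 1/2 + b"
  have \<sigma>: "1/2 < \<sigma>" "\<sigma> \<le> 5/8" using b by (auto simp: \<sigma>_def)
  let ?P = "{s. Re s > 0}" and ?H = "{s. Re s > 1/2}"
  have oP: "open ?P" "convex ?P" and oH: "open ?H" "convex ?H" by (rule open_halfspace_Re_gt convex_halfspace_Re_gt)+
  have hA: "(\<lambda>s. Aco s * upow u s) holomorphic_on ?P"
    by (intro holomorphic_intros upow_holomorphic holomorphic_on_subset[OF Aco_holomorphic]) (use u in auto)
  have hG: "(\<lambda>s. Glog s * upow u s) holomorphic_on ?H"
    by (intro holomorphic_intros upow_holomorphic Glog_holomorphic[OF RH]) (use u in auto)
  define l where "l = lt T"
  have l: "l \<ge> 1" unfolding l_def by (rule lt_ge_1)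
  have kT: "norm (upow u (Complex a t)) \<le> u\<^sup>2 / T" if "a \<in> {0<..2}" "\<bar>t\<bar> = T" for a t
  proof -
    have "u powr a \<le> u powr 2" using u that by (intro powr_mono) auto
    then have "u powr a \<le> u\<^sup>2" using u by simp
    moreover have "norm (Complex a t) \<ge> T" using norm_Complex_ge(2)[where a = a and t = t] that by linarith
    ultimately show ?thesis using u T by (subst upow_norm) (auto intro!: frac_le)
  qed
  define e where "e = l * (u\<^sup>2 / T)"
  have e0: "e \<ge> 0" using l T by (simp add: e_def)
  have b8: "1 \<le> 1 / b" using b by (simp add: pos_le_divide_eq)
  have ZAG: "Zd T u = vint (\<lambda>s. Aco s * upow u s) 2 (-T) T - vint (\<lambda>s. Glog s * upow u s) 2 (-T) T"
  proof -
    have "continuous_on {-T..T} (\<lambda>t. Aco (Complex 2 t) * upow u (Complex 2 t))" by (rule vline_cont[OF hA]) auto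
    moreover have "continuous_on {-T..T} (\<lambda>t. Glog (Complex 2 t) * upow u (Complex 2 t))" by (rule vline_cont[OF hG]) auto
    ultimately show ?thesis unfolding Zd_def vint_def upow_def[symmetric] left_diff_distrib
      by (intro integral_diff integrable_continuous_real)
  qed
  \<comment> \<open>\<open>Aco\<close> is analytic beyond the critical line, so its integral moves
    to \<open>Re s = 1/4\<close>, short of the pole of \<open>upow\<close> at 0; only horizontal
    sides are lost.\<close>
  have A1: "norm (vint (\<lambda>s. Aco s * upow u s) 2 (-T) T - vint (\<lambda>s. Aco s * upow u s) (1/4) (-T) T) \<le> 21 * e"
  proof -
    define H where "H = 6 * l * (u\<^sup>2 / T)"
    have hz: "norm (Aco (Complex a t) * upow u (Complex a t)) \<le> H" if "a \<in> {1/4..2}" "\<bar>t\<bar> = T" for a t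
    proof -
      have "norm (Aco (Complex a t)) \<le> 6 * l" using Aco_bound[of "Complex a t"] that T by (simp add: l_def)
      then show ?thesis unfolding norm_mult H_def using that l by (intro mult_mono kT) auto
    qed
    have "norm (vint (\<lambda>s. Aco s * upow u s) 2 (-T) T - vint (\<lambda>s. Aco s * upow u s) (1/4) (-T) T) \<le> (2 - 1/4) * (H + H)"
      by (rule vint_shift[OF hA oP]) (use T in \<open>auto intro!: hz\<close>)
    then show ?thesis by (simp add: e_def H_def)
  qed
  have A2: "norm (vint (\<lambda>s. Aco s * upow u s) (1/4) (-T) T) \<le> 72 * l\<^sup>2 * u powr (1/4)"
  proof -
    have "norm (vint (\<lambda>s. Aco s * upow u s) (1/4) (-T) T) \<le> 12 * (6 * l) * (u powr (1/4)) * lt T"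
    proof (rule vint_upow_bound[where d = "1/4"])
      show "continuous_on {-T..T} (\<lambda>t. Aco (Complex (1/4) t))" by (rule vline_cont[OF Aco_holomorphic]) auto
      show "norm (Aco (Complex (1/4) t)) \<le> 6 * l" if "t \<in> {-T..T}" for t
      proof -
        have "norm (Aco (Complex (1/4) t)) \<le> 6 * lt t" using Aco_bound[of "Complex (1/4) t"] by simp
        also have "\<dots> \<le> 6 * l" using that T by (auto simp: l_def abs_le_iff)
        finally show ?thesis .
      qed
      show "norm (upow u (Complex (1/4) t)) \<le> u powr (1/4) / norm (Complex (1/4) t)" for t using u by (subst upow_norm) auto
    qed (use u T l upow_cont in auto)
    then show ?thesis by (simp add: l_def power2_eq_square mult_ac)
  qed
  have Gh: "norm (Glog (Complex a t)) \<le> CG * l / b" if "a \<in> {\<sigma>..2}" "\<bar>t\<bar> \<le> T" for a t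
  proof -
    have "norm (Glog (Complex a t)) \<le> CG * lt t / (a - 1/2)" using Glog_bound[OF RH, of "Complex a t"] that \<sigma> by simp
    also have "\<dots> \<le> CG * l / b" using that \<sigma> b CG_ge l T
      by (intro frac_le mult_left_mono) (auto simp: l_def \<sigma>_def)
    finally show ?thesis .
  qed
  have G1: "norm (vint (\<lambda>s. Glog s * upow u s) 2 (-T) T - vint (\<lambda>s. Glog s * upow u s) \<sigma> (-T) T) \<le> 3 * CG / b * e"
  proof -
    define H where "H = CG * l / b * (u\<^sup>2 / T)"
    have hz: "norm (Glog (Complex a t) * upow u (Complex a t)) \<le> H" if "a \<in> {\<sigma>..2}" "\<bar>t\<bar> = T" for a t
      unfolding norm_mult H_def using that \<sigma> l b CG_ge by (intro mult_mono kT Gh) auto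
    have "norm (vint (\<lambda>s. Glog s * upow u s) 2 (-T) T - vint (\<lambda>s. Glog s * upow u s) \<sigma> (-T) T) \<le> (2 - \<sigma>) * (H + H)"
      by (rule vint_shift[OF hG oH]) (use T \<sigma> in \<open>auto intro!: hz\<close>)
    also have "\<dots> \<le> (3/2) * (H + H)"
      using \<sigma> CG_ge l b T by (intro mult_right_mono) (auto simp: H_def)
    also have "\<dots> = 3 * CG / b * e" by (simp add: e_def H_def mult_ac)
    finally show ?thesis .
  qed
  \<comment> \<open>The reflected integrand: \<open>Glog\<close> is still evaluated right of the
    critical line, while the exponent of \<open>u\<close> is \<open>2 * \<sigma> - s\<close>. Moving
    to the right, to \<open>Re s = 3/4\<close>, lowers this exponent to
    \<open>1/4 + 2 * b\<close>.\<close>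
  define m where "m s = Glog s * upow u (of_real (2 * \<sigma>) - s)" for s
  let ?S = "{s. Re s > 1/2} \<inter> {s. Re s < 2 * \<sigma>}"
  have oS: "open ?S" "convex ?S" by (intro open_Int convex_Int open_halfspace_Re_gt open_halfspace_Re_lt convex_halfspace_Re_gt convex_halfspace_Re_lt)+
  have hk: "(\<lambda>s. upow u (of_real (2 * \<sigma>) - s)) holomorphic_on ?S"
    unfolding upow_def by (intro holomorphic_intros) (use u in auto)
  have hm: "m holomorphic_on ?S" unfolding m_def
    by (intro holomorphic_intros hk holomorphic_on_subset[OF Glog_holomorphic[OF RH]]) auto
  have kr: "of_real (2 * \<sigma>) - Complex a t = Complex (2 * \<sigma> - a) (- t)" for a t by (simp add: complex_eq_iff)
  have M1: "norm (vint m (3/4) (-T) T - vint m \<sigma> (-T) T) \<le> CG / (2 * b) * e"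
  proof -
    define H where "H = CG * l / b * (u\<^sup>2 / T)"
    have hz: "norm (m (Complex a t)) \<le> H" if "a \<in> {\<sigma>..3/4}" "\<bar>t\<bar> = T" for a t
      unfolding norm_mult m_def kr H_def using that \<sigma> l b CG_ge by (intro mult_mono kT Gh) auto
    have "norm (vint m (3/4) (-T) T - vint m \<sigma> (-T) T) \<le> (3/4 - \<sigma>) * (H + H)"
      by (rule vint_shift[OF hm oS]) (use T \<sigma> in \<open>auto intro!: hz\<close>)
    also have "\<dots> \<le> (1/4) * (H + H)"
      using \<sigma> CG_ge l b T by (intro mult_right_mono) (auto simp: H_def)
    also have "\<dots> = CG / (2 * b) * e" by (simp add: e_def H_def mult_ac)
    finally show ?thesis .
  qed
  have M2: "norm (vint m (3/4) (-T) T) \<le> 48 * CG * l\<^sup>2 * u powr (1/4 + 2 * b)"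
  proof -
    have "norm (vint m (3/4) (-T) T) \<le> 12 * (4 * CG * l) * (u powr (1/4 + 2 * b)) * lt T"
      unfolding m_def
    proof (rule vint_upow_bound[where d = "1/4 + 2 * b"])
      show "continuous_on {-T..T} (\<lambda>t. Glog (Complex (3/4) t))" by (rule vline_cont[OF Glog_holomorphic[OF RH]]) auto
      show "continuous_on {-T..T} (\<lambda>t. upow u (of_real (2 * \<sigma>) - Complex (3/4) t))"
        by (rule vline_cont[OF hk]) (use \<sigma> in auto)
      show "norm (Glog (Complex (3/4) t)) \<le> 4 * CG * l" if "t \<in> {-T..T}" for t
      proof -
        have "norm (Glog (Complex (3/4) t)) \<le> 4 * CG * lt t" using Glog_bound[OF RH, of "Complex (3/4) t"] by simp
        also have "\<dots> \<le> 4 * CG * l" using that T CG_ge by (auto simp: l_def abs_le_iff)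
        finally show ?thesis .
      qed
      show "norm (upow u (of_real (2 * \<sigma>) - Complex (3/4) t)) \<le> u powr (1/4 + 2 * b) / norm (Complex (1/4 + 2 * b) t)" for t
      proof -
        have "2 * \<sigma> - 3/4 = 1/4 + 2 * b" by (simp add: \<sigma>_def)
        moreover have "norm (Complex (1/4 + 2 * b) (- t)) = norm (Complex (1/4 + 2 * b) t)" by (simp add: cmod_def)
        ultimately show ?thesis unfolding kr using u by (subst upow_norm) auto
      qed
    qed (use u T l CG_ge b in auto)
    then show ?thesis by (simp add: l_def power2_eq_square mult_ac)
  qed
  define I where "I = integral {-T..T} (\<lambda>t. of_real (ReG \<sigma> t) * upow u (Complex \<sigma> t))"
  have cR: "continuous_on A (\<lambda>t. of_real (ReG \<sigma> t) * upow u (Complex \<sigma> t))" for A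
    by (intro continuous_intros ReG_cont[OF RH \<sigma>(1)] upow_cont) (use u \<sigma> in auto)
  have cmm: "continuous_on {-T..T} (\<lambda>t. m (Complex \<sigma> t))" by (rule vline_cont[OF hm]) (use \<sigma> in auto)
  have GI: "vint (\<lambda>s. Glog s * upow u s) \<sigma> (-T) T = 2 * I - cnj (vint m \<sigma> (-T) T)"
  proof -
    have "Glog (Complex \<sigma> t) * upow u (Complex \<sigma> t) = 2 * (of_real (ReG \<sigma> t) * upow u (Complex \<sigma> t)) - cnj (m (Complex \<sigma> t))" for t
    proof -
      have c: "cnj (upow u (Complex (2 * \<sigma> - \<sigma>) (- t))) = upow u (Complex \<sigma> t)"
      proof -
        have "cnj (of_real u powr s) = of_real u powr (cnj s)" for s
          using u by (simp add: powr_def exp_cnj Ln_of_real)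
        moreover have "cnj (Complex (2 * \<sigma> - \<sigma>) (- t)) = Complex \<sigma> t" by (simp add: complex_eq_iff)
        ultimately show ?thesis unfolding upow_def by simp
      qed
      have "Glog (Complex \<sigma> t) = 2 * of_real (ReG \<sigma> t) - cnj (Glog (Complex \<sigma> t))"
        by (simp add: ReG_def complex_eq_iff)
      then have "Glog (Complex \<sigma> t) * upow u (Complex \<sigma> t) = (2 * of_real (ReG \<sigma> t) - cnj (Glog (Complex \<sigma> t))) * upow u (Complex \<sigma> t)" by simp
      also have "\<dots> = 2 * (of_real (ReG \<sigma> t) * upow u (Complex \<sigma> t)) - cnj (m (Complex \<sigma> t))"
        unfolding m_def kr complex_cnj_mult c by (simp add: left_diff_distrib)
      finally show ?thesis .
    qed
    then have "vint (\<lambda>s. Glog s * upow u s) \<sigma> (-T) T = integral {-T..T} (\<lambda>t. 2 * (of_real (ReG \<sigma> t) * upow u (Complex \<sigma> t)) - cnj (m (Complex \<sigma> t)))"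
      unfolding vint_def by simp
    also have "\<dots> = integral {-T..T} (\<lambda>t. 2 * (of_real (ReG \<sigma> t) * upow u (Complex \<sigma> t))) - integral {-T..T} (\<lambda>t. cnj (m (Complex \<sigma> t)))"
      by (rule integral_diff; rule integrable_continuous_real) (intro continuous_intros cR cmm)+
    finally show ?thesis unfolding I_def vint_def by (simp add: integral_cnj)
  qed
  \<comment> \<open>The integrand at \<open>- t\<close> is the complex conjugate of the one at
    \<open>t\<close>.\<close>
  have ReI: "Re I = 2 * Re (integral {0..T} (\<lambda>t. of_real (ReG \<sigma> t) * upow u (Complex \<sigma> t)))"
  proof -
    let ?f = "\<lambda>t. of_real (ReG \<sigma> t) * upow u (Complex \<sigma> t)"
    have "I = integral {-T..0} ?f + integral {0..T} ?f"
      unfolding I_def by (rule Henstock_Kurzweil_Integration.integral_combine[symmetric]) (use T in \<open>auto intro!: integrable_continuous_real cR\<close>)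
    also have "integral {-T..0} ?f = integral {0..T} (\<lambda>t. ?f (- t))"
      using Henstock_Kurzweil_Integration.integral_reflect_real[of T 0 "\<lambda>t. ?f (- t)"] by simp
    also have "(\<lambda>t. ?f (- t)) = (\<lambda>t. cnj (?f t))"
    proof
      fix t
      have c: "Complex \<sigma> (- t) = cnj (Complex \<sigma> t)" by (simp add: complex_eq_iff)
      have "cnj (of_real u powr s) = of_real u powr (cnj s)" for s
        using u by (simp add: powr_def exp_cnj Ln_of_real)
      then have "upow u (cnj (Complex \<sigma> t)) = cnj (upow u (Complex \<sigma> t))" unfolding upow_def by simp
      moreover have "ReG \<sigma> (- t) = ReG \<sigma> t" unfolding ReG_def c Glog_cnj by simp
      ultimately show "?f (- t) = cnj (?f t)" unfolding c by simp
    qed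
    also have "integral {0..T} (\<lambda>t. cnj (?f t)) = cnj (integral {0..T} ?f)" by (rule integral_cnj[symmetric])
    finally show ?thesis by simp
  qed
  have nb: "1/4 \<le> 1/4 + 2 * b" using b by simp
  have up: "u powr (1/4) \<le> u powr (1/4 + 2 * b)" using u nb by (intro powr_mono) auto
  define W where "W = l\<^sup>2 * u powr (1/4 + 2 * b)"
  have W0: "W \<ge> 0" by (simp add: W_def)
  have A2': "norm (vint (\<lambda>s. Aco s * upow u s) (1/4) (-T) T) \<le> 72 * CG * W"
  proof -
    have "72 * l\<^sup>2 * u powr (1/4) \<le> 72 * l\<^sup>2 * u powr (1/4 + 2 * b)" using up by (intro mult_left_mono) auto
    also have "\<dots> = 72 * 1 * W" by (simp add: W_def)
    also have "\<dots> \<le> 72 * CG * W" using CG_ge W0 by (intro mult_right_mono) auto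
    finally show ?thesis using A2 by simp
  qed
  define E where "E = CG / b * e"
  have E0: "E \<ge> e"
  proof -
    have "1 * 1 \<le> CG * (1 / b)" using CG_ge b8 by (intro mult_mono) auto
    then show ?thesis unfolding E_def using e0 mult_right_mono[of 1 "CG / b" e] by simp
  qed
  have tri: "norm (v1 + v2 - v3 + (v4 - v5)) \<le> norm v1 + norm v2 + norm v3 + norm v4 + norm v5" for v1 v2 v3 v4 v5 :: complex
    using norm_triangle_ineq[of "v1 + v2 - v3" "v4 - v5"] norm_triangle_ineq4[of "v1 + v2" v3] norm_triangle_ineq[of v1 v2]
      norm_triangle_ineq4[of v4 v5] by linarith
  have ZI: "Zd T u + 2 * I = (vint (\<lambda>s. Aco s * upow u s) 2 (-T) T - vint (\<lambda>s. Aco s * upow u s) (1/4) (-T) T)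
     + vint (\<lambda>s. Aco s * upow u s) (1/4) (-T) T
     - (vint (\<lambda>s. Glog s * upow u s) 2 (-T) T - vint (\<lambda>s. Glog s * upow u s) \<sigma> (-T) T)
     + (cnj (vint m (3/4) (-T) T) - cnj (vint m (3/4) (-T) T - vint m \<sigma> (-T) T))"
    unfolding ZAG GI by simp
  have "norm (Zd T u + 2 * I) \<le> norm (vint (\<lambda>s. Aco s * upow u s) 2 (-T) T - vint (\<lambda>s. Aco s * upow u s) (1/4) (-T) T)
     + norm (vint (\<lambda>s. Aco s * upow u s) (1/4) (-T) T)
     + norm (vint (\<lambda>s. Glog s * upow u s) 2 (-T) T - vint (\<lambda>s. Glog s * upow u s) \<sigma> (-T) T)
     + norm (cnj (vint m (3/4) (-T) T)) + norm (cnj (vint m (3/4) (-T) T - vint m \<sigma> (-T) T))"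
    unfolding ZI by (rule tri)
  then have "norm (Zd T u + 2 * I) \<le> norm (vint (\<lambda>s. Aco s * upow u s) 2 (-T) T - vint (\<lambda>s. Aco s * upow u s) (1/4) (-T) T)
     + norm (vint (\<lambda>s. Aco s * upow u s) (1/4) (-T) T)
     + norm (vint (\<lambda>s. Glog s * upow u s) 2 (-T) T - vint (\<lambda>s. Glog s * upow u s) \<sigma> (-T) T)
     + norm (vint m (3/4) (-T) T) + norm (vint m (3/4) (-T) T - vint m \<sigma> (-T) T)"
    unfolding complex_mod_cnj .
  moreover have "norm (vint m (3/4) (-T) T) \<le> 48 * (CG * W)" using M2 by (simp add: W_def)
  moreover have "3 * CG / b * e = 3 * E" "CG / (2 * b) * e = E / 2" by (simp_all add: E_def)
  ultimately have "norm (Zd T u + 2 * I) \<le> 120 * CG * W + 25 * E"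
    using A1 A2' G1 M1 E0 e0 by linarith
  then have "\<bar>Re (Zd T u) + 2 * Re I\<bar> \<le> 120 * CG * W + 25 * E"
    using abs_Re_le_cmod[of "Zd T u + 2 * I"] by simp
  then have "\<bar>Re (Zd T u)\<bar> \<le> 4 * \<bar>Re (integral {0..T} (\<lambda>t. of_real (ReG \<sigma> t) * upow u (Complex \<sigma> t)))\<bar> + 120 * CG * W + 25 * E"
    unfolding ReI by linarith
  then show ?thesis unfolding W_def E_def e_def l_def \<sigma>_def by (simp add: mult_ac)
qed

section \<open>Mean values of the density\<close>

text \<open>The 36 is \<open>(3/2) * 2 * 12\<close>: the width of the strip, its two horizontal
  sides, and the constant bounding the integrand on them in \<open>Aco_Glog_mean\<close>.\<close>

definition K1 :: real where "K1 = 36 * CG * exp 3"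

lemma K1_ge: "K1 \<ge> 1"
proof -
  have "1 * 1 \<le> (36 * CG) * exp (3::real)" using CG_ge by (intro mult_mono) auto
  then show ?thesis by (simp add: K1_def)
qed

lemma integral_one_over:
  fixes T1 T2 :: real
  assumes "0 < T1" "T1 \<le> T2"
  shows "((\<lambda>t. 1 / t) has_integral (ln T2 - ln T1)) {T1..T2}"
proof (rule fundamental_theorem_of_calculus[OF assms(2)])
  fix t assume "t \<in> {T1..T2}"
  then have "(ln has_real_derivative 1 / t) (at t within {T1..T2})" using assms by (auto intro!: derivative_eq_intros)
  then show "(ln has_vector_derivative 1 / t) (at t within {T1..T2})" by (simp add: has_real_derivative_iff_has_vector_derivative)
qed

lemma Aco_Glog_holomorphic:
  assumes RH: riemann_hypothesis
  shows "(\<lambda>s. Aco s - Glog s) holomorphic_on {s. Re s > 1/2}"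
  by (intro holomorphic_intros Glog_holomorphic[OF RH] holomorphic_on_subset[OF Aco_holomorphic]) auto

text \<open>The factor \<open>cis (t * y) / t\<close> extends analytically to \<open>k\<close>, so
  the integral can be moved to \<open>Re s = 2\<close>. There \<open>Aco - Glog\<close> is bounded
  and the decay \<open>1 / t\<close> gives \<open>ln T2\<close>. The horizontal sides give
  \<open>1 / b\<close>, the logarithm of \<open>Glog_bound\<close> being absorbed by
  \<open>1 / t\<close>. The condition on \<open>y\<close> keeps the exponential in \<open>k\<close>
  bounded on the strip.\<close>

lemma Aco_Glog_mean:
  assumes RH: riemann_hypothesis and b: "0 < b" "b \<le> 1/8" and y: "\<bar>y\<bar> \<le> 2" and T: "1 \<le> T1" "T1 \<le> T2"
  shows "norm (integral {T1..T2} (\<lambda>t. (Aco (Complex (1/2 + b) t) - Glog (Complex (1/2 + b) t)) * (cis (t * y) / of_real t))) \<le> K1 * (1 / b + ln T2)"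
proof -
  define \<sigma> where "\<sigma> = 1/2 + b"
  define k where "k s = exp ((s - of_real \<sigma>) * of_real y) * (\<i> / (s - of_real \<sigma>))" for s
  define n where "n s = (Aco s - Glog s) * k s" for s
  let ?S = "{s. Re s > 1/2} \<inter> {s. Im s > 0}"
  have oS: "open ?S" "convex ?S" by (intro open_Int convex_Int open_halfspace_Re_gt open_halfspace_Im_gt convex_halfspace_Re_gt convex_halfspace_Im_gt)+
  have hk: "k holomorphic_on ?S" unfolding k_def
    by (intro holomorphic_intros) (auto simp: complex_eq_iff)
  have hn: "n holomorphic_on ?S" unfolding n_def
    by (intro holomorphic_intros hk holomorphic_on_subset[OF Aco_Glog_holomorphic[OF RH]]) auto
  have kb: "norm (k (Complex a t)) \<le> exp 3 * (1 / t)" if "a \<in> {\<sigma>..2}" "t \<ge> 1" for a t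
  proof -
    have "(a - \<sigma>) * y \<le> \<bar>a - \<sigma>\<bar> * \<bar>y\<bar>" by (metis abs_ge_self abs_mult)
    also have "\<dots> \<le> (3/2) * 2" using that y b by (intro mult_mono) (auto simp: \<sigma>_def)
    finally have e: "norm (exp ((Complex a t - of_real \<sigma>) * of_real y)) \<le> exp 3" by simp
    have "Complex a t - of_real \<sigma> = Complex (a - \<sigma>) t" by (simp add: complex_eq_iff)
    then have "t \<le> norm (Complex a t - of_real \<sigma>)" using norm_Complex_ge(2)[where a = "a - \<sigma>" and t = t] that by simp
    then have "norm (\<i> / (Complex a t - of_real \<sigma>)) \<le> 1 / t" using that by (simp add: norm_divide frac_le)
    then show ?thesis unfolding k_def norm_mult using e that by (intro mult_mono) auto
  qed
  have hz: "norm (n (Complex a t)) \<le> 12 * CG * exp 3 / b" if a: "a \<in> {\<sigma>..2}" and t: "t \<ge> 1" for a t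
  proof -
    have "norm (Aco (Complex a t)) \<le> CG * lt t / b"
    proof -
      have "norm (Aco (Complex a t)) \<le> 6 * lt t" using Aco_bound[of "Complex a t"] a b by (simp add: \<sigma>_def)
      also have "\<dots> \<le> CG * lt t * 1" using CG_ge lt_ge_1[of t] mult_right_mono[of 6 CG "lt t"] by simp
      also have "\<dots> \<le> CG * lt t * (1 / b)"
        using CG_ge lt_ge_1[of t] b by (intro mult_left_mono) (auto simp: pos_le_divide_eq)
      finally show ?thesis by simp
    qed
    moreover have "norm (Glog (Complex a t)) \<le> CG * lt t / b"
    proof -
      have "norm (Glog (Complex a t)) \<le> CG * lt t / (a - 1/2)" using Glog_bound[OF RH, of "Complex a t"] a b by (simp add: \<sigma>_def)
      also have "\<dots> \<le> CG * lt t / b" using a b CG_ge lt_ge_1[of t] by (intro divide_left_mono) (auto simp: \<sigma>_def)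
      finally show ?thesis .
    qed
    ultimately have Z: "norm (Aco (Complex a t) - Glog (Complex a t)) \<le> 2 * CG * lt t / b"
      using norm_triangle_ineq4[of "Aco (Complex a t)" "Glog (Complex a t)"] by simp
    have ll: "lt t \<le> 6 * t" using ln_le_minus_one[of "6 + \<bar>t\<bar>"] t by simp
    have "norm (n (Complex a t)) \<le> (2 * CG * lt t / b) * (exp 3 * (1 / t))"
      unfolding n_def norm_mult using Z kb[OF a t] by (intro mult_mono) (auto intro: order.trans[OF norm_ge_zero])
    also have "\<dots> \<le> (2 * CG * (6 * t) / b) * (exp 3 * (1 / t))"
      using ll CG_ge b t by (intro mult_right_mono divide_right_mono mult_left_mono) auto
    also have "\<dots> = 12 * CG * exp 3 / b" using t by simp
    finally show ?thesis .
  qed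
  have sh: "norm (vint n 2 T1 T2 - vint n \<sigma> T1 T2) \<le> (2 - \<sigma>) * (12 * CG * exp 3 / b + 12 * CG * exp 3 / b)"
    by (rule vint_shift[OF hn oS]) (use b T in \<open>auto simp: \<sigma>_def intro!: hz[unfolded \<sigma>_def]\<close>)
  also have "\<dots> \<le> (3/2) * (12 * CG * exp 3 / b + 12 * CG * exp 3 / b)"
    using b CG_ge by (intro mult_right_mono) (auto simp: \<sigma>_def)
  finally have sh: "norm (vint n 2 T1 T2 - vint n \<sigma> T1 T2) \<le> K1 * (1 / b)" by (simp add: K1_def)
  have l2: "norm (vint n 2 T1 T2) \<le> K1 * ln T2"
  proof -
    have i: "((\<lambda>t. (CG * exp 3) * (1 / t)) has_integral ((CG * exp 3) * (ln T2 - ln T1))) {T1..T2}"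
      by (rule has_integral_mult_right[OF integral_one_over]) (use T in auto)
    have "norm (vint n 2 T1 T2) \<le> integral {T1..T2} (\<lambda>t. (CG * exp 3) * (1 / t))"
      unfolding vint_def
    proof (rule integral_norm_bound_integral)
      show "(\<lambda>t. n (Complex 2 t)) integrable_on {T1..T2}"
        by (rule integrable_continuous_real[OF vline_cont[OF hn]]) (use T in auto)
      show "(\<lambda>t. (CG * exp 3) * (1 / t)) integrable_on {T1..T2}" using i by blast
      fix t assume t: "t \<in> {T1..T2}"
      have "norm (Aco (Complex 2 t) - Glog (Complex 2 t)) \<le> CG"
        using Zline_bound[OF RH, of t] LamC_nonneg by (simp add: CG_def)
      then have "norm (n (Complex 2 t)) \<le> CG * (exp 3 * (1 / t))"
        unfolding n_def norm_mult using kb[of 2 t] t T b CG_ge by (intro mult_mono) (auto simp: \<sigma>_def)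
      then show "norm (n (Complex 2 t)) \<le> (CG * exp 3) * (1 / t)" by simp
    qed
    also have "\<dots> = (CG * exp 3) * (ln T2 - ln T1)" using i by (rule integral_unique)
    also have "\<dots> \<le> K1 * ln T2" unfolding K1_def using T CG_ge by (intro mult_mono) auto
    finally show ?thesis .
  qed
  have "vint n \<sigma> T1 T2 = integral {T1..T2} (\<lambda>t. (Aco (Complex \<sigma> t) - Glog (Complex \<sigma> t)) * (cis (t * y) / of_real t))"
    unfolding vint_def
  proof (rule integral_cong)
    fix t assume "t \<in> {T1..T2}"
    then have t: "t \<noteq> 0" using T by auto
    have "Complex \<sigma> t - of_real \<sigma> = \<i> * of_real t" by (simp add: complex_eq_iff)
    then have "k (Complex \<sigma> t) = cis (t * y) / of_real t" unfolding k_def using t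
      by (simp add: cis_conv_exp mult_ac)
    then show "n (Complex \<sigma> t) = (Aco (Complex \<sigma> t) - Glog (Complex \<sigma> t)) * (cis (t * y) / of_real t)" by (simp add: n_def)
  qed
  moreover have "norm (vint n \<sigma> T1 T2) \<le> K1 * (1 / b + ln T2)"
    using sh l2 norm_triangle_ineq4[of "vint n 2 T1 T2" "vint n 2 T1 T2 - vint n \<sigma> T1 T2"] by (simp add: distrib_left)
  ultimately show ?thesis by (simp add: \<sigma>_def)
qed

text \<open>Averaging \<open>Aco_Glog_mean\<close> over \<open>y\<close> and \<open>- y\<close>
  replaces \<open>cis\<close> by the real factor \<open>cos\<close>, after which the real part can
  be taken inside the integral.\<close>

lemma ReZ_mean:
  assumes RH: riemann_hypothesis and b: "0 < b" "b \<le> 1/8" and y: "\<bar>y\<bar> \<le> 2" and T: "1 \<le> T1" "T1 \<le> T2"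
  shows "\<bar>integral {T1..T2} (\<lambda>t. Re (Aco (Complex (1/2 + b) t) - Glog (Complex (1/2 + b) t)) * cos (t * y) / t)\<bar> \<le> K1 * (1 / b + ln T2)"
proof -
  let ?Z = "\<lambda>t. Aco (Complex (1/2 + b) t) - Glog (Complex (1/2 + b) t)"
  have cZ: "continuous_on {T1..T2} ?Z" by (rule vline_cont[OF Aco_Glog_holomorphic[OF RH]]) (use b in auto)
  have int: "(\<lambda>t. ?Z t * (cis (t * x) / of_real t)) integrable_on {T1..T2}" for x
    by (intro integrable_continuous_real continuous_intros cZ) (use T in auto)
  have "integral {T1..T2} (\<lambda>t. Re (?Z t) * cos (t * y) / t) = integral {T1..T2} (\<lambda>t. Re ((1/2) * (?Z t * (cis (t * y) / of_real t) + ?Z t * (cis (t * (-y)) / of_real t))))"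
  proof (rule integral_cong)
    fix t
    have "cis (t * y) + cis (t * (-y)) = of_real (2 * cos (t * y))" by (simp add: complex_eq_iff)
    then have "(1/2) * (Z * (cis (t * y) / of_real t) + Z * (cis (t * (-y)) / of_real t)) = Z * of_real (cos (t * y) / t)" for Z
      by (simp only: distrib_left[symmetric] add_divide_distrib[symmetric]) simp
    then show "Re (?Z t) * cos (t * y) / t = Re ((1/2) * (?Z t * (cis (t * y) / of_real t) + ?Z t * (cis (t * (-y)) / of_real t)))"
      by (simp only:) simp
  qed
  also have "\<dots> = Re (integral {T1..T2} (\<lambda>t. (1/2) * (?Z t * (cis (t * y) / of_real t) + ?Z t * (cis (t * (-y)) / of_real t))))"
    using integral_linear[OF _ bounded_linear_Re, of "\<lambda>t. (1/2) * (?Z t * (cis (t * y) / of_real t) + ?Z t * (cis (t * (-y)) / of_real t))" "{T1..T2}"]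
      int[of y] int[of "-y"] by (simp only: o_def integrable_add integrable_on_mult_right)
  also have "\<dots> = Re ((1/2) * (integral {T1..T2} (\<lambda>t. ?Z t * (cis (t * y) / of_real t)) + integral {T1..T2} (\<lambda>t. ?Z t * (cis (t * (-y)) / of_real t))))"
    by (simp only: integral_mult_right integral_add[OF int[of y] int[of "-y"]])
  finally have eq: "integral {T1..T2} (\<lambda>t. Re (?Z t) * cos (t * y) / t) = Re ((1/2) * (integral {T1..T2} (\<lambda>t. ?Z t * (cis (t * y) / of_real t)) + integral {T1..T2} (\<lambda>t. ?Z t * (cis (t * (-y)) / of_real t))))" .
  have "\<bar>Re ((1/2) * (A + B))\<bar> \<le> M" if "norm A \<le> M" "norm B \<le> M" for A B :: complex and M
  proof -
    have "\<bar>Re A\<bar> \<le> M" "\<bar>Re B\<bar> \<le> M" using that abs_Re_le_cmod[of A] abs_Re_le_cmod[of B] by linarith+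
    moreover have e: "Re ((1/2) * (A + B)) = Re A / 2 + Re B / 2" by (simp add: add_divide_distrib)
    ultimately show ?thesis unfolding e by linarith
  qed
  then show ?thesis unfolding eq using Aco_Glog_mean[OF RH b y T] Aco_Glog_mean[OF RH b _ T, of "-y"] y by simp
qed

lemma ReZ_ReG: "Re (Aco (Complex \<sigma> t) - Glog (Complex \<sigma> t)) = Re (Aco (Complex \<sigma> t)) - ReG \<sigma> t"
  by (simp add: ReG_def)

lemma ReA_cont: "\<sigma> \<ge> 0 \<Longrightarrow> continuous_on A (\<lambda>t. Re (Aco (Complex \<sigma> t)))"
  by (intro continuous_intros continuous_on_compose2[OF holomorphic_on_imp_continuous_on[OF Aco_holomorphic]])
     (auto intro!: continuous_intros)

lemma ReG_split:
  assumes RH: riemann_hypothesis and b: "0 < b" "b \<le> 1/8" and T: "1 \<le> T1" "T1 \<le> T2"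
  shows "integral {T1..T2} (\<lambda>t. ReG (1/2 + b) t * cos (t * y) / t) =
    integral {T1..T2} (\<lambda>t. Re (Aco (Complex (1/2 + b) t)) * cos (t * y) / t) -
    integral {T1..T2} (\<lambda>t. Re (Aco (Complex (1/2 + b) t) - Glog (Complex (1/2 + b) t)) * cos (t * y) / t)"
proof -
  have c1: "continuous_on {T1..T2} (\<lambda>t. Re (Aco (Complex (1/2 + b) t)) * cos (t * y) / t)"
    by (intro continuous_intros ReA_cont) (use T b in auto)
  have c2: "continuous_on {T1..T2} (\<lambda>t. ReG (1/2 + b) t * cos (t * y) / t)"
    by (intro continuous_intros ReG_cont[OF RH]) (use T b in auto)
  have "integral {T1..T2} (\<lambda>t. Re (Aco (Complex (1/2 + b) t) - Glog (Complex (1/2 + b) t)) * cos (t * y) / t) =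
    integral {T1..T2} (\<lambda>t. Re (Aco (Complex (1/2 + b) t)) * cos (t * y) / t - ReG (1/2 + b) t * cos (t * y) / t)"
    unfolding ReZ_ReG by (simp add: left_diff_distrib diff_divide_distrib)
  also have "\<dots> = integral {T1..T2} (\<lambda>t. Re (Aco (Complex (1/2 + b) t)) * cos (t * y) / t) - integral {T1..T2} (\<lambda>t. ReG (1/2 + b) t * cos (t * y) / t)"
    by (rule integral_diff; rule integrable_continuous_real) (rule c1 c2)+
  finally show ?thesis by simp
qed

text \<open>The main term is the integral of \<open>ln t / (2 * t)\<close>; its constant 1/4 is what
  fixes the exponent \<open>sqrt (2 * pi * \<epsilon>)\<close>. As only an upper bound is wanted,
  the negative contribution of \<open>ln (2 * pi)\<close> is dropped.\<close>

lemma ReG_diag: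
  assumes RH: riemann_hypothesis and b: "0 < b" "b \<le> 1/8" and T: "1 \<le> T"
  shows "integral {1..T} (\<lambda>t. ReG (1/2 + b) t / t) \<le> (ln T)\<^sup>2 / 4 + 8 + K1 * (1 / b + ln T)"
proof -
  define F where "F t = (ln t)\<^sup>2 / 4 - 8 / t" for t :: real
  have i: "((\<lambda>t. ln t / (2 * t) + 8 / t\<^sup>2) has_integral (F T - F 1)) {1..T}"
  proof (rule fundamental_theorem_of_calculus[OF T])
    fix t assume t: "t \<in> {1..T}"
    have "(F has_real_derivative ln t / (2 * t) + 8 / t\<^sup>2) (at t within {1..T})"
      unfolding F_def using t by (auto intro!: derivative_eq_intros simp: power2_eq_square)
    then show "(F has_vector_derivative ln t / (2 * t) + 8 / t\<^sup>2) (at t within {1..T})"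
      by (simp add: has_real_derivative_iff_has_vector_derivative)
  qed
  have A: "integral {1..T} (\<lambda>t. Re (Aco (Complex (1/2 + b) t)) / t) \<le> (ln T)\<^sup>2 / 4 + 8"
  proof -
    have "integral {1..T} (\<lambda>t. Re (Aco (Complex (1/2 + b) t)) / t) \<le> integral {1..T} (\<lambda>t. ln t / (2 * t) + 8 / t\<^sup>2)"
    proof (rule integral_le)
      show "(\<lambda>t. Re (Aco (Complex (1/2 + b) t)) / t) integrable_on {1..T}"
        by (intro integrable_continuous_real continuous_intros ReA_cont) (use b in auto)
      show "(\<lambda>t. ln t / (2 * t) + 8 / t\<^sup>2) integrable_on {1..T}" using i by blast
      fix t assume t: "t \<in> {1..T}"
      have "\<bar>Re (Aco (Complex (1/2 + b) t)) - (ln t - ln (2 * pi)) / 2\<bar> \<le> 8 / t"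
        by (rule Re_Aco) (use b t in auto)
      moreover have "0 \<le> ln (2 * pi)" using pi_gt3 by simp
      moreover have "A \<le> l / 2 + e" if "\<bar>A - (l - c) / 2\<bar> \<le> e" "0 \<le> c" for A l c e :: real using that unfolding diff_divide_distrib by linarith
      ultimately have "Re (Aco (Complex (1/2 + b) t)) \<le> ln t / 2 + 8 / t" by blast
      then have "Re (Aco (Complex (1/2 + b) t)) / t \<le> (ln t / 2 + 8 / t) / t" using t by (intro divide_right_mono) auto
      also have "\<dots> = ln t / (2 * t) + 8 / t\<^sup>2" by (simp add: add_divide_distrib power2_eq_square)
      finally show "Re (Aco (Complex (1/2 + b) t)) / t \<le> ln t / (2 * t) + 8 / t\<^sup>2" .
    qed
    also have "\<dots> = F T - F 1" using i by (rule integral_unique)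
    also have "\<dots> \<le> (ln T)\<^sup>2 / 4 + 8" using T by (simp add: F_def)
    finally show ?thesis .
  qed
  have "\<bar>integral {1..T} (\<lambda>t. Re (Aco (Complex (1/2 + b) t) - Glog (Complex (1/2 + b) t)) * cos (t * 0) / t)\<bar> \<le> K1 * (1 / b + ln T)"
    by (rule ReZ_mean[OF RH b]) (use T in auto)
  moreover have "integral {1..T} (\<lambda>t. ReG (1/2 + b) t * cos (t * 0) / t) =
    integral {1..T} (\<lambda>t. Re (Aco (Complex (1/2 + b) t)) * cos (t * 0) / t) -
    integral {1..T} (\<lambda>t. Re (Aco (Complex (1/2 + b) t) - Glog (Complex (1/2 + b) t)) * cos (t * 0) / t)"
    by (rule ReG_split[OF RH b]) (use T in auto)
  ultimately show ?thesis using A by simp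
qed

text \<open>Integration by parts: the total variation of a decreasing nonnegative amplitude is at
  most its initial value.\<close>

lemma integral_decreasing_cos:
  fixes \<phi> \<phi>' :: "real \<Rightarrow> real"
  assumes ab: "a \<le> b" and d: "\<And>t. t \<in> {a..b} \<Longrightarrow> (\<phi> has_real_derivative \<phi>' t) (at t within {a..b})"
    and c: "continuous_on {a..b} \<phi>'" and neg: "\<And>t. t \<in> {a..b} \<Longrightarrow> \<phi>' t \<le> 0"
    and pos: "\<phi> b \<ge> 0" and y: "y \<noteq> 0"
  shows "\<bar>integral {a..b} (\<lambda>t. \<phi> t * cos (t * y))\<bar> \<le> 2 * \<phi> a / \<bar>y\<bar>"
proof -
  define H where "H t = \<phi> t * (sin (t * y) / y)" for t
  have c\<phi>: "continuous_on {a..b} \<phi>" using d by (intro DERIV_continuous_on)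
  have iH: "((\<lambda>t. \<phi>' t * (sin (t * y) / y) + \<phi> t * cos (t * y)) has_integral (H b - H a)) {a..b}"
  proof (rule fundamental_theorem_of_calculus[OF ab])
    fix t assume t: "t \<in> {a..b}"
    have "((\<lambda>t. sin (t * y) / y) has_real_derivative cos (t * y)) (at t within {a..b})"
      using y by (auto intro!: derivative_eq_intros)
    then have "(H has_real_derivative \<phi>' t * (sin (t * y) / y) + cos (t * y) * \<phi> t) (at t within {a..b})"
      unfolding H_def by (intro DERIV_mult d t)
    then show "(H has_vector_derivative \<phi>' t * (sin (t * y) / y) + \<phi> t * cos (t * y)) (at t within {a..b})"
      by (simp add: has_real_derivative_iff_has_vector_derivative mult.commute)
  qed
  have i1: "(\<lambda>t. \<phi>' t * (sin (t * y) / y)) integrable_on {a..b}"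
    by (intro integrable_continuous_real continuous_intros c) (use y in auto)
  have i2: "(\<lambda>t. \<phi> t * cos (t * y)) integrable_on {a..b}"
    by (intro integrable_continuous_real continuous_intros c\<phi>)
  have e: "integral {a..b} (\<lambda>t. \<phi> t * cos (t * y)) = H b - H a - integral {a..b} (\<lambda>t. \<phi>' t * (sin (t * y) / y))"
    using integral_unique[OF iH] integral_add[OF i1 i2] by simp
  have i3: "((\<lambda>t. - \<phi>' t / \<bar>y\<bar>) has_integral (- \<phi> b / \<bar>y\<bar> - - \<phi> a / \<bar>y\<bar>)) {a..b}"
  proof (rule fundamental_theorem_of_calculus[OF ab])
    fix t assume t: "t \<in> {a..b}"
    have "((\<lambda>t. - \<phi> t / \<bar>y\<bar>) has_real_derivative - \<phi>' t / \<bar>y\<bar>) (at t within {a..b})"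
      by (intro DERIV_cdivide DERIV_minus d t)
    then show "((\<lambda>t. - \<phi> t / \<bar>y\<bar>) has_vector_derivative - \<phi>' t / \<bar>y\<bar>) (at t within {a..b})"
      by (simp add: has_real_derivative_iff_has_vector_derivative)
  qed
  have "norm (integral {a..b} (\<lambda>t. \<phi>' t * (sin (t * y) / y))) \<le> integral {a..b} (\<lambda>t. - \<phi>' t / \<bar>y\<bar>)"
  proof (rule integral_norm_bound_integral[OF i1])
    show "(\<lambda>t. - \<phi>' t / \<bar>y\<bar>) integrable_on {a..b}" using i3 by blast
    fix t assume t: "t \<in> {a..b}"
    have "norm (\<phi>' t * (sin (t * y) / y)) = \<bar>\<phi>' t\<bar> * (\<bar>sin (t * y)\<bar> / \<bar>y\<bar>)" by (simp add: abs_mult)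
    also have "\<dots> \<le> \<bar>\<phi>' t\<bar> * (1 / \<bar>y\<bar>)" by (intro mult_left_mono divide_right_mono) auto
    also have "\<dots> = - \<phi>' t / \<bar>y\<bar>" using neg[OF t] by simp
    finally show "norm (\<phi>' t * (sin (t * y) / y)) \<le> - \<phi>' t / \<bar>y\<bar>" .
  qed
  also have "\<dots> = \<phi> a / \<bar>y\<bar> - \<phi> b / \<bar>y\<bar>" unfolding integral_unique[OF i3] by simp
  finally have I: "\<bar>integral {a..b} (\<lambda>t. \<phi>' t * (sin (t * y) / y))\<bar> \<le> \<phi> a / \<bar>y\<bar> - \<phi> b / \<bar>y\<bar>" by simp
  have "0 \<le> \<phi> a / \<bar>y\<bar> - \<phi> b / \<bar>y\<bar>" using I by linarith
  then have "\<phi> b / \<bar>y\<bar> \<le> \<phi> a / \<bar>y\<bar>" by simp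
  then have pa: "0 \<le> \<phi> a" using pos y by (simp add: divide_le_cancel)
  have Hb: "\<bar>H t\<bar> \<le> \<phi> t / \<bar>y\<bar>" if "\<phi> t \<ge> 0" for t
  proof -
    have "\<bar>H t\<bar> = \<phi> t * (\<bar>sin (t * y)\<bar> / \<bar>y\<bar>)" using that by (simp add: H_def abs_mult)
    also have "\<dots> \<le> \<phi> t * (1 / \<bar>y\<bar>)" using that by (intro mult_left_mono divide_right_mono) auto
    finally show ?thesis by simp
  qed
  have "2 * \<phi> a / \<bar>y\<bar> = \<phi> a / \<bar>y\<bar> + \<phi> a / \<bar>y\<bar>" by simp
  then show ?thesis unfolding e using I Hb[OF pos] Hb[OF pa] by linarith
qed

text \<open>Once \<open>T1 * \<bar>y\<bar> \<ge> 1\<close>, the cosine oscillates enough to reduce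
  the main part \<open>ln t / (2 * t)\<close> to one logarithm, against two on the diagonal; this is
  the almost orthogonality. The bound \<open>3 \<le> T1\<close> lies beyond \<open>exp 1\<close>,
  from where on \<open>ln t / t\<close> decreases.\<close>

lemma ReG_off:
  assumes RH: riemann_hypothesis and b: "0 < b" "b \<le> 1/8" and T: "3 \<le> T1" "T1 \<le> T2"
    and y: "\<bar>y\<bar> \<le> 2" "1 \<le> T1 * \<bar>y\<bar>"
  shows "\<bar>integral {T1..T2} (\<lambda>t. ReG (1/2 + b) t * cos (t * y) / t)\<bar> \<le> ln T2 + 10 + K1 * (1 / b + ln T2)"
proof -
  have y0: "y \<noteq> 0" using y by auto
  have T0: "T1 > 0" using T by simp
  have yT: "1 / (T1 * \<bar>y\<bar>) \<le> 1" using y by (simp add: divide_le_eq)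
  have I1: "\<bar>integral {T1..T2} (\<lambda>t. ln t / t * cos (t * y))\<bar> \<le> 2 * ln T2"
  proof -
    have "\<bar>integral {T1..T2} (\<lambda>t. (ln t / t) * cos (t * y))\<bar> \<le> 2 * (ln T1 / T1) / \<bar>y\<bar>"
    proof (rule integral_decreasing_cos[where \<phi>' = "\<lambda>t. (1 - ln t) / t\<^sup>2"])
      show "((\<lambda>t. ln t / t) has_real_derivative (1 - ln t) / t\<^sup>2) (at t within {T1..T2})" if "t \<in> {T1..T2}" for t
        using that T by (auto intro!: derivative_eq_intros simp: power2_eq_square)
      show "continuous_on {T1..T2} (\<lambda>t. (1 - ln t) / t\<^sup>2)" by (intro continuous_intros) (use T in auto)
      show "(1 - ln t) / t\<^sup>2 \<le> 0" if "t \<in> {T1..T2}" for t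
      proof -
        have "exp 1 \<le> t" using that T exp_le by simp
        then have "1 \<le> ln t" by (metis exp_gt_zero ln_exp ln_le_cancel_iff order_less_le_trans)
        then show ?thesis by (simp add: divide_nonpos_nonneg)
      qed
    qed (use T y0 in auto)
    also have "\<dots> = 2 * ln T1 * (1 / (T1 * \<bar>y\<bar>))" by simp
    also have "\<dots> \<le> 2 * ln T1 * 1" using yT T by (intro mult_left_mono) auto
    also have "\<dots> \<le> 2 * ln T2" using T by simp
    finally show ?thesis .
  qed
  have I2: "\<bar>integral {T1..T2} (\<lambda>t. 1 / t * cos (t * y))\<bar> \<le> 2"
  proof -
    have "\<bar>integral {T1..T2} (\<lambda>t. (1 / t) * cos (t * y))\<bar> \<le> 2 * (1 / T1) / \<bar>y\<bar>"
    proof (rule integral_decreasing_cos[where \<phi>' = "\<lambda>t. - 1 / t\<^sup>2"])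
      show "((\<lambda>t. 1 / t) has_real_derivative - 1 / t\<^sup>2) (at t within {T1..T2})" if "t \<in> {T1..T2}" for t
        using that T by (auto intro!: derivative_eq_intros simp: power2_eq_square)
      show "continuous_on {T1..T2} (\<lambda>t. - 1 / t\<^sup>2)" by (intro continuous_intros) (use T in auto)
    qed (use T y0 in auto)
    also have "\<dots> = 2 * (1 / (T1 * \<bar>y\<bar>))" by simp
    finally show ?thesis using yT by linarith
  qed
  define R where "R t = Re (Aco (Complex (1/2 + b) t)) - (ln t - ln (2 * pi)) / 2" for t
  have Rb: "\<bar>R t\<bar> \<le> 8 / t" if "t \<in> {T1..T2}" for t
    unfolding R_def by (rule Re_Aco) (use b T that in auto)
  have cR: "continuous_on {T1..T2} R" unfolding R_def
    by (intro continuous_intros ReA_cont) (use b T in auto)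
  have I3: "\<bar>integral {T1..T2} (\<lambda>t. R t * cos (t * y) / t)\<bar> \<le> 8"
  proof -
    have i: "((\<lambda>t. 8 / t\<^sup>2) has_integral (- 8 / T2 - - 8 / T1)) {T1..T2}"
    proof (rule fundamental_theorem_of_calculus[OF T(2)])
      fix t assume t: "t \<in> {T1..T2}"
      have "((\<lambda>t. - 8 / t) has_real_derivative 8 / t\<^sup>2) (at t within {T1..T2})"
        using t T by (auto intro!: derivative_eq_intros simp: power2_eq_square)
      then show "((\<lambda>t. - 8 / t) has_vector_derivative 8 / t\<^sup>2) (at t within {T1..T2})"
        by (simp add: has_real_derivative_iff_has_vector_derivative)
    qed
    have "norm (integral {T1..T2} (\<lambda>t. R t * cos (t * y) / t)) \<le> integral {T1..T2} (\<lambda>t. 8 / t\<^sup>2)"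
    proof (rule integral_norm_bound_integral)
      show "(\<lambda>t. R t * cos (t * y) / t) integrable_on {T1..T2}"
        by (intro integrable_continuous_real continuous_intros cR) (use T in auto)
      show "(\<lambda>t. 8 / t\<^sup>2) integrable_on {T1..T2}" using i by blast
      fix t assume t: "t \<in> {T1..T2}"
      have t0: "t > 0" using t T by auto
      have "norm (R t * cos (t * y) / t) = \<bar>R t\<bar> * \<bar>cos (t * y)\<bar> / t" using t0 by (simp add: abs_mult)
      also have "\<dots> \<le> (8 / t) * 1 / t" using Rb[OF t] t0 by (intro divide_right_mono mult_mono) auto
      finally show "norm (R t * cos (t * y) / t) \<le> 8 / t\<^sup>2" by (simp add: power2_eq_square)
    qed
    also have "\<dots> = 8 / T1 - 8 / T2" unfolding integral_unique[OF i] by simp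
    also have "\<dots> \<le> 8"
    proof -
      have "8 / T1 \<le> 8" "0 \<le> 8 / T2" using T by (auto simp: divide_le_eq)
      then show ?thesis by linarith
    qed
    finally show ?thesis by simp
  qed
  have j1: "(\<lambda>t. ln t / t * cos (t * y)) integrable_on {T1..T2}" "(\<lambda>t. 1 / t * cos (t * y)) integrable_on {T1..T2}"
    "(\<lambda>t. R t * cos (t * y) / t) integrable_on {T1..T2}"
    by (intro integrable_continuous_real continuous_intros cR; use T in auto)+
  have "integral {T1..T2} (\<lambda>t. Re (Aco (Complex (1/2 + b) t)) * cos (t * y) / t) =
    integral {T1..T2} (\<lambda>t. ((1/2) * (ln t / t * cos (t * y)) - (ln (2 * pi) / 2) * (1 / t * cos (t * y))) + R t * cos (t * y) / t)"
  proof (rule integral_cong)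
    fix t
    have "A * k / t = ((1/2) * (l / t * k) - (c / 2) * (1 / t * k)) + (A - (l - c) / 2) * k / t" for A k l c :: real
      by (simp add: add_divide_distrib diff_divide_distrib algebra_simps)
    then show "Re (Aco (Complex (1/2 + b) t)) * cos (t * y) / t =
      ((1/2) * (ln t / t * cos (t * y)) - (ln (2 * pi) / 2) * (1 / t * cos (t * y))) + R t * cos (t * y) / t"
      unfolding R_def .
  qed
  also have "\<dots> = integral {T1..T2} (\<lambda>t. (1/2) * (ln t / t * cos (t * y)) - (ln (2 * pi) / 2) * (1 / t * cos (t * y))) + integral {T1..T2} (\<lambda>t. R t * cos (t * y) / t)"
    by (intro integral_add integrable_diff integrable_on_mult_right j1)
  also have "integral {T1..T2} (\<lambda>t. (1/2) * (ln t / t * cos (t * y)) - (ln (2 * pi) / 2) * (1 / t * cos (t * y))) =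
     integral {T1..T2} (\<lambda>t. (1/2) * (ln t / t * cos (t * y))) - integral {T1..T2} (\<lambda>t. (ln (2 * pi) / 2) * (1 / t * cos (t * y)))"
    by (intro integral_diff integrable_on_mult_right j1)
  finally have A: "integral {T1..T2} (\<lambda>t. Re (Aco (Complex (1/2 + b) t)) * cos (t * y) / t) =
     (1/2) * integral {T1..T2} (\<lambda>t. ln t / t * cos (t * y)) - (ln (2 * pi) / 2) * integral {T1..T2} (\<lambda>t. 1 / t * cos (t * y)) + integral {T1..T2} (\<lambda>t. R t * cos (t * y) / t)"
    unfolding integral_mult_right .
  have lp: "0 \<le> ln (2 * pi)" "ln (2 * pi) \<le> 2"
  proof -
    show "0 \<le> ln (2 * pi)" using pi_gt3 by simp
    have "(2.5::real) \<le> exp 1" using e_approx_32 by (simp add: abs_if split: if_splits)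
    then have "2.5 * 2.5 \<le> exp 1 * (exp 1::real)" by (intro mult_mono) auto
    also have "\<dots> = exp 2" by (simp flip: exp_add)
    finally have "2 * pi \<le> exp 2 + 0.15" using pi_approx by simp
    moreover have "(2.7::real) \<le> exp 1" using e_approx_32 by (simp add: abs_if split: if_splits)
    then have "2.7 * 2.7 \<le> exp 1 * (exp 1::real)" by (intro mult_mono) auto
    then have "7.29 \<le> exp (2::real)" by (simp flip: exp_add)
    ultimately have "2 * pi \<le> exp 2" using pi_approx by simp
    then have "ln (2 * pi) \<le> ln (exp 2)" by (subst ln_le_cancel_iff) auto
    then show "ln (2 * pi) \<le> 2" by simp
  qed
  have "\<bar>(ln (2 * pi) / 2) * integral {T1..T2} (\<lambda>t. 1 / t * cos (t * y))\<bar> \<le> 1 * 2"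
    unfolding abs_mult using lp I2 by (intro mult_mono) auto
  then have A': "\<bar>integral {T1..T2} (\<lambda>t. Re (Aco (Complex (1/2 + b) t)) * cos (t * y) / t)\<bar> \<le> ln T2 + 10"
    unfolding A using I1 I3 by linarith
  have "\<bar>integral {T1..T2} (\<lambda>t. Re (Aco (Complex (1/2 + b) t) - Glog (Complex (1/2 + b) t)) * cos (t * y) / t)\<bar> \<le> K1 * (1 / b + ln T2)"
    by (rule ReZ_mean[OF RH b y(1)]) (use T in auto)
  moreover have "integral {T1..T2} (\<lambda>t. ReG (1/2 + b) t * cos (t * y) / t) =
    integral {T1..T2} (\<lambda>t. Re (Aco (Complex (1/2 + b) t)) * cos (t * y) / t) -
    integral {T1..T2} (\<lambda>t. Re (Aco (Complex (1/2 + b) t) - Glog (Complex (1/2 + b) t)) * cos (t * y) / t)"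
    by (rule ReG_split[OF RH b]) (use T in auto)
  ultimately show ?thesis using A' by linarith
qed

section \<open>Large values\<close>

lemma norm_sum_cis_sq:
  fixes a :: "'i \<Rightarrow> real"
  shows "(norm (\<Sum>i\<in>F. of_real (a i) * cis (\<theta> i)))\<^sup>2 = (\<Sum>i\<in>F. \<Sum>j\<in>F. a i * a j * cos (\<theta> i - \<theta> j))"
proof -
  have "(norm (\<Sum>i\<in>F. of_real (a i) * cis (\<theta> i)))\<^sup>2 = (\<Sum>i\<in>F. a i * cos (\<theta> i))\<^sup>2 + (\<Sum>i\<in>F. a i * sin (\<theta> i))\<^sup>2"
    unfolding cmod_power2 by simp
  also have "\<dots> = (\<Sum>i\<in>F. \<Sum>j\<in>F. (a i * cos (\<theta> i)) * (a j * cos (\<theta> j)) + (a i * sin (\<theta> i)) * (a j * sin (\<theta> j)))"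
    unfolding power2_eq_square sum_product sum.distrib ..
  also have "\<dots> = (\<Sum>i\<in>F. \<Sum>j\<in>F. a i * a j * cos (\<theta> i - \<theta> j))"
    by (intro sum.cong refl) (simp add: cos_diff algebra_simps)
  finally show ?thesis .
qed

text \<open>Duality: with suitable signs the sum of the real parts is one integral of the
  exponential sum \<open>D\<close> against the density. Cauchy-Schwarz bounds it by the mass of the
  density and the quadratic form \<open>Q\<close>, in which each point contributes \<open>P\<close>
  and each pair of distinct points contributes \<open>Off\<close>.\<close>

lemma large_values:
  fixes u :: "'i \<Rightarrow> real"
  assumes RH: riemann_hypothesis and b: "0 < b" and T: "1 \<le> T1" "T1 \<le> T2" and F: "finite F" "F \<noteq> {}"
    and u: "\<And>i. i \<in> F \<Longrightarrow> u i > 0" "\<And>i. i \<in> F \<Longrightarrow> u i powr (1/2 + b) \<le> M"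
    and big: "\<And>i. i \<in> F \<Longrightarrow> B0 \<le> \<bar>Re (integral {T1..T2} (\<lambda>t. of_real (ReG (1/2 + b) t) * upow (u i) (Complex (1/2 + b) t)))\<bar>"
    and B0: "B0 > 0" and P: "P > 0" "integral {T1..T2} (\<lambda>t. ReG (1/2 + b) t / t) \<le> P"
    and O: "Off \<ge> 0" "\<And>i j. i \<in> F \<Longrightarrow> j \<in> F \<Longrightarrow> i \<noteq> j \<Longrightarrow>
      \<bar>integral {T1..T2} (\<lambda>t. ReG (1/2 + b) t * cos (t * (ln (u i) - ln (u j))) / t)\<bar> \<le> Off"
  shows "real (card F) * B0\<^sup>2 \<le> P * M\<^sup>2 * (P + real (card F) * Off)"
proof -
  define \<sigma> where "\<sigma> = 1/2 + b"
  have \<sigma>: "\<sigma> > 1/2" using b by (simp add: \<sigma>_def)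
  define I where "I i = integral {T1..T2} (\<lambda>t. of_real (ReG \<sigma> t) * upow (u i) (Complex \<sigma> t))" for i
  define e where "e i = sgn (Re (I i))" for i
  have e: "\<bar>e i\<bar> \<le> 1" "e i * Re (I i) = \<bar>Re (I i)\<bar>" for i by (auto simp: e_def sgn_if)
  define a where "a i = e i * u i powr \<sigma>" for i
  define R where "R = real (card F)"
  have R: "R > 0" using F by (simp add: R_def card_gt_0_iff)
  have M: "M > 0" using F u by (metis all_not_in_conv less_le_trans powr_gt_zero less_irrefl)
  have aM: "\<bar>a i\<bar> \<le> M" if "i \<in> F" for i
  proof -
    have "\<bar>e i\<bar> * (u i powr \<sigma>) \<le> 1 * M" using e(1)[of i] u(2)[OF that] by (intro mult_mono) (auto simp: \<sigma>_def)
    then show ?thesis by (simp add: a_def abs_mult)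
  qed
  define D where "D t = (\<Sum>i\<in>F. of_real (a i) * cis (t * ln (u i)))" for t
  have cD: "continuous_on A D" for A unfolding D_def by (intro continuous_intros)
  have cG: "continuous_on A (ReG \<sigma>)" for A by (rule ReG_cont[OF RH \<sigma>])
  have cu: "continuous_on A (\<lambda>t. upow (u i) (Complex \<sigma> t))" if "i \<in> F" for A i
    by (rule upow_cont) (use u(1)[OF that] \<sigma> in auto)
  have g0: "ReG \<sigma> t \<ge> 0" for t by (rule ReG_nonneg[OF RH \<sigma>])
  define J where "J y = integral {T1..T2} (\<lambda>t. ReG \<sigma> t * cos (t * y) / t)" for y
  have J0: "\<bar>J 0\<bar> \<le> P"
  proof -
    have "J 0 \<ge> 0" unfolding J_def
      by (rule integral_nonneg) (use g0 T in \<open>auto intro!: integrable_continuous_real continuous_intros cG\<close>)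
    then show ?thesis using P(2) by (simp add: J_def \<sigma>_def)
  qed
  define Q where "Q = integral {T1..T2} (\<lambda>t. ReG \<sigma> t / t * (norm (D t))\<^sup>2)"
  have Q: "Q \<le> M\<^sup>2 * (R * P + R\<^sup>2 * Off)"
  proof -
    have "Q = integral {T1..T2} (\<lambda>t. \<Sum>i\<in>F. \<Sum>j\<in>F. (a i * a j) * (ReG \<sigma> t * cos (t * (ln (u i) - ln (u j))) / t))"
      unfolding Q_def D_def norm_sum_cis_sq sum_distrib_left
      by (intro integral_cong sum.cong refl) (simp add: algebra_simps)
    also have "\<dots> = (\<Sum>i\<in>F. integral {T1..T2} (\<lambda>t. \<Sum>j\<in>F. (a i * a j) * (ReG \<sigma> t * cos (t * (ln (u i) - ln (u j))) / t)))"
      by (rule integral_sum[OF F(1)]) (intro integrable_continuous_real continuous_intros cG; use T in auto)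
    also have "\<dots> = (\<Sum>i\<in>F. \<Sum>j\<in>F. integral {T1..T2} (\<lambda>t. (a i * a j) * (ReG \<sigma> t * cos (t * (ln (u i) - ln (u j))) / t)))"
      by (intro sum.cong refl integral_sum[OF F(1)]) (intro integrable_continuous_real continuous_intros cG; use T in auto)
    also have "\<dots> = (\<Sum>i\<in>F. \<Sum>j\<in>F. (a i * a j) * J (ln (u i) - ln (u j)))"
      unfolding integral_mult_right J_def ..
    also have "\<dots> \<le> (\<Sum>i\<in>F. \<Sum>j\<in>F. M\<^sup>2 * ((if i = j then P else 0) + Off))"
    proof (intro sum_mono)
      fix i j assume ij: "i \<in> F" "j \<in> F"
      have "(a i * a j) * J (ln (u i) - ln (u j)) \<le> \<bar>a i\<bar> * \<bar>a j\<bar> * \<bar>J (ln (u i) - ln (u j))\<bar>"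
        by (metis abs_ge_self abs_mult)
      also have "\<dots> \<le> M * M * ((if i = j then P else 0) + Off)"
      proof (intro mult_mono aM ij)
        show "\<bar>J (ln (u i) - ln (u j))\<bar> \<le> (if i = j then P else 0) + Off"
          using J0 O(1) O(2)[OF ij] by (auto simp: J_def \<sigma>_def)
      qed (use M in auto)
      finally show "(a i * a j) * J (ln (u i) - ln (u j)) \<le> M\<^sup>2 * ((if i = j then P else 0) + Off)" by (simp add: power2_eq_square)
    qed
    also have "\<dots> = M\<^sup>2 * (R * P + R\<^sup>2 * Off)"
      using F(1) by (simp add: sum_distrib_left[symmetric] sum.distrib R_def power2_eq_square algebra_simps)
    finally show ?thesis .
  qed
  \<comment> \<open>Cauchy-Schwarz is carried out as a weighted inequality of arithmetic and
    geometric means. With this weight the first summand is half of the left-hand side and can be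
    absorbed.\<close>
  define lam where "lam = R * B0 / P"
  have lam: "lam > 0" using R B0 P by (simp add: lam_def)
  have "R * B0 \<le> (\<Sum>i\<in>F. \<bar>Re (I i)\<bar>)"
    using sum_mono[of F "\<lambda>_. B0" "\<lambda>i. \<bar>Re (I i)\<bar>"] big by (simp add: R_def I_def \<sigma>_def)
  also have "\<dots> = Re (\<Sum>i\<in>F. of_real (e i) * I i)" by (simp add: e(2))
  also have "(\<Sum>i\<in>F. of_real (e i) * I i) = integral {T1..T2} (\<lambda>t. \<Sum>i\<in>F. of_real (e i) * (of_real (ReG \<sigma> t) * upow (u i) (Complex \<sigma> t)))"
  proof -
    have "integral {T1..T2} (\<lambda>t. \<Sum>i\<in>F. of_real (e i) * (of_real (ReG \<sigma> t) * upow (u i) (Complex \<sigma> t))) =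
      (\<Sum>i\<in>F. integral {T1..T2} (\<lambda>t. of_real (e i) * (of_real (ReG \<sigma> t) * upow (u i) (Complex \<sigma> t))))"
      by (rule integral_sum[OF F(1)]) (intro integrable_continuous_real continuous_intros cG cu; assumption)
    then show ?thesis unfolding integral_mult_right I_def by simp
  qed
  also have "Re \<dots> \<le> integral {T1..T2} (\<lambda>t. (1/2) * (lam * (ReG \<sigma> t / t)) + (1 / (2 * lam)) * (ReG \<sigma> t / t * (norm (D t))\<^sup>2))"
  proof (rule order.trans[OF complex_Re_le_cmod], rule integral_norm_bound_integral)
    show "(\<lambda>t. \<Sum>i\<in>F. of_real (e i) * (of_real (ReG \<sigma> t) * upow (u i) (Complex \<sigma> t))) integrable_on {T1..T2}"
      by (intro integrable_continuous_real continuous_intros cG cu; assumption)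
    show "(\<lambda>t. (1/2) * (lam * (ReG \<sigma> t / t)) + (1 / (2 * lam)) * (ReG \<sigma> t / t * (norm (D t))\<^sup>2)) integrable_on {T1..T2}"
      by (intro integrable_continuous_real continuous_intros cG cD) (use T in auto)
    fix t assume t: "t \<in> {T1..T2}"
    have t0: "t > 0" using t T by auto
    \<comment> \<open>The factor \<open>1 / s\<close> is common to all points; once it is taken out,
      each point leaves the pure oscillation \<open>cis (t * ln (u i))\<close> with a real
      coefficient.\<close>
    have "of_real (e i) * (of_real (ReG \<sigma> t) * upow (u i) (Complex \<sigma> t)) = of_real (ReG \<sigma> t) / Complex \<sigma> t * (of_real (a i) * cis (t * ln (u i)))" if "i \<in> F" for i
    proof -
      have ui: "u i > 0" by (rule u(1)[OF that])
      have "complex_of_real (u i) powr Complex \<sigma> t = exp (of_real (\<sigma> * ln (u i)) + \<i> * of_real (t * ln (u i)))"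
        using ui by (simp add: powr_def Ln_of_real Complex_eq algebra_simps)
      also have "\<dots> = of_real (u i powr \<sigma>) * cis (t * ln (u i))"
        using ui by (simp only: exp_add exp_of_real cis_conv_exp) (simp add: powr_def)
      finally show ?thesis unfolding upow_def a_def by simp
    qed
    then have "(\<Sum>i\<in>F. of_real (e i) * (of_real (ReG \<sigma> t) * upow (u i) (Complex \<sigma> t))) = of_real (ReG \<sigma> t) / Complex \<sigma> t * D t"
      unfolding D_def sum_distrib_left by simp
    then have "norm (\<Sum>i\<in>F. of_real (e i) * (of_real (ReG \<sigma> t) * upow (u i) (Complex \<sigma> t))) = ReG \<sigma> t / norm (Complex \<sigma> t) * norm (D t)"
      using g0[of t] by (simp add: norm_mult norm_divide)
    also have "\<dots> \<le> ReG \<sigma> t / t * norm (D t)"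
      using norm_Complex_ge(2)[where a = \<sigma> and t = t] g0[of t] t0 by (intro mult_right_mono frac_le) auto
    also have "\<dots> \<le> ReG \<sigma> t / t * ((lam + (norm (D t))\<^sup>2 / lam) / 2)"
    proof (rule mult_left_mono)
      have "2 * lam * norm (D t) \<le> lam * lam + (norm (D t))\<^sup>2"
        using sum_squares_bound[of lam "norm (D t)"] by (simp add: power2_eq_square)
      then show "norm (D t) \<le> (lam + (norm (D t))\<^sup>2 / lam) / 2" using lam by (simp add: field_simps)
    qed (use g0[of t] t0 in auto)
    also have "\<dots> = (1/2) * (lam * (ReG \<sigma> t / t)) + (1 / (2 * lam)) * (ReG \<sigma> t / t * (norm (D t))\<^sup>2)"
      using lam t0 by (simp add: field_simps)
    finally show "norm (\<Sum>i\<in>F. of_real (e i) * (of_real (ReG \<sigma> t) * upow (u i) (Complex \<sigma> t))) \<le> (1/2) * (lam * (ReG \<sigma> t / t)) + (1 / (2 * lam)) * (ReG \<sigma> t / t * (norm (D t))\<^sup>2)" .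
  qed
  also have "\<dots> = integral {T1..T2} (\<lambda>t. (1/2) * (lam * (ReG \<sigma> t / t))) + integral {T1..T2} (\<lambda>t. (1 / (2 * lam)) * (ReG \<sigma> t / t * (norm (D t))\<^sup>2))"
    by (rule integral_add; intro integrable_continuous_real continuous_intros cG cD) (use T in auto)
  also have "\<dots> = (1/2) * (lam * integral {T1..T2} (\<lambda>t. ReG \<sigma> t / t)) + (1 / (2 * lam)) * Q"
    unfolding integral_mult_right Q_def ..
  also have "\<dots> \<le> (1/2) * (lam * P) + (1 / (2 * lam)) * (M\<^sup>2 * (R * P + R\<^sup>2 * Off))"
    using P(2) Q lam by (intro add_mono mult_left_mono) (auto simp: \<sigma>_def)
  also have "lam * P = R * B0" using P by (simp add: lam_def)
  finally have "R * B0 \<le> (1/2) * (R * B0) + (1 / (2 * lam)) * (M\<^sup>2 * (R * P + R\<^sup>2 * Off))" .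
  moreover have "(1 / lam) * (M\<^sup>2 * (R * P + R\<^sup>2 * Off)) = 2 * ((1 / (2 * lam)) * (M\<^sup>2 * (R * P + R\<^sup>2 * Off)))" by simp
  moreover have "x \<le> z" if "x \<le> (1/2) * x + y" "z = 2 * y" for x y z :: real using that by linarith
  ultimately have "R * B0 \<le> (1 / lam) * (M\<^sup>2 * (R * P + R\<^sup>2 * Off))" by blast
  then have "lam * (R * B0) \<le> M\<^sup>2 * (R * P + R\<^sup>2 * Off)" using lam by (simp add: field_simps)
  then have "(R * B0) * (R * B0) \<le> P * (M\<^sup>2 * (R * P + R\<^sup>2 * Off))" using P by (simp add: lam_def field_simps)
  then have "R * (R * B0\<^sup>2) \<le> R * (P * M\<^sup>2 * (P + R * Off))" by (simp add: power2_eq_square algebra_simps)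
  then show ?thesis using R unfolding R_def[symmetric] by simp
qed

section \<open>Separated points of large deviation\<close>

text \<open>Below \<open>T0\<close> absolute values are taken, at the price of the full diagonal
  mean of the density; only the part above \<open>T0\<close> keeps its oscillation. Heights below 1,
  outside the range of the mean value estimates, are covered by \<open>Glog_bound\<close>.\<close>

lemma high_part:
  assumes RH: riemann_hypothesis and x: "x \<ge> 4" and h: "1 \<le> h" "h \<le> x / 2" and b: "0 < b" "b \<le> 1/8"
    and T: "1 \<le> T0" "T0 \<le> T" and dev: "\<bar>chebyshev_psi x - x\<bar> \<ge> \<eta>"
  obtains u where "\<bar>u - x\<bar> \<le> h"
    "2 * pi * (\<eta> - h - 1) - (1024 * LamC + 256) * x ^ 3 / T \<le>
       4 * (u powr (1/2 + b) * (12 * CG / b + ((ln T0)\<^sup>2 / 4 + 8 + K1 * (1 / b + ln T0))) +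
          \<bar>Re (integral {T0..T} (\<lambda>t. of_real (ReG (1/2 + b) t) * upow u (Complex (1/2 + b) t)))\<bar>)
       + 120 * CG * (lt T)\<^sup>2 * u powr (1/4 + 2 * b) + 25 * CG * lt T * u\<^sup>2 / (b * T)"
proof -
  define \<sigma> where "\<sigma> = 1/2 + b"
  have \<sigma>: "\<sigma> > 1/2" "\<sigma> \<le> 2" using b by (auto simp: \<sigma>_def)
  have T1: "T \<ge> 1" using T by simp
  obtain u where u: "\<bar>u - x\<bar> \<le> h" "2 * pi * (\<eta> - h - 1) - (1024 * LamC + 256) * x ^ 3 / T \<le> \<bar>Re (Zd T u)\<bar>"
    using psi_deviation[OF RH x h T1 dev] by blast
  have u1: "u \<ge> 1" using u x h by linarith
  let ?f = "\<lambda>t. of_real (ReG \<sigma> t) * upow u (Complex \<sigma> t)"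
  have cf: "continuous_on A ?f" for A
    by (intro continuous_intros ReG_cont[OF RH] upow_cont) (use \<sigma> u1 in auto)
  have g0: "ReG \<sigma> t \<ge> 0" for t by (rule ReG_nonneg[OF RH]) (use \<sigma> in auto)
  have nf: "norm (?f t) = ReG \<sigma> t * (u powr \<sigma> / norm (Complex \<sigma> t))" for t
    using g0[of t] u1 by (simp add: norm_mult upow_norm)
  have split: "integral {0..T} ?f = integral {0..1} ?f + integral {1..T0} ?f + integral {T0..T} ?f"
  proof -
    have "integral {0..T} ?f = integral {0..T0} ?f + integral {T0..T} ?f"
      by (rule Henstock_Kurzweil_Integration.integral_combine[symmetric]) (use T in \<open>auto intro!: integrable_continuous_real cf\<close>)
    also have "integral {0..T0} ?f = integral {0..1} ?f + integral {1..T0} ?f"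
      by (rule Henstock_Kurzweil_Integration.integral_combine[symmetric]) (use T in \<open>auto intro!: integrable_continuous_real cf\<close>)
    finally show ?thesis .
  qed
  have I0: "norm (integral {0..1} ?f) \<le> 12 * CG / b * u powr \<sigma>"
  proof -
    have "norm (integral {0..1} ?f) \<le> 12 * CG / b * u powr \<sigma> * (1 - 0)"
    proof (rule integral_bound[OF _ cf])
      fix t :: real assume t: "t \<in> {0..1}"
      have "ReG \<sigma> t \<le> norm (Glog (Complex \<sigma> t))" unfolding ReG_def by (rule complex_Re_le_cmod)
      also have "\<dots> \<le> CG * lt t / b" using Glog_bound[OF RH, of "Complex \<sigma> t"] \<sigma> by (simp add: \<sigma>_def)
      also have "\<dots> \<le> CG * 6 / b"
      proof -
        have "lt t \<le> 6" using ln_le_minus_one[of "6 + \<bar>t\<bar>"] t by simp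
        then show ?thesis using CG_ge b by (intro divide_right_mono mult_left_mono) auto
      qed
      finally have R: "ReG \<sigma> t \<le> 6 * CG / b" by (simp add: mult.commute)
      have "1 / 2 \<le> norm (Complex \<sigma> t)" using norm_Complex_ge(1)[where a = \<sigma> and t = t] \<sigma> by linarith
      then have "u powr \<sigma> / norm (Complex \<sigma> t) \<le> u powr \<sigma> / (1/2)" by (intro divide_left_mono) (auto intro: mult_pos_pos)
      then have "norm (?f t) \<le> 6 * CG / b * (u powr \<sigma> / (1/2))" unfolding nf using R CG_ge b by (intro mult_mono) auto
      then show "norm (?f t) \<le> 12 * CG / b * u powr \<sigma>" by simp
    qed simp
    then show ?thesis by simp
  qed
  have I1: "norm (integral {1..T0} ?f) \<le> u powr \<sigma> * ((ln T0)\<^sup>2 / 4 + 8 + K1 * (1 / b + ln T0))"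
  proof -
    have "norm (integral {1..T0} ?f) \<le> integral {1..T0} (\<lambda>t. u powr \<sigma> * (ReG \<sigma> t / t))"
    proof (rule integral_norm_bound_integral)
      show "(\<lambda>t. u powr \<sigma> * (ReG \<sigma> t / t)) integrable_on {1..T0}"
        by (intro integrable_continuous_real continuous_intros ReG_cont[OF RH]) (use \<sigma> in auto)
      fix t assume t: "t \<in> {1..T0}"
      have n: "t \<le> norm (Complex \<sigma> t)" using norm_Complex_ge(2)[where a = \<sigma> and t = t] t by simp
      have "0 < t" using t by simp
      moreover from this n have "0 < norm (Complex \<sigma> t)" by linarith
      ultimately have "0 < norm (Complex \<sigma> t) * t" by (rule mult_pos_pos[rotated])
      then have "ReG \<sigma> t * (u powr \<sigma> / norm (Complex \<sigma> t)) \<le> ReG \<sigma> t * (u powr \<sigma> / t)"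
        using n g0 by (intro mult_left_mono divide_left_mono) auto
      then show "norm (?f t) \<le> u powr \<sigma> * (ReG \<sigma> t / t)" unfolding nf by (simp add: mult_ac)
    qed (intro integrable_continuous_real cf)
    also have "\<dots> = u powr \<sigma> * integral {1..T0} (\<lambda>t. ReG \<sigma> t / t)" by (rule integral_mult_right)
    also have "\<dots> \<le> u powr \<sigma> * ((ln T0)\<^sup>2 / 4 + 8 + K1 * (1 / b + ln T0))"
      using ReG_diag[OF RH b T(1)] by (intro mult_left_mono) (auto simp: \<sigma>_def)
    finally show ?thesis .
  qed
  have "\<bar>Re (integral {0..T} ?f)\<bar> \<le> norm (integral {0..1} ?f) + norm (integral {1..T0} ?f) + \<bar>Re (integral {T0..T} ?f)\<bar>"
    unfolding split using abs_Re_le_cmod[of "integral {0..1} ?f"] abs_Re_le_cmod[of "integral {1..T0} ?f"] by simp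
  also have "\<dots> \<le> u powr \<sigma> * (12 * CG / b + ((ln T0)\<^sup>2 / 4 + 8 + K1 * (1 / b + ln T0))) + \<bar>Re (integral {T0..T} ?f)\<bar>"
  proof -
    have "u powr \<sigma> * (12 * CG / b + w) = 12 * CG / b * u powr \<sigma> + u powr \<sigma> * w" for w by (simp add: algebra_simps)
    then show ?thesis using I0 I1 by simp
  qed
  finally have "4 * \<bar>Re (integral {0..T} ?f)\<bar> \<le> 4 * (u powr \<sigma> * (12 * CG / b + ((ln T0)\<^sup>2 / 4 + 8 + K1 * (1 / b + ln T0))) + \<bar>Re (integral {T0..T} ?f)\<bar>)"
    by simp
  then show ?thesis using that[OF u(1)] u(2) Zd_reduce[OF RH u1 T1 b] unfolding \<sigma>_def by fastforce
qed

definition C1 :: real where "C1 = 1024 * LamC + 256"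

lemma C1_pos: "C1 > 0" using LamC_nonneg by (simp add: C1_def)

text \<open>The errors of lower order than \<open>(ln X)\<^sup>2 * sqrt X\<close> that arise in
  \<open>localized\<close>, after the parameters \<open>b\<close> and \<open>T\<close> have been
  expressed through \<open>\<delta>\<close> and \<open>X\<close>.\<close>

definition restf :: "real \<Rightarrow> real \<Rightarrow> real" where
  "restf \<delta> X = (7 + 8 * C1) + 24 * (24 * CG / \<delta> + 8 + K1 * (2 / \<delta> + 1)) * (sqrt X * ln X) + 7 * (X powr (1/4) * ln X ^ 3)
     + 720 * CG * (lt (X ^ 4) ^ 2 * X powr (1/4)) + (450 * CG / \<delta>) * (lt (X ^ 4) * ln X)"

lemma restf_small:
  assumes d: "c > 0"
  shows "eventually (\<lambda>X. restf \<delta> X \<le> c * ((ln X)\<^sup>2 * sqrt X)) at_top"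
proof -
  let ?g = "\<lambda>X::real. (ln X)\<^sup>2 * sqrt X"
  have "((\<lambda>X. (7 + 8 * C1) * (1 / ?g X) + 24 * (24 * CG / \<delta> + 8 + K1 * (2 / \<delta> + 1)) * ((sqrt X * ln X) / ?g X) + 7 * ((X powr (1/4) * ln X ^ 3) / ?g X)
     + 720 * CG * ((lt (X ^ 4) ^ 2 * X powr (1/4)) / ?g X) + (450 * CG / \<delta>) * ((lt (X ^ 4) * ln X) / ?g X)) \<longlongrightarrow>
     (7 + 8 * C1) * 0 + 24 * (24 * CG / \<delta> + 8 + K1 * (2 / \<delta> + 1)) * 0 + 7 * 0 + 720 * CG * 0 + (450 * CG / \<delta>) * 0) at_top"
  proof (intro tendsto_intros)
    show "((\<lambda>X. 1 / ?g X) \<longlongrightarrow> 0) at_top" by real_asymp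
    show "((\<lambda>X. (sqrt X * ln X) / ?g X) \<longlongrightarrow> 0) at_top" by real_asymp
    show "((\<lambda>X. (X powr (1/4) * ln X ^ 3) / ?g X) \<longlongrightarrow> 0) at_top" by real_asymp
    show "((\<lambda>X. (lt (X ^ 4) ^ 2 * X powr (1/4)) / ?g X) \<longlongrightarrow> 0) at_top" by real_asymp
    show "((\<lambda>X. (lt (X ^ 4) * ln X) / ?g X) \<longlongrightarrow> 0) at_top" by real_asymp
  qed
  then have "((\<lambda>X. restf \<delta> X / ?g X) \<longlongrightarrow> 0) at_top"
    unfolding restf_def by (simp only: add_divide_distrib times_divide_eq_right mult_zero_right add_0_right mult_1_right)
  then have "eventually (\<lambda>X. restf \<delta> X / ?g X < c) at_top" using d by (rule order_tendstoD(2))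
  moreover have "eventually (\<lambda>X::real. ?g X > 0) at_top" by real_asymp
  ultimately show ?thesis by eventually_elim (simp add: divide_less_eq)
qed

text \<open>One of the two factors \<open>1 - \<delta>\<close> in the square of \<open>ln T0\<close>
  pays for the loss \<open>exp \<delta>\<close> that comes from working off the critical
  line.\<close>

lemma exp_one_minus:
  assumes "0 \<le> \<delta>" "\<delta> \<le> (1::real)"
  shows "exp \<delta> * (1 - \<delta>) \<le> 1"
proof -
  have "1 - \<delta> \<le> exp (- \<delta>)" using exp_ge_add_one_self[of "- \<delta>"] by simp
  then have "exp \<delta> * (1 - \<delta>) \<le> exp \<delta> * exp (- \<delta>)" by (intro mult_left_mono) auto
  then show ?thesis by (simp add: exp_minus)
qed

text \<open>The choice of parameters: \<open>b\<close> is small enough for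
  \<open>u powr b \<le> exp \<delta>\<close>, \<open>h\<close> is a small share of the deviation so
  that moving \<open>x\<close> to \<open>u\<close> uses up only part of the surplus, and
  \<open>T = X ^ 4\<close> makes the truncation errors bounded or logarithmic.\<close>

lemma localized:
  fixes X \<epsilon> \<delta> :: real
  assumes RH: riemann_hypothesis and e: "0 < \<epsilon>" "\<epsilon> < 1/100" and d: "0 < \<delta>" "\<delta> < 1/100"
  defines "L \<equiv> ln X" and "\<tau> \<equiv> sqrt (2 * pi * \<epsilon>)"
  defines "b \<equiv> \<delta> / (2 * L)" and "h \<equiv> \<delta> * \<epsilon> / 4 * (sqrt X * L\<^sup>2)" and "T0 \<equiv> X powr ((1 - \<delta>) * \<tau>)" and "T \<equiv> X ^ 4"
  assumes X: "X \<ge> 4" "L \<ge> 1" and h: "1 \<le> h" "h \<le> X / 2" and rest: "restf \<delta> X \<le> 2 * \<delta> * \<epsilon> * (L\<^sup>2 * sqrt X)"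
    and x: "X \<le> x" "x \<le> 2 * X" and dev: "\<bar>chebyshev_psi x - x\<bar> \<ge> \<epsilon> * (ln x)\<^sup>2 * sqrt x"
  obtains u where "\<bar>u - x\<bar> \<le> h"
    "\<delta> * \<epsilon> / 2 * (L\<^sup>2 * sqrt X) \<le> \<bar>Re (integral {T0..T} (\<lambda>t. of_real (ReG (1/2 + b) t) * upow u (Complex (1/2 + b) t)))\<bar>"
proof -
  have \<tau>: "0 < \<tau>" "\<tau>\<^sup>2 = 2 * pi * \<epsilon>" "\<tau> \<le> 1"
  proof -
    show "0 < \<tau>" "\<tau>\<^sup>2 = 2 * pi * \<epsilon>" using e by (auto simp: \<tau>_def)
    have "2 * pi * \<epsilon> \<le> 2 * 4 * (1/100)" using e pi_less_4 by (intro mult_mono) auto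
    then show "\<tau> \<le> 1" unfolding \<tau>_def by (simp add: real_sqrt_le_1_iff)
  qed
  have b: "0 < b" "b \<le> 1/8" "b * (2 * L) = \<delta>" "1 / b = 2 * L / \<delta>" using d X by (auto simp: b_def field_simps)
  have lnT0: "ln T0 = (1 - \<delta>) * \<tau> * L" using X by (simp add: T0_def L_def ln_powr)
  have T01: "1 \<le> T0" unfolding T0_def using X d \<tau> by (intro ge_one_powr_ge_zero) auto
  have T0T: "T0 \<le> T"
  proof -
    have "(1 - \<delta>) * \<tau> \<le> 1 * 1" using d \<tau> by (intro mult_mono) auto
    then have "T0 \<le> X powr 1" unfolding T0_def using X by (intro powr_mono) auto
    also have "\<dots> \<le> T" using X self_le_power[of X 4] by (simp add: T_def)
    finally show ?thesis .
  qed
  have lnT0': "0 \<le> ln T0" "ln T0 \<le> L"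
  proof -
    show "0 \<le> ln T0" using T01 by simp
    have "(1 - \<delta>) * \<tau> * L \<le> 1 * 1 * L" using d \<tau> X by (intro mult_mono) auto
    then show "ln T0 \<le> L" by (simp add: lnT0)
  qed
  have Lx: "L \<le> ln x" unfolding L_def using x X by simp
  have dev': "\<bar>chebyshev_psi x - x\<bar> \<ge> \<epsilon> * L\<^sup>2 * sqrt x"
  proof -
    have "\<epsilon> * L\<^sup>2 * sqrt x \<le> \<epsilon> * (ln x)\<^sup>2 * sqrt x"
      using e Lx X x by (intro mult_right_mono mult_left_mono power_mono) auto
    then show ?thesis using dev by linarith
  qed
  have x4: "x \<ge> 4" "h \<le> x / 2" using x X h by auto
  obtain u where u: "\<bar>u - x\<bar> \<le> h" and
    big: "2 * pi * (\<epsilon> * L\<^sup>2 * sqrt x - h - 1) - (1024 * LamC + 256) * x ^ 3 / T \<le>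
       4 * (u powr (1/2 + b) * (12 * CG / b + ((ln T0)\<^sup>2 / 4 + 8 + K1 * (1 / b + ln T0))) +
          \<bar>Re (integral {T0..T} (\<lambda>t. of_real (ReG (1/2 + b) t) * upow u (Complex (1/2 + b) t)))\<bar>)
       + 120 * CG * (lt T)\<^sup>2 * u powr (1/4 + 2 * b) + 25 * CG * lt T * u\<^sup>2 / (b * T)"
    by (rule high_part[OF RH x4(1) h(1) x4(2) b(1,2) T01 T0T dev'])
  define G where "G = \<bar>Re (integral {T0..T} (\<lambda>t. of_real (ReG (1/2 + b) t) * upow u (Complex (1/2 + b) t)))\<bar>"
  have ub: "0 < u" "1 \<le> u" "u \<le> 3 * X" "u \<le> x + h" using u x X h by linarith+
  \<comment> \<open>The crude bound \<open>u \<le> 3 * X \<le> X * X\<close> is the reason for the 2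
    in the denominator of \<open>b\<close>.\<close>
  have lnu: "ln u \<le> 2 * L"
  proof -
    have "3 * X \<le> X * X" using X by (intro mult_right_mono) auto
    then have "u \<le> X * X" using ub by linarith
    then have "ln u \<le> ln (X * X)" using ub X by (subst ln_le_cancel_iff) auto
    then show ?thesis using X by (simp add: L_def ln_mult_pos)
  qed
  have ed: "exp \<delta> \<le> 2" "exp (2 * \<delta>) \<le> 2"
  proof -
    have "exp (2 * \<delta>) \<le> exp (1/2)" using d by simp
    moreover have "exp (1/2) \<le> (2::real)"
    proof -
      have "exp (1/2) * exp (1/2) = exp (1::real)" by (simp flip: exp_add)
      also have "\<dots> \<le> 2 * 2" using exp_le by simp
      finally show ?thesis using power2_le_imp_le[of "exp (1/2)" "2::real"] by (simp add: power2_eq_square)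
    qed
    ultimately show "exp (2 * \<delta>) \<le> 2" by linarith
    moreover have "exp \<delta> \<le> exp (2 * \<delta>)" using d by simp
    ultimately show "exp \<delta> \<le> 2" by linarith
  qed
  have upb: "u powr b \<le> exp \<delta>" "u powr (2 * b) \<le> 2"
  proof -
    have "b * ln u \<le> b * (2 * L)" using lnu b by (intro mult_left_mono) auto
    then have bl: "b * ln u \<le> \<delta>" using b by simp
    then show "u powr b \<le> exp \<delta>" using ub by (simp add: powr_def)
    have "u powr (2 * b) \<le> exp (2 * \<delta>)" using bl ub by (simp add: powr_def)
    then show "u powr (2 * b) \<le> 2" using ed by linarith
  qed
  define S where "S = sqrt X"
  have S0: "S > 0" "S * S = X" "S \<ge> 1" using X by (auto simp: S_def)
  have sx: "S \<le> sqrt x" "sqrt x \<le> 2 * S"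
  proof -
    show "S \<le> sqrt x" using x by (simp add: S_def)
    have "sqrt x \<le> sqrt (4 * X)" using x X by simp
    then show "sqrt x \<le> 2 * S" by (simp add: S_def real_sqrt_mult)
  qed
  have sh: "sqrt h \<le> S" "sqrt h \<le> X powr (1/4) * L"
  proof -
    show "sqrt h \<le> S" using h X by (simp add: S_def)
    have "\<delta> * \<epsilon> \<le> 1 * 1" using d e by (intro mult_mono) auto
    then have "h \<le> 1 * (sqrt X * L\<^sup>2)" unfolding h_def using X by (intro mult_right_mono) auto
    then have "sqrt h \<le> sqrt (sqrt X * L\<^sup>2)" by simp
    also have "\<dots> = sqrt (sqrt X) * L" using X by (simp add: real_sqrt_mult)
    also have "sqrt (sqrt X) = X powr (1/4)" using X by (simp add: powr_half_sqrt[symmetric] powr_powr)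
    finally show "sqrt h \<le> X powr (1/4) * L" .
  qed
  have us: "u powr (1/2 + b) \<le> (sqrt x + sqrt h) * exp \<delta>"
  proof -
    have "sqrt u \<le> sqrt (x + h)" using ub by simp
    also have "\<dots> \<le> sqrt x + sqrt h" using x X h by (intro sqrt_add_le_add_sqrt) auto
    finally have "sqrt u \<le> sqrt x + sqrt h" .
    then have "sqrt u * u powr b \<le> (sqrt x + sqrt h) * exp \<delta>" using upb by (intro mult_mono) (use x X h in auto)
    then show ?thesis using ub by (simp add: powr_add powr_half_sqrt)
  qed
  define c3 where "c3 = 24 * CG / \<delta> + 8 + K1 * (2 / \<delta> + 1)"
  have c3: "12 * CG / b + 8 + K1 * (1 / b + ln T0) \<le> c3 * L"
  proof -
    have "12 * CG / b = 12 * CG * (1 / b)" by simp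
    also have "\<dots> = 24 * CG / \<delta> * L" unfolding b(4) by simp
    finally have "12 * CG / b = 24 * CG / \<delta> * L" .
    moreover have "8 \<le> 8 * L" using X by simp
    moreover have "K1 * (1 / b + ln T0) \<le> K1 * (2 / \<delta> + 1) * L"
    proof -
      have "1 / b + ln T0 \<le> (2 / \<delta> + 1) * L" using b(4) lnT0' by (simp add: algebra_simps)
      then show ?thesis using K1_ge mult_left_mono[of "1 / b + ln T0" "(2 / \<delta> + 1) * L" K1] by (simp add: mult.assoc)
    qed
    ultimately show ?thesis by (simp add: c3_def algebra_simps)
  qed
  have c30: "0 \<le> c3 * L"
  proof -
    have "0 \<le> c3" unfolding c3_def using CG_ge K1_ge d by (intro add_nonneg_nonneg) auto
    then show ?thesis using X by simp
  qed
  define q where "q = 2 * pi * \<epsilon> * L\<^sup>2"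
  have q: "0 \<le> q" "q \<le> 7 * L\<^sup>2"
  proof -
    have "2 * pi * \<epsilon> \<le> 2 * 4 * (1/100)" using e pi_less_4 by (intro mult_mono) auto
    then have "2 * pi * \<epsilon> \<le> 7" by simp
    then show "q \<le> 7 * L\<^sup>2" unfolding q_def by (intro mult_right_mono) auto
  qed (use e in \<open>auto simp: q_def\<close>)
  have q4: "(ln T0)\<^sup>2 = (1 - \<delta>)\<^sup>2 * q" unfolding lnT0 power_mult_distrib \<tau>(2) q_def by simp
  \<comment> \<open>The decisive low-frequency term. Passing from \<open>u\<close> back to
    \<open>x\<close> costs \<open>sqrt h\<close>, which is of lower order, and
    \<open>exp \<delta>\<close> uses up one factor \<open>1 - \<delta>\<close>.\<close>
  have main1: "4 * (u powr (1/2 + b) * ((ln T0)\<^sup>2 / 4)) \<le> (1 - \<delta>) * (sqrt x * q) + 7 * (X powr (1/4) * L ^ 3)"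
  proof -
    have "4 * (u powr (1/2 + b) * ((ln T0)\<^sup>2 / 4)) = u powr (1/2 + b) * ((1 - \<delta>)\<^sup>2 * q)" by (simp add: q4)
    also have "\<dots> \<le> ((sqrt x + sqrt h) * exp \<delta>) * ((1 - \<delta>)\<^sup>2 * q)" using us q by (intro mult_right_mono) auto
    also have "\<dots> = (exp \<delta> * (1 - \<delta>)) * ((1 - \<delta>) * (sqrt x + sqrt h) * q)" by (simp add: power2_eq_square algebra_simps)
    also have "\<dots> \<le> 1 * ((1 - \<delta>) * (sqrt x + sqrt h) * q)"
      by (intro mult_right_mono exp_one_minus mult_nonneg_nonneg) (use d q x X h in auto)
    also have "\<dots> = (1 - \<delta>) * (sqrt x * q) + (1 - \<delta>) * (sqrt h * q)" by (simp add: algebra_simps)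
    also have "(1 - \<delta>) * (sqrt h * q) \<le> 1 * ((X powr (1/4) * L) * (7 * L\<^sup>2))"
      using d sh q X h by (intro mult_mono) auto
    also have "1 * ((X powr (1/4) * L) * (7 * L\<^sup>2)) = 7 * (X powr (1/4) * L ^ 3)" by (simp add: power2_eq_square power3_eq_cube)
    finally show ?thesis by simp
  qed
  have main2: "4 * (u powr (1/2 + b) * (12 * CG / b + 8 + K1 * (1 / b + ln T0))) \<le> 24 * c3 * (S * L)"
  proof -
    have "u powr (1/2 + b) \<le> (2 * S + S) * 2" using us
    proof (rule order.trans)
      show "(sqrt x + sqrt h) * exp \<delta> \<le> (2 * S + S) * 2" using sx sh ed S0 h x X by (intro mult_mono add_mono) auto
    qed
    then have "u powr (1/2 + b) * (12 * CG / b + 8 + K1 * (1 / b + ln T0)) \<le> ((2 * S + S) * 2) * (c3 * L)"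
      using c3 b CG_ge K1_ge lnT0' S0 by (intro mult_mono) (auto intro!: add_nonneg_nonneg mult_nonneg_nonneg)
    then show ?thesis by (simp add: mult_ac)
  qed
  have main3: "120 * CG * (lt T)\<^sup>2 * u powr (1/4 + 2 * b) \<le> 720 * CG * ((lt T)\<^sup>2 * X powr (1/4))"
  proof -
    have "u powr (1/4) \<le> (3 * X) powr (1/4)" using ub by (intro powr_mono2) auto
    also have "\<dots> = 3 powr (1/4) * X powr (1/4)" using X by (simp add: powr_mult)
    also have "\<dots> \<le> 3 * X powr (1/4)"
    proof -
      have "3 powr (1/4) \<le> (3::real) powr 1" by (intro powr_mono) auto
      then show ?thesis by (intro mult_right_mono) auto
    qed
    finally have "u powr (1/4) * u powr (2 * b) \<le> (3 * X powr (1/4)) * 2" using upb by (intro mult_mono) auto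
    then have "u powr (1/4 + 2 * b) \<le> 6 * X powr (1/4)" by (simp add: powr_add)
    then have "120 * CG * (lt T)\<^sup>2 * u powr (1/4 + 2 * b) \<le> 120 * CG * (lt T)\<^sup>2 * (6 * X powr (1/4))"
      using CG_ge by (intro mult_left_mono) auto
    then show ?thesis by (simp add: mult_ac)
  qed
  have main4: "25 * CG * lt T * u\<^sup>2 / (b * T) \<le> (450 * CG / \<delta>) * (lt T * L)"
  proof -
    have "u\<^sup>2 \<le> (3 * X)\<^sup>2" using ub by (intro power_mono) auto
    then have u2: "u\<^sup>2 \<le> 9 * (X * X)" by (simp add: power2_eq_square)
    have "X * X * 1 \<le> X * X * (X * X)" using X mult_mono[of 1 X 1 X] by (intro mult_left_mono) auto
    then have "X * X \<le> T" by (simp add: T_def power4_eq_xxxx mult.assoc)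
    then have u3: "u\<^sup>2 / T \<le> 9" using u2 X by (simp add: T_def divide_le_eq)
    have "25 * CG * lt T * u\<^sup>2 / (b * T) = 25 * CG * lt T * (1 / b) * (u\<^sup>2 / T)" by simp
    also have "\<dots> \<le> 25 * CG * lt T * (1 / b) * 9"
      using u3 CG_ge lt_ge_1[of T] b by (intro mult_left_mono) auto
    also have "\<dots> = (450 * CG / \<delta>) * (lt T * L)" unfolding b(4) by simp
    finally show ?thesis .
  qed
  have main5: "(1024 * LamC + 256) * x ^ 3 / T \<le> 8 * C1"
  proof -
    have "x ^ 3 \<le> (2 * X) ^ 3" using x X by (intro power_mono) auto
    then have "x ^ 3 \<le> 8 * X ^ 3" by (simp add: power_mult_distrib)
    also have "\<dots> \<le> 8 * T" using X unfolding T_def by (intro mult_left_mono power_increasing) auto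
    finally have "x ^ 3 / T \<le> 8" using X by (simp add: T_def divide_le_eq)
    then show ?thesis using C1_pos mult_left_mono[of "x ^ 3 / T" 8 C1] by (simp add: C1_def)
  qed
  have restX: "restf \<delta> X = (7 + 8 * C1) + 24 * c3 * (S * L) + 7 * (X powr (1/4) * L ^ 3) + 720 * CG * ((lt T)\<^sup>2 * X powr (1/4)) + (450 * CG / \<delta>) * (lt T * L)"
    unfolding restf_def c3_def S_def L_def T_def ..
  \<comment> \<open>The unit of account: the surplus is at least \<open>2 * pi * Y\<close>, the move
    to \<open>u\<close> takes \<open>pi / 2 * Y\<close>, and the lower-order terms take
    \<open>2 * Y\<close>. At least \<open>2 * Y\<close> remains, since
    \<open>3 * pi / 2 \<ge> 4\<close>.\<close>
  define Y where "Y = \<delta> * \<epsilon> * (L\<^sup>2 * S)"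
  have Y0: "Y \<ge> 0" using d e S0 by (simp add: Y_def)
  have e1: "2 * pi * (\<epsilon> * L\<^sup>2 * sqrt x - h - 1) = sqrt x * q - pi / 2 * Y - 2 * pi"
    unfolding q_def Y_def h_def S_def by (simp add: algebra_simps)
  have e2: "4 * (u powr (1/2 + b) * (12 * CG / b + ((ln T0)\<^sup>2 / 4 + 8 + K1 * (1 / b + ln T0))) + G) =
    4 * (u powr (1/2 + b) * ((ln T0)\<^sup>2 / 4)) + 4 * (u powr (1/2 + b) * (12 * CG / b + 8 + K1 * (1 / b + ln T0))) + 4 * G"
    by (simp only: distrib_left add_ac)
  have rY: "restf \<delta> X \<le> 2 * Y" using rest by (simp add: Y_def S_def mult_ac)
  have xq: "2 * pi * Y \<le> \<delta> * (sqrt x * q)"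
  proof -
    have "\<delta> * (S * q) \<le> \<delta> * (sqrt x * q)" using sx q d by (intro mult_left_mono mult_right_mono) auto
    then show ?thesis by (simp add: Y_def q_def mult_ac)
  qed
  \<comment> \<open>The bookkeeping is isolated as a statement about real variables, where it is
    linear.\<close>
  have gen: "4 * Y / 2 \<le> 4 * G" if
    "A - p2 - p - c8 \<le> m1 + m2 + 4 * G + m3 + m4" "m1 \<le> A - dA + r1" "m2 \<le> r2" "m3 \<le> r3" "m4 \<le> r4" "c8 \<le> r5"
    "p \<le> 7" "7 + r5 + r2 + r1 + r3 + r4 \<le> 2 * Y" "p1 \<le> dA" "4 * Y + p2 \<le> p1"
    for A p2 p c8 m1 m2 m3 m4 r1 r2 r3 r4 r5 p1 dA :: real
    using that by linarith
  have "4 * Y / 2 \<le> 4 * G"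
  proof (rule gen)
    show "sqrt x * q - pi / 2 * Y - 2 * pi - (1024 * LamC + 256) * x ^ 3 / T \<le>
      4 * (u powr (1/2 + b) * ((ln T0)\<^sup>2 / 4)) + 4 * (u powr (1/2 + b) * (12 * CG / b + 8 + K1 * (1 / b + ln T0))) + 4 * G
       + 120 * CG * (lt T)\<^sup>2 * u powr (1/4 + 2 * b) + 25 * CG * lt T * u\<^sup>2 / (b * T)"
      using big unfolding e1 G_def[symmetric] e2 .
    show "4 * (u powr (1/2 + b) * ((ln T0)\<^sup>2 / 4)) \<le> sqrt x * q - \<delta> * (sqrt x * q) + 7 * (X powr (1/4) * L ^ 3)"
      using main1 by (simp add: left_diff_distrib)
    show "2 * pi \<le> 7" using pi_approx by simp
    show "7 + 8 * C1 + 24 * c3 * (S * L) + 7 * (X powr (1/4) * L ^ 3) + 720 * CG * ((lt T)\<^sup>2 * X powr (1/4)) + (450 * CG / \<delta>) * (lt T * L) \<le> 2 * Y"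
      using rY unfolding restX .
    show "4 * Y + pi / 2 * Y \<le> 2 * pi * Y"
    proof -
      have "(4 + pi / 2) * Y \<le> (2 * pi) * Y" using pi_gt3 Y0 by (intro mult_right_mono) auto
      then show ?thesis by (simp add: distrib_right)
    qed
  qed (use main2 main3 main4 main5 xq in auto)
  then have "\<delta> * \<epsilon> / 2 * (L\<^sup>2 * sqrt X) \<le> G" by (simp add: Y_def S_def mult_ac)
  then show ?thesis unfolding G_def by (rule that[OF u])
qed

section \<open>Counting the separated points\<close>

lemma abs_ln_diff_ge:
  fixes a a' B :: real
  assumes "0 < a" "0 < a'" "a \<le> B" "a' \<le> B"
  shows "\<bar>a - a'\<bar> / B \<le> \<bar>ln a - ln a'\<bar>"
proof -
  have *: "(q - p) / B \<le> ln q - ln p" if "0 < p" "p \<le> q" "q \<le> B" for p q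
  proof -
    have "(q - p) / B \<le> (q - p) / q" using that by (intro divide_left_mono) (auto intro: mult_pos_pos)
    also have "\<dots> = 1 - p / q" using that by (simp add: diff_divide_distrib)
    also have "\<dots> \<le> - ln (p / q)" using ln_le_minus_one[of "p / q"] that by simp
    also have "\<dots> = ln q - ln p" using that by (simp add: ln_div)
    finally show ?thesis .
  qed
  show ?thesis
  proof (cases "a \<le> a'")
    case True
    then show ?thesis using *[of a a'] assms by simp
  next
    case False
    then show ?thesis using *[of a' a] assms by simp
  qed
qed

text \<open>The moved points lie between \<open>X / 2\<close> and \<open>3 * X\<close>, so their
  logarithms differ by at most \<open>ln 6\<close>; this must not exceed the bound 2 on
  \<open>\<bar>y\<bar>\<close> in \<open>ReG_off\<close>.\<close>

lemma ln_6_le: "ln 6 \<le> (2::real)"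
proof -
  have "5/2 \<le> exp (1::real)" using exp_lower_Taylor_quadratic[of "1::real"] by simp
  then have "(5/2) * (5/2) \<le> exp 1 * exp (1::real)" by (intro mult_mono) auto
  also have "\<dots> = exp 2" by (simp flip: exp_add)
  finally have "6 \<le> exp (2::real)" by simp
  then show ?thesis using ln_mono[of 6 "exp (2::real)"] by simp
qed

text \<open>\<open>large_values\<close> is applied with \<open>M = 3 * sqrt X\<close>,
  \<open>P = 5 * L\<^sup>2\<close> and \<open>Off = c * L\<close>. The pairs are weaker than the
  diagonal by a factor of order \<open>L\<close>, so for large \<open>L\<close> they are absorbed on
  the left, and \<open>X\<close> drops out of the bound.\<close>

lemma card_bound:
  fixes X \<epsilon> \<delta> :: real
  assumes RH: riemann_hypothesis and e: "0 < \<epsilon>" "\<epsilon> < 1/100" and d: "0 < \<delta>" "\<delta> < 1/100"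
  defines "L \<equiv> ln X" and "\<tau> \<equiv> sqrt (2 * pi * \<epsilon>)"
  defines "h \<equiv> \<delta> * \<epsilon> / 4 * (sqrt X * L\<^sup>2)" and "c \<equiv> 14 + K1 * (2 / \<delta> + 4)"
  assumes X: "X \<ge> 4" "L \<ge> 1" and h: "1 \<le> h" "h \<le> X / 2" and rest: "restf \<delta> X \<le> 2 * \<delta> * \<epsilon> * (L\<^sup>2 * sqrt X)"
    and T03: "3 \<le> X powr ((1 - \<delta>) * \<tau>)" and gap: "6 \<le> X powr (\<delta> * \<tau>)" and sep: "4 * (sqrt X * L\<^sup>2) \<le> X powr (7/10)"
    and L8: "c \<le> L" and Lc: "360 * c \<le> (\<epsilon> * \<delta>)\<^sup>2 * L"
    and F: "finite F" "F \<noteq> {}" "F \<subseteq> {X..2 * X}"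
    and sepF: "\<And>x x'. x \<in> F \<Longrightarrow> x' \<in> F \<Longrightarrow> x \<noteq> x' \<Longrightarrow> X powr (1 - (1 - 2 * \<delta>) * \<tau>) \<le> \<bar>x - x'\<bar>"
    and dev: "\<And>x. x \<in> F \<Longrightarrow> \<bar>chebyshev_psi x - x\<bar> \<ge> \<epsilon> * (ln x)\<^sup>2 * sqrt x"
  shows "real (card F) \<le> 1800 / (\<epsilon> * \<delta>)\<^sup>2"
proof -
  define b T0 T where "b = \<delta> / (2 * L)" and "T0 = X powr ((1 - \<delta>) * \<tau>)" and "T = X ^ 4"
  define I where "I = (\<lambda>u. \<bar>Re (integral {T0..T} (\<lambda>t. of_real (ReG (1/2 + b) t) * upow u (Complex (1/2 + b) t)))\<bar>)"
  note loc = localized[OF RH e d, of X, folded L_def \<tau>_def, folded b_def h_def T_def T0_def, OF X h rest]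
  have "\<exists>u. \<forall>x\<in>F. \<bar>u x - x\<bar> \<le> h \<and> \<delta> * \<epsilon> / 2 * (L\<^sup>2 * sqrt X) \<le> I (u x)"
  proof (rule bchoice, rule ballI)
    fix x assume x: "x \<in> F"
    then have x': "X \<le> x" "x \<le> 2 * X" using F by auto
    obtain v where "\<bar>v - x\<bar> \<le> h" "\<delta> * \<epsilon> / 2 * (L\<^sup>2 * sqrt X) \<le>
        \<bar>Re (integral {T0..T} (\<lambda>t. of_real (ReG (1/2 + b) t) * upow v (Complex (1/2 + b) t)))\<bar>"
      by (rule loc[OF x' dev[OF x]])
    then show "\<exists>u. \<bar>u - x\<bar> \<le> h \<and> \<delta> * \<epsilon> / 2 * (L\<^sup>2 * sqrt X) \<le> I u" unfolding I_def by blast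
  qed
  then obtain u where u: "\<And>x. x \<in> F \<Longrightarrow> \<bar>u x - x\<bar> \<le> h" "\<And>x. x \<in> F \<Longrightarrow> \<delta> * \<epsilon> / 2 * (L\<^sup>2 * sqrt X) \<le> I (u x)" by blast
  \<comment> \<open>With \<open>\<epsilon> < 1/100\<close> one has
    \<open>2 * pi * \<epsilon> < 9/100\<close>. The separation is then at least
    \<open>X powr (7/10)\<close>, well above the shifts by \<open>h\<close>, which are
    \<open>sqrt X\<close> up to logarithms.\<close>
  have \<tau>: "0 < \<tau>" "\<tau> \<le> 3/10"
  proof -
    show "0 < \<tau>" using e by (simp add: \<tau>_def)
    have "2 * pi * \<epsilon> \<le> 2 * 4 * (1/100)" using e pi_less_4 by (intro mult_mono) auto
    then have "\<tau> \<le> sqrt ((3/10)\<^sup>2)" unfolding \<tau>_def by (intro real_sqrt_le_mono) (simp add: power2_eq_square)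
    then show "\<tau> \<le> 3/10" by simp
  qed
  have b: "0 < b" "b \<le> 1/8" "b * (2 * L) = \<delta>" "1 / b = 2 * L / \<delta>" using d X by (auto simp: b_def field_simps)
  have T0T: "3 \<le> T0" "T0 \<le> T"
  proof -
    show "3 \<le> T0" using T03 by (simp add: T0_def)
    have "(1 - \<delta>) * \<tau> \<le> 1 * 1" using d \<tau> by (intro mult_mono) auto
    then have "T0 \<le> X powr 1" unfolding T0_def using X by (intro powr_mono) auto
    also have "\<dots> \<le> T" using X self_le_power[of X 4] by (simp add: T_def)
    finally show "T0 \<le> T" .
  qed
  have lnT: "ln T = 4 * L" using X by (simp add: T_def L_def ln_realpow)
  have K: "0 \<le> K1" "14 \<le> c" using K1_ge d by (auto simp: c_def)
  have Kc: "K1 * (1 / b + ln T) = (c - 14) * L" unfolding b(4) lnT c_def by (simp add: algebra_simps)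
  have ub: "0 < u x" "X / 2 \<le> u x" "u x \<le> 3 * X" if "x \<in> F" for x
  proof -
    have "X \<le> x" "x \<le> 2 * X" using that F by auto
    then show "0 < u x" "X / 2 \<le> u x" "u x \<le> 3 * X" using u(1)[OF that] h X by linarith+
  qed
  have M: "u x powr (1/2 + b) \<le> 3 * sqrt X" if x: "x \<in> F" for x
  proof -
    have "3 * X \<le> X * X" using X by (intro mult_right_mono) auto
    then have "u x \<le> X * X" using ub[OF x] by linarith
    then have "ln (u x) \<le> ln (X * X)" using ub[OF x] X by (subst ln_le_cancel_iff) auto
    then have "b * ln (u x) \<le> b * (2 * L)" using X b by (intro mult_left_mono) (auto simp: L_def ln_mult_pos)
    then have "u x powr b \<le> exp \<delta>" using b ub[OF x] by (simp add: powr_def)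
    moreover have "exp \<delta> * (2/3) \<le> exp \<delta> * (1 - \<delta>)" using d by (intro mult_left_mono) auto
    ultimately have "u x powr b \<le> 3/2" using exp_one_minus[of \<delta>] d by linarith
    moreover have "sqrt (u x) \<le> sqrt (4 * X)" using ub[OF x] X by (intro real_sqrt_le_mono) linarith
    then have "sqrt (u x) \<le> 2 * sqrt X" by (simp add: real_sqrt_mult)
    ultimately have "sqrt (u x) * u x powr b \<le> (2 * sqrt X) * (3/2)" using ub[OF x] X by (intro mult_mono) auto
    then show ?thesis using ub[OF x] by (simp add: powr_add powr_half_sqrt)
  qed
  have P: "integral {T0..T} (\<lambda>t. ReG (1/2 + b) t / t) \<le> 5 * L\<^sup>2"
  proof -
    have co: "(\<lambda>t. ReG (1/2 + b) t / t) integrable_on {a..T}" if "1 \<le> a" for a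
      by (intro integrable_continuous_real continuous_intros ReG_cont[OF RH]) (use b that in auto)
    \<comment> \<open>Positivity of the density allows the range to be extended down to 1, where
      \<open>ReG_diag\<close> starts.\<close>
    have "integral {T0..T} (\<lambda>t. ReG (1/2 + b) t / t) \<le> integral {1..T} (\<lambda>t. ReG (1/2 + b) t / t)"
      using T0T b by (intro integral_subset_le co) (auto intro!: divide_nonneg_nonneg ReG_nonneg[OF RH])
    also have "\<dots> \<le> (ln T)\<^sup>2 / 4 + 8 + K1 * (1 / b + ln T)" using T0T by (intro ReG_diag[OF RH b(1,2)]) auto
    also have "\<dots> = 4 * L\<^sup>2 + 8 + (c - 14) * L" unfolding Kc unfolding lnT by (simp add: power_mult_distrib)
    also have "\<dots> \<le> 4 * L\<^sup>2 + c * L" using X by (simp add: left_diff_distrib)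
    also have "\<dots> \<le> 5 * L\<^sup>2" using mult_right_mono[OF L8, of L] X by (simp add: power2_eq_square)
    finally show ?thesis .
  qed
  have Off: "\<bar>integral {T0..T} (\<lambda>t. ReG (1/2 + b) t * cos (t * (ln (u x) - ln (u x'))) / t)\<bar> \<le> c * L"
    if x: "x \<in> F" "x' \<in> F" "x \<noteq> x'" for x x'
  proof -
    define y where "y = ln (u x) - ln (u x')"
    define s where "s = X powr (1 - (1 - 2 * \<delta>) * \<tau>)"
    have "(1 - 2 * \<delta>) * \<tau> \<le> 1 * (3/10)" using d \<tau> by (intro mult_mono) auto
    then have "X powr (7/10) \<le> s" unfolding s_def using X by (intro powr_mono) auto
    moreover have "h \<le> 1 * (sqrt X * L\<^sup>2)"
    proof -
      have "\<delta> * \<epsilon> \<le> 1 * 1" using d e by (intro mult_mono) auto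
      then show ?thesis unfolding h_def using X by (intro mult_right_mono) auto
    qed
    ultimately have "4 * h \<le> s" using sep by linarith
    then have "s / 2 \<le> \<bar>u x - u x'\<bar>" using sepF[OF x] u(1)[OF x(1)] u(1)[OF x(2)] unfolding s_def by linarith
    then have "s / 2 / (3 * X) \<le> \<bar>u x - u x'\<bar> / (3 * X)" using X by (intro divide_right_mono) auto
    also have "\<dots> \<le> \<bar>y\<bar>" unfolding y_def using ub[OF x(1)] ub[OF x(2)] by (intro abs_ln_diff_ge) auto
    finally have y1: "s / (6 * X) \<le> \<bar>y\<bar>" by simp
    \<comment> \<open>The exponent of \<open>T0\<close> exceeds the one subtracted in the separation
      by \<open>\<delta> * \<tau>\<close>. This margin lets the frequencies above \<open>T0\<close>
      resolve the points.\<close>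
    have "T0 * s = X * X powr (\<delta> * \<tau>)" unfolding T0_def s_def using X
      by (simp add: powr_add[symmetric] powr_mult_base algebra_simps)
    then have "T0 * (s / (6 * X)) = X powr (\<delta> * \<tau>) / 6" using X by simp
    then have "1 \<le> T0 * (s / (6 * X))" using gap by simp
    also have "\<dots> \<le> T0 * \<bar>y\<bar>" using y1 T0T by (intro mult_left_mono) auto
    finally have y2: "1 \<le> T0 * \<bar>y\<bar>" .
    have *: "ln (u a) - ln (u a') \<le> 2" if a: "a \<in> F" "a' \<in> F" for a a'
    proof -
      have "ln (u a) - ln (u a') = ln (u a / u a')" using ub[OF a(1)] ub[OF a(2)] by (simp add: ln_div)
      also have "\<dots> \<le> ln 6" using ub[OF a(1)] ub[OF a(2)] by (intro ln_mono) (auto simp: divide_le_eq)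
      finally show ?thesis using ln_6_le by simp
    qed
    have "\<bar>y\<bar> \<le> 2" using *[OF x(1,2)] *[OF x(2,1)] by (simp add: y_def)
    then have "\<bar>integral {T0..T} (\<lambda>t. ReG (1/2 + b) t * cos (t * y) / t)\<bar> \<le> ln T + 10 + K1 * (1 / b + ln T)"
      using y2 T0T by (intro ReG_off[OF RH b(1,2)])
    also have "\<dots> = c * L - 10 * L + 10" unfolding Kc unfolding lnT by (simp add: algebra_simps)
    also have "\<dots> \<le> c * L" using X by simp
    finally show ?thesis unfolding y_def .
  qed
  define R where "R = real (card F)"
  define S where "S = sqrt X"
  have S: "S > 0" using X by (simp add: S_def)
  have "R * (\<delta> * \<epsilon> / 2 * (L\<^sup>2 * sqrt X))\<^sup>2 \<le> 5 * L\<^sup>2 * (3 * sqrt X)\<^sup>2 * (5 * L\<^sup>2 + R * (c * L))"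
    unfolding R_def
  proof (rule large_values[where u = u and b = b and ?T1.0 = T0 and ?T2.0 = T])
    show "\<delta> * \<epsilon> / 2 * (L\<^sup>2 * sqrt X) \<le> \<bar>Re (integral {T0..T} (\<lambda>t. of_real (ReG (1/2 + b) t) * upow (u x) (Complex (1/2 + b) t)))\<bar>"
      if "x \<in> F" for x using u(2)[OF that] by (simp add: I_def)
  qed (use RH b T0T F ub M P Off d e X K in auto)
  moreover have "R * (\<delta> * \<epsilon> / 2 * (L\<^sup>2 * sqrt X))\<^sup>2 = (L\<^sup>2 * S)\<^sup>2 * (R * (\<epsilon> * \<delta>)\<^sup>2 / 4)"
    by (simp add: S_def power_mult_distrib power_divide)
  \<comment> \<open>The 225 is \<open>5 * 9 * 5\<close> from the diagonal and the 45 is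
    \<open>5 * 9\<close> from the pairs.\<close>
  moreover have "5 * L\<^sup>2 * (3 * sqrt X)\<^sup>2 * (5 * L\<^sup>2 + R * (c * L)) = (L\<^sup>2 * S)\<^sup>2 * (225 + 45 * R * (c / L))"
  proof -
    define w where "w = c / L"
    have "c = w * L" using X by (simp add: w_def)
    then show ?thesis unfolding w_def[symmetric] S_def[symmetric] by (simp add: power_mult_distrib power2_eq_square algebra_simps)
  qed
  ultimately have "(L\<^sup>2 * S)\<^sup>2 * (R * (\<epsilon> * \<delta>)\<^sup>2 / 4) \<le> (L\<^sup>2 * S)\<^sup>2 * (225 + 45 * R * (c / L))" by (simp only:)
  then have "R * (\<epsilon> * \<delta>)\<^sup>2 / 4 \<le> 225 + 45 * R * (c / L)"
    using X S by (simp add: mult_le_cancel_left)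
  \<comment> \<open>By the 360, which is \<open>45 * 8\<close>, the pairs use up at most half of the
    left-hand side; the remaining half gives \<open>1800 = 8 * 225\<close>.\<close>
  moreover have "45 * R * (c / L) \<le> R * (\<epsilon> * \<delta>)\<^sup>2 / 8"
  proof -
    have "c / L \<le> (\<epsilon> * \<delta>)\<^sup>2 / 360" using Lc X by (simp add: divide_le_eq)
    then have "45 * R * (c / L) \<le> 45 * R * ((\<epsilon> * \<delta>)\<^sup>2 / 360)" by (intro mult_left_mono) (auto simp: R_def)
    then show ?thesis by simp
  qed
  ultimately have "R * (\<epsilon> * \<delta>)\<^sup>2 \<le> 1800" by linarith
  then show ?thesis using d e by (simp add: R_def le_divide_eq)
qed

lemma eventually_sufficiently_large:
  fixes \<epsilon> \<delta> c :: real
  assumes "0 < \<epsilon>" "0 < \<delta>" "\<delta> < 1"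
  defines "\<tau> \<equiv> sqrt (2 * pi * \<epsilon>)"
  shows "eventually (\<lambda>X. X \<ge> 4 \<and> ln X \<ge> 1 \<and> 1 \<le> \<delta> * \<epsilon> / 4 * (sqrt X * (ln X)\<^sup>2) \<and> \<delta> * \<epsilon> / 4 * (sqrt X * (ln X)\<^sup>2) \<le> X / 2
    \<and> 3 \<le> X powr ((1 - \<delta>) * \<tau>) \<and> 6 \<le> X powr (\<delta> * \<tau>) \<and> 4 * (sqrt X * (ln X)\<^sup>2) \<le> X powr (7/10)
    \<and> c \<le> ln X \<and> 360 * c \<le> (\<epsilon> * \<delta>)\<^sup>2 * ln X) at_top"
proof -
  \<comment> \<open>The compound parameters are renamed so that the asymptotic statements contain
    only constants known to be positive.\<close>
  define a where "a = \<delta> * \<epsilon> / 4"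
  define k where "k = (\<epsilon> * \<delta>)\<^sup>2"
  define p q where "p = (1 - \<delta>) * \<tau>" and "q = \<delta> * \<tau>"
  have pos: "0 < a" "0 < k" "0 < p" "0 < q" using assms by (auto simp: a_def k_def p_def q_def \<tau>_def)
  show ?thesis
    unfolding a_def[symmetric] k_def[symmetric] p_def[symmetric] q_def[symmetric]
  proof (intro eventually_conj)
    have "filterlim (\<lambda>X::real. ln X) at_top at_top" by (rule ln_at_top)
    then show "eventually (\<lambda>X. c \<le> ln X) at_top" "eventually (\<lambda>X::real. 1 \<le> ln X) at_top"
      unfolding filterlim_at_top by blast+
    have "filterlim (\<lambda>X. k * ln X) at_top at_top" using pos by real_asymp
    then show "eventually (\<lambda>X. 360 * c \<le> k * ln X) at_top" unfolding filterlim_at_top by blast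
    have "filterlim (\<lambda>X::real. X powr p) at_top at_top" "filterlim (\<lambda>X::real. X powr q) at_top at_top" using pos by real_asymp+
    then show "eventually (\<lambda>X. 3 \<le> X powr p) at_top" "eventually (\<lambda>X. 6 \<le> X powr q) at_top"
      unfolding filterlim_at_top by blast+
  qed (use pos in real_asymp)+
qed

theorem theorem2:
  assumes "riemann_hypothesis"
  shows "\<exists>C c0 :: real. C > 0 \<and> c0 > 0 \<and>
    (\<forall>\<epsilon> \<delta> :: real. 0 < \<epsilon> \<and> \<epsilon> < c0 \<and> 0 < \<delta> \<and> \<delta> < c0 \<longrightarrow>
      (\<exists>X0 :: real. \<forall>X \<ge> X0. \<forall>S :: real set.
         S \<subseteq> {X..2 * X} \<and>
         (\<forall>x\<in>S. \<forall>x'\<in>S. x \<noteq> x' \<longrightarrow>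
            \<bar>x - x'\<bar> \<ge> X powr (1 - (1 - 2 * \<delta>) * sqrt (2 * pi * \<epsilon>))) \<and>
         (\<forall>x\<in>S. \<bar>chebyshev_psi x - x\<bar> \<ge> \<epsilon> * (ln x)\<^sup>2 * sqrt x) \<longrightarrow>
         finite S \<and> real (card S) \<le> exp (C / (\<epsilon> * \<delta>)\<^sup>2)))"
proof (rule exI[of _ 1800], rule exI[of _ "1/100"], intro conjI allI impI)
  fix \<epsilon> \<delta> :: real
  assume "0 < \<epsilon> \<and> \<epsilon> < 1/100 \<and> 0 < \<delta> \<and> \<delta> < 1/100"
  then have e: "0 < \<epsilon>" "\<epsilon> < 1/100" and d: "0 < \<delta>" "\<delta> < 1/100" by auto
  \<comment> \<open>\<open>card_bound\<close> already gives the count \<open>N\<close>; the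
    exponential bound follows from the much weaker \<open>N \<le> exp N\<close>.\<close>
  define N where "N = 1800 / (\<epsilon> * \<delta>)\<^sup>2"
  have N0: "0 \<le> N" by (simp add: N_def)
  have "0 < 2 * \<delta> * \<epsilon>" "\<delta> < 1" using e d by auto
  note ev = restf_small[OF this(1), of \<delta>] eventually_sufficiently_large[OF e(1) d(1) this(2), of "14 + K1 * (2 / \<delta> + 4)"]
  from ev have "eventually (\<lambda>X. \<forall>S. S \<subseteq> {X..2 * X} \<and>
         (\<forall>x\<in>S. \<forall>x'\<in>S. x \<noteq> x' \<longrightarrow>
            \<bar>x - x'\<bar> \<ge> X powr (1 - (1 - 2 * \<delta>) * sqrt (2 * pi * \<epsilon>))) \<and>
         (\<forall>x\<in>S. \<bar>chebyshev_psi x - x\<bar> \<ge> \<epsilon> * (ln x)\<^sup>2 * sqrt x) \<longrightarrow>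
         finite S \<and> real (card S) \<le> exp N) at_top"
  proof eventually_elim
    case (elim X)
    show ?case
    proof (intro allI impI)
      fix S assume S: "S \<subseteq> {X..2 * X} \<and>
         (\<forall>x\<in>S. \<forall>x'\<in>S. x \<noteq> x' \<longrightarrow>
            \<bar>x - x'\<bar> \<ge> X powr (1 - (1 - 2 * \<delta>) * sqrt (2 * pi * \<epsilon>))) \<and>
         (\<forall>x\<in>S. \<bar>chebyshev_psi x - x\<bar> \<ge> \<epsilon> * (ln x)\<^sup>2 * sqrt x)"
      \<comment> \<open>Finite subsets come first. Their bound is uniform, so \<open>S\<close>
        cannot be infinite, as it would then have finite subsets of any size.\<close>
      have fin: "real (card F) \<le> N" if F: "finite F" "F \<subseteq> S" for F
      proof (cases "F = {}")
        case False
        have "X powr (1 - (1 - 2 * \<delta>) * sqrt (2 * pi * \<epsilon>)) \<le> \<bar>x - x'\<bar>" if "x \<in> F" "x' \<in> F" "x \<noteq> x'" for x x'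
          using S F that by blast
        moreover have "F \<subseteq> {X..2 * X}" "\<And>x. x \<in> F \<Longrightarrow> \<epsilon> * (ln x)\<^sup>2 * sqrt x \<le> \<bar>chebyshev_psi x - x\<bar>" using S F by blast+
        ultimately show ?thesis unfolding N_def using F(1) False elim
          by (intro card_bound[OF assms e d, of X F]) blast+
      qed (use N0 in simp)
      have "finite S"
      proof (rule ccontr)
        assume "infinite S"
        then obtain F where F: "finite F" "card F = nat \<lceil>N\<rceil> + 1" "F \<subseteq> S" using infinite_arbitrarily_large by blast
        show False using fin[OF F(1,3)] F(2) by linarith
      qed
      moreover have "N \<le> exp N" using exp_ge_add_one_self[of N] by linarith
      ultimately show "finite S \<and> real (card S) \<le> exp N" using fin[of S] by simp
    qed
  qed
  then show "\<exists>X0. \<forall>X\<ge>X0. \<forall>S. S \<subseteq> {X..2 * X} \<and>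
         (\<forall>x\<in>S. \<forall>x'\<in>S. x \<noteq> x' \<longrightarrow>
            \<bar>x - x'\<bar> \<ge> X powr (1 - (1 - 2 * \<delta>) * sqrt (2 * pi * \<epsilon>))) \<and>
         (\<forall>x\<in>S. \<bar>chebyshev_psi x - x\<bar> \<ge> \<epsilon> * (ln x)\<^sup>2 * sqrt x) \<longrightarrow>
         finite S \<and> real (card S) \<le> exp (1800 / (\<epsilon> * \<delta>)\<^sup>2)"
    unfolding eventually_at_top_linorder N_def .
qed auto

end
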